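(* There exists no curve $C \subset \mathbb{CP}^2$ of degree $5$ with four singularities whose link is a torus knot $T(2,3)$ and one singularity whose link is the torus knot $T(2,5)$.
   Context: A curve is a reduced plane projective complex curve, i.e. the zero-set $C = \{f = 0\} \subset \mathbb{CP}^2$ of a (non-constant) homogeneous square-free polynomial $f \in \mathbb{C}[x,y,z]$ (not necessarily irreducible); its degree is $\deg f$. A point $p\in C$ is singular if $\nabla f(p)=0$. The link of the singularity of $C$ at $p$ is the link $C \cap S_\varepsilon \subset S_\varepsilon \cong S^3$, where $S_\varepsilon$ is a sphere of sufficiently small radius centred at $p$ in an affine chart, considered up to isotopy. $T(2,2k+1)$ is the (positive) torus knot which is the link of the singularity of $\{x^2 = y^{2k+1}\} \subset \mathbb{C}^2$ at the origin. *)

theory Defs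
  imports
    "HOL-Analysis.Analysis"
    "HOL-Computational_Algebra.Polynomial_Factorial"
    "HOL-Computational_Algebra.Squarefree"
begin

(* C[x,y,z] is represented by complex poly poly poly: the outermost variable is x and the
   innermost one is z, so coeff (coeff (coeff f i) j) k is the coefficient of x^i y^j z^k. *)
type_synonym poly3 = "complex poly poly poly"

definition eval3 :: "poly3 \<Rightarrow> complex^3 \<Rightarrow> complex" where
  "eval3 f v = poly (poly (poly f [:[:v $ 1:]:]) [:v $ 2:]) (v $ 3)"

definition homogeneous :: "nat \<Rightarrow> poly3 \<Rightarrow> bool" where
  "homogeneous d f \<longleftrightarrow> (\<forall>i j k. coeff (coeff (coeff f i) j) k \<noteq> 0 \<longrightarrow> i + j + k = d)"

definition gradient :: "poly3 \<Rightarrow> complex^3 \<Rightarrow> complex^3" where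
  "gradient f v =
     vector [eval3 (pderiv f) v, eval3 (map_poly pderiv f) v, eval3 (map_poly (map_poly pderiv) f) v]"

(* A point of the projective plane is a line through the origin of C^3. *)
definition CP2 :: "(complex^3) set set" where
  "CP2 = {vec.span {v} | v. v \<noteq> 0}"

definition zero_locus :: "poly3 \<Rightarrow> (complex^3) set set" where
  "zero_locus f = {p \<in> CP2. \<forall>v\<in>p. eval3 f v = 0}"

(* squarefree 0 is false, so f is nonzero and d is its degree; 0 < d makes f non-constant. *)
definition plane_curve :: "nat \<Rightarrow> poly3 \<Rightarrow> (complex^3) set set \<Rightarrow> bool" where
  "plane_curve d f C \<longleftrightarrow> 0 < d \<and> homogeneous d f \<and> squarefree f \<and> C = zero_locus f"

definition singular_points :: "poly3 \<Rightarrow> (complex^3) set set" where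
  "singular_points f = {p \<in> zero_locus f. \<forall>v\<in>p. gradient f v = 0}"

(* For a basis v, a, b of C^3, the map (s,t) |-> [v + s a + t b] is the inverse of an affine
   chart centred at [v]; its image is the complement of the line through [a] and [b]. *)
definition affine_chart_at :: "(complex^3) set \<Rightarrow> complex^3 \<Rightarrow> complex^3 \<Rightarrow> complex^3 \<Rightarrow> bool" where
  "affine_chart_at p v a b \<longleftrightarrow> p = vec.span {v} \<and> vec.span {v, a, b} = UNIV"

definition in_chart ::
  "(complex^3) set set \<Rightarrow> complex^3 \<Rightarrow> complex^3 \<Rightarrow> complex^3 \<Rightarrow> (complex \<times> complex) set" where
  "in_chart C v a b = {(s, t). vec.span {v + s *s a + t *s b} \<in> C}"

(* The sphere of radius r about 0 is identified with the unit sphere by scaling. *)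
definition link_at_radius :: "(complex \<times> complex) set \<Rightarrow> real \<Rightarrow> (complex \<times> complex) set" where
  "link_at_radius V r = (\<lambda>w. w /\<^sub>R r) ` (V \<inter> sphere 0 r)"

(* Isotopy of links means ambient isotopy; isotopy through embeddings of the link alone
   would make all knots trivial in the topological category. *)
definition ambient_isotopic :: "'a::topological_space set \<Rightarrow> 'a set \<Rightarrow> 'a set \<Rightarrow> bool" where
  "ambient_isotopic S K L \<longleftrightarrow>
     (\<exists>h. homotopic_with_canon (\<lambda>\<phi>. \<exists>\<psi>. homeomorphism S S \<phi> \<psi>) S S id h \<and> h ` K = L)"

definition same_link :: "(complex \<times> complex) set \<Rightarrow> (complex \<times> complex) set \<Rightarrow> bool" where
  "same_link V W \<longleftrightarrow>
     (\<exists>\<epsilon>>0. \<forall>r s. 0 < r \<and> r < \<epsilon> \<and> 0 < s \<and> s < \<epsilon> \<longrightarrow>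
        ambient_isotopic (sphere 0 1) (link_at_radius V r) (link_at_radius W s))"

(* For odd n, T(2,n) is by definition the link at the origin of {x^2 = y^n}. *)
definition has_link_T2 :: "(complex^3) set set \<Rightarrow> (complex^3) set \<Rightarrow> nat \<Rightarrow> bool" where
  "has_link_T2 C p n \<longleftrightarrow>
     (\<exists>v a b. affine_chart_at p v a b \<and> same_link (in_chart C v a b) {(x, y). x\<^sup>2 = y ^ n})"

end

theory Submission
  imports Defs "HOL-Computational_Algebra.Field_as_Ring"
begin

text \<open>
  A link \<open>T(2,k)\<close> with \<open>k\<close> odd is connected, so at each of the five points the quadratic part of the
  equation is the square of a linear form, and at \<open>q\<close> the curve is not a tacnode. Moreover \<open>q\<close> is not
  an ordinary cusp: the complement of \<open>T(2,5)\<close> carries a circle action whose generic orbit has linking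
  number 10 with the knot, so the tenth power of its monodromy is isotopic to the identity, whereas
  the monodromy of a cusp has order 6.

  Now project from \<open>q\<close>. If \<open>q\<close> is a double point, the equation is a cubic in the projection variable whose
  discriminant is a binary form of degree 14. Each of the four cusps contributes a triple root, and so
  does the tangent at \<open>q\<close>; since \<open>5 * 3 > 14\<close> the discriminant vanishes, contradicting
  squarefreeness. If \<open>q\<close> is a triple point, the discriminant has degree 8 and \<open>4 * 3 > 8\<close>; higher
  multiplicities, and coincidences between the lines through \<open>q\<close>, are excluded by Bezout.
\<close>

section \<open>The circle action on the complement of T(2,5)\<close>

text \<open>The delta invariants 1, 1, 1, 1, 2 add up to 6, the arithmetic genus of a plane quintic,
  so the genus formula is satisfied and gives no contradiction. Counting roots of the discriminant
  is Riemann-Hurwitz for the projection from \<open>q\<close>, in a form that asks neither for a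
  normalization nor for irreducibility. The tangent at \<open>q\<close> counts as a triple root
  because of two identities for the coefficients of the germ at \<open>q\<close>: the cubic term
  along the tangent vanishes, and so does the tacnode discriminant. The first is the hard one: the
  links of a cusp and T(2,5) are both connected, so connectedness cannot tell them apart. Moreover,
  links are compared by a homeomorphism of spheres that need not respect any fibration, and the cusp
  germ is known only up to terms of higher order. Therefore the circle action is used on the exact
  model T(2,5), estimates are used on the cusp side, and all winding numbers are increments of
  continuous logarithms on convex sets.\<close>

lemma exp_eq_one_constant:
  fixes d :: "'a::topological_space \<Rightarrow> complex"
  assumes "connected S" "continuous_on S d" "\<And>x. x \<in> S \<Longrightarrow> exp (d x) = 1"
  shows "\<exists>n::int. \<forall>x\<in>S. d x = 2 * pi * \<i> * n"
proof (cases "S = {}")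
  case True
  then show ?thesis by blast
next
  case False
  then obtain a where a: "a \<in> S" by blast
  have form: "\<exists>n::int. d x = 2 * pi * \<i> * n" if "x \<in> S" for x
  proof -
    from assms(3)[OF that] obtain n :: int where "Re (d x) = 0" "Im (d x) = of_int (2 * n) * pi"
      unfolding exp_eq_1 by blast
    then show ?thesis by (intro exI[of _ n]) (simp add: complex_eq_iff)
  qed
  have "d constant_on S"
  proof (rule continuous_discrete_range_constant[OF assms(1,2)])
    fix x assume x: "x \<in> S"
    show "\<exists>e>0. \<forall>y. y \<in> S \<and> d y \<noteq> d x \<longrightarrow> e \<le> norm (d y - d x)"
    proof (intro exI[of _ "2*pi"] conjI allI impI)
      fix y assume y: "y \<in> S \<and> d y \<noteq> d x"
      obtain n k :: int where n: "d x = 2 * pi * \<i> * n" and k: "d y = 2 * pi * \<i> * k"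
        using form x y by metis
      then have "k \<noteq> n" using y by auto
      then have "1 \<le> \<bar>real_of_int (k - n)\<bar>" by linarith
      moreover have "d y - d x = 2 * pi * \<i> * of_int (k - n)" by (simp add: n k algebra_simps)
      then have "norm (d y - d x) = 2 * pi * \<bar>real_of_int (k - n)\<bar>"
        by (simp add: norm_mult del: of_int_diff)
      ultimately show "2*pi \<le> norm (d y - d x)" by simp
    qed simp
  qed
  then obtain z where z: "\<And>x. x \<in> S \<Longrightarrow> d x = z" unfolding constant_on_def by blast
  obtain n :: int where "d a = 2 * pi * \<i> * n" using form a by blast
  then show ?thesis using z a by metis
qed

text \<open>Uniqueness of lifts through exp. Winding numbers below are increments of continuous
  logarithms, and this makes them independent of the logarithm chosen.\<close>

lemma logs_differ_by_constant:
  fixes b b' :: "'a::topological_space \<Rightarrow> complex"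
  assumes "connected S" "continuous_on S b" "continuous_on S b'"
    and "\<And>x. x \<in> S \<Longrightarrow> exp (b x) = exp (b' x)" "x \<in> S" "y \<in> S"
  shows "b x - b' x = b y - b' y"
proof -
  have "continuous_on S (\<lambda>x. b x - b' x)" by (intro continuous_intros assms)
  then have "\<exists>n::int. \<forall>x\<in>S. b x - b' x = 2 * pi * \<i> * n"
    by (rule exp_eq_one_constant[OF assms(1)]) (simp add: exp_diff assms(4))
  then show ?thesis using assms(5,6) by metis
qed

lemma continuous_log_on_convex:
  fixes f :: "'a::real_normed_vector \<Rightarrow> complex"
  assumes "convex S" "continuous_on S f" "\<And>x. x \<in> S \<Longrightarrow> f x \<noteq> 0"
  obtains g where "continuous_on S g" "\<And>x. x \<in> S \<Longrightarrow> exp (g x) = f x"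
  using continuous_logarithm_on_contractible[OF assms(2) convex_imp_contractible[OF assms(1)]] assms(3)
  by metis

text \<open>The weights 5 and 2 turn \<open>fst p ^ 2\<close> and \<open>snd p ^ 5\<close> by the
  same angle \<open>10 * \<eta>\<close>. So T(2,5) and the spheres are preserved, and
  \<open>G25\<close> winds ten times along an orbit off the knot.\<close>

definition rot :: "real \<Rightarrow> complex \<times> complex \<Rightarrow> complex \<times> complex" where
  "rot \<eta> p = (cis (5 * \<eta>) * fst p, cis (2 * \<eta>) * snd p)"

definition G25 :: "complex \<times> complex \<Rightarrow> complex" where
  "G25 p = fst p ^ 2 - snd p ^ 5"

lemma G25_rot [simp]: "G25 (rot \<eta> p) = cis (10 * \<eta>) * G25 p"
proof -
  have "cis (5 * \<eta>) ^ 2 = cis (10 * \<eta>)" "cis (2 * \<eta>) ^ 5 = cis (10 * \<eta>)"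
    by (simp_all add: Complex.DeMoivre)
  then show ?thesis by (simp add: G25_def rot_def power_mult_distrib algebra_simps)
qed

lemma rot_rot [simp]: "rot \<eta> (rot \<xi> p) = rot (\<eta> + \<xi>) p"
  by (simp add: rot_def cis_mult mult.assoc[symmetric] distrib_left)

lemma rot_0 [simp]: "rot 0 p = p"
  by (simp add: rot_def)

lemma rot_2pi: "rot (\<eta> + 2 * pi * of_int j) p = rot \<eta> p"
proof -
  have per: "cis (of_int n * (\<eta> + 2 * pi * of_int j)) = cis (of_int n * \<eta>)" for n :: int
  proof -
    have "of_int n * (\<eta> + 2 * pi * of_int j) = of_int n * \<eta> + 2 * pi * of_int (n * j)"
      by (simp add: algebra_simps)
    then show ?thesis by (simp only: cis_mult[symmetric] cis_multiple_2pi[OF Ints_of_int] mult_1_right)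
  qed
  from per[of 5] per[of 2] show ?thesis unfolding rot_def by simp
qed

lemma norm_rot [simp]: "norm (rot \<eta> p) = norm p"
  by (simp add: rot_def norm_prod_def norm_mult)

lemma continuous_on_rot [continuous_intros]:
  assumes "continuous_on S f" "continuous_on S g"
  shows "continuous_on S (\<lambda>x. rot (f x) (g x))"
  unfolding rot_def by (intro continuous_intros assms)

lemma continuous_on_G25 [continuous_intros]:
  "continuous_on S f \<Longrightarrow> continuous_on S (\<lambda>x. G25 (f x))"
  unfolding G25_def by (intro continuous_intros)

text \<open>A continuous map from a compact set into a metric space is closed, so its image carries
  the quotient topology.\<close>

lemma descend_along_compact:
  fixes q :: "'a::metric_space \<Rightarrow> 'b::metric_space" and v :: "'a \<Rightarrow> 'c::metric_space"
  assumes "compact K" "continuous_on K q" "continuous_on K v"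
    and "\<And>x y. x \<in> K \<Longrightarrow> y \<in> K \<Longrightarrow> q x = q y \<Longrightarrow> v x = v y"
  obtains V where "continuous_on (q ` K) V" "\<And>x. x \<in> K \<Longrightarrow> V (q x) = v x"
proof -
  define V where "V z = v (SOME x. x \<in> K \<and> q x = z)" for z
  have V: "V (q x) = v x" if "x \<in> K" for x
  proof -
    have "(SOME y. y \<in> K \<and> q y = q x) \<in> K \<and> q (SOME y. y \<in> K \<and> q y = q x) = q x"
      by (rule someI_ex) (use that in blast)
    then show ?thesis unfolding V_def using assms(4) that by blast
  qed
  have "continuous_on (q ` K) V"
    unfolding continuous_on_closed_vimage[OF compact_imp_closed[OF compact_continuous_image[OF assms(2,1)]]]
  proof (intro allI impI)
    fix B :: "'c set" assume "closed B"
    then have "closed (v -` B \<inter> K)"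
      using assms(1,3) compact_imp_closed continuous_on_closed_vimage by blast
    then have "compact (v -` B \<inter> K)"
      by (metis assms(1) compact_Int_closed inf.absorb_iff2 inf_le2)
    then have "compact (q ` (v -` B \<inter> K))"
      by (intro compact_continuous_image continuous_on_subset[OF assms(2)]) auto
    moreover have "V -` B \<inter> q ` K = q ` (v -` B \<inter> K)" using V by auto
    ultimately show "closed (V -` B \<inter> q ` K)" by (simp add: compact_imp_closed)
  qed
  then show ?thesis using V that by blast
qed

text \<open>The ten sample points are spaced by a tenth of a period. Moving all of them back by one
  spacing replaces the largest sample by its translate by \<open>- 2 * pi\<close>, which costs one
  \<open>w\<close>.\<close>

lemma sum_quasi_periodic_shift:
  fixes b :: "real \<Rightarrow> complex" and k :: int
  assumes "\<And>x. b (x + 2 * pi) = b x + w"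
  shows "(\<Sum>j<10::nat. b ((2 * pi * j - a - 2 * pi * k) / 10))
       = (\<Sum>j<10::nat. b ((2 * pi * j - a) / 10)) - of_int k * w"
proof -
  define T where "T k = (\<Sum>j<10::nat. b ((2 * pi * j - a - 2 * pi * of_int k) / 10))" for k :: int
  have step: "T (k + 1) = T k - w" for k
  proof -
    define x where "x j = (2 * pi * (j - 1) - a - 2 * pi * of_int k) / 10" for j :: real
    have x10: "x 10 = x 0 + 2 * pi" unfolding x_def by (simp add: field_simps)
    have "T k = (\<Sum>j<10::nat. b (x (real (Suc j))))" by (simp add: T_def x_def)
    also have "\<dots> = (\<Sum>j<10::nat. b (x (real j))) + b (x 10) - b (x 0)"
    proof -
      have "(\<Sum>j<Suc 10. b (x (real j))) = b (x (real 0)) + (\<Sum>j<10. b (x (real (Suc j))))"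
        by (rule sum.lessThan_Suc_shift)
      moreover have "(\<Sum>j<Suc 10. b (x (real j))) = (\<Sum>j<10. b (x (real j))) + b (x (real 10))"
        by (rule sum.lessThan_Suc)
      ultimately have "b (x 0) + (\<Sum>j<10. b (x (real (Suc j)))) = (\<Sum>j<10. b (x (real j))) + b (x 10)"
        by (metis of_nat_0 of_nat_numeral)
      then show ?thesis by (metis add_diff_cancel_left')
    qed
    also have "(\<Sum>j<10::nat. b (x (real j))) = T (k + 1)"
    proof -
      have "x (real j) = (2 * pi * real j - a - 2 * pi * of_int (k + 1)) / 10" for j :: nat
        unfolding x_def by (simp add: algebra_simps)
      then show ?thesis by (simp only: T_def)
    qed
    also have "T (k + 1) + b (x 10) - b (x 0) = T (k + 1) + w"
      using assms[of "x 0"] x10 by simp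
    finally show ?thesis by simp
  qed
  have "T k = T 0 - of_int k * w"
  proof (induction k rule: int_induct[where k=0])
    case base
    then show ?case by simp
  next
    case (step1 i)
    then show ?case using step[of i] by (simp only: of_int_add) (simp add: algebra_simps)
  next
    case (step2 i)
    have "T (i - 1) = T i + w" using step[of "i - 1"] by simp
    also have "\<dots> = T 0 - of_int (i - 1) * w" using step2 by (simp add: algebra_simps)
    finally show ?case .
  qed
  then show ?thesis by (simp add: T_def)
qed


lemma prod_periodic_shift:
  fixes f :: "int \<Rightarrow> complex"
  assumes "\<And>i. f (i + 10) = f i"
  shows "(\<Prod>j<10::nat. f (int j + k)) = (\<Prod>j<10::nat. f (int j))"
proof -
  have step: "(\<Prod>j<10::nat. f (int j + (k + 1))) = (\<Prod>j<10::nat. f (int j + k))" for k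
  proof -
    have "f (int 0 + k) * (\<Prod>j<10::nat. f (int (Suc j) + k)) = (\<Prod>j<10::nat. f (int j + k)) * f (int 10 + k)"
      using prod.lessThan_Suc_shift[of "\<lambda>j. f (int j + k)" 10] prod.lessThan_Suc[of "\<lambda>j. f (int j + k)" 10]
      by metis
    moreover have "f (int 10 + k) = f (int 0 + k)" using assms[of k] by (simp add: add.commute)
    moreover have "(\<Prod>j<10::nat. f (int (Suc j) + k)) = (\<Prod>j<10::nat. f (int j + (k + 1)))"
      by (simp add: algebra_simps)
    ultimately show ?thesis
    \<comment> \<open>The common factor can be cancelled only if it is nonzero. Otherwise it occurs
      in both products: at index 0 in one and, by periodicity, at index 9 in the other.\<close>
    proof (cases "f (int 0 + k) = 0")
      case True
      have "(\<Prod>j<10::nat. f (int j + k)) = 0" using True by (auto intro!: bexI[of _ 0])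
      moreover have "(\<Prod>j<10::nat. f (int j + (k + 1))) = 0"
        using True \<open>f (int 10 + k) = f (int 0 + k)\<close> by (auto intro!: bexI[of _ 9] simp: algebra_simps)
      ultimately show ?thesis by metis
    qed simp
  qed
  show ?thesis
  proof (induction k rule: int_induct[where k=0])
    case (step2 i)
    then show ?case using step[of "i - 1"] by simp
  qed (simp_all only: step add_0_right)
qed

text \<open>The conditions amount to \<open>x ^ 2 = z * g\<close> and
  \<open>y ^ 5 = (z - 1) * g\<close>, solvable for every \<open>g\<close>. Only the norm remains;
  its square \<open>N g\<close> starts at 0 and exceeds \<open>\<sigma>\<^sup>2\<close> eventually,
  so the intermediate value theorem supplies \<open>g\<close>.\<close>

lemma exists_point_with_ratio:
  fixes z :: complex
  assumes "\<sigma> > 0"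
  obtains p :: "complex \<times> complex" and g :: real
  where "norm p = \<sigma>" "g > 0" "G25 p = of_real g" "fst p ^ 2 = z * g"
proof -
  define N where "N g = norm z * g + root 5 (norm (z - 1) * g) ^ 2" for g :: real
  have cont: "continuous_on {0..b} N" for b unfolding N_def by (intro continuous_intros)
  have "\<exists>b\<ge>0. N b \<ge> \<sigma>\<^sup>2"
  proof (cases "z = 0")
    case True
    then show ?thesis using assms by (intro exI[of _ "\<sigma> ^ 5"]) (simp add: N_def real_root_pos2)
  next
    case False
    then show ?thesis by (intro exI[of _ "\<sigma>\<^sup>2 / norm z"]) (simp add: N_def)
  qed
  then obtain b where "b \<ge> 0" "N b \<ge> \<sigma>\<^sup>2" by blast
  moreover have "N 0 \<le> \<sigma>\<^sup>2" by (simp add: N_def)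
  ultimately obtain g where g: "0 \<le> g" "N g = \<sigma>\<^sup>2" using IVT'[of N 0 "\<sigma>\<^sup>2" b] cont by blast
  have "g \<noteq> 0"
  proof
    assume "g = 0"
    then show False using g assms by (simp add: N_def)
  qed
  with g have "g > 0" by simp
  define x where "x = csqrt (z * g)"
  obtain y where y: "y ^ 5 = (z - 1) * g"
  proof (cases "(z - 1) * g = 0")
    case True
    then show ?thesis using that[of 0] by simp
  next
    case False
    then show ?thesis using that[of "exp (Ln ((z - 1) * g) / 5)"]
      by (simp add: exp_of_nat_mult[symmetric])
  qed
  have x2: "x ^ 2 = z * g" by (simp add: x_def)
  have "norm x ^ 2 = norm z * g" using x2 g by (metis abs_of_nonneg norm_mult norm_of_real norm_power)
  moreover have "norm y ^ 5 = norm (z - 1) * g"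
    using y g by (metis abs_of_nonneg norm_mult norm_of_real norm_power)
  then have "norm y = root 5 (norm (z - 1) * g)"
    by (metis norm_ge_zero real_root_pos2 zero_less_numeral)
  ultimately have "norm x ^ 2 + norm y ^ 2 = \<sigma>\<^sup>2" using g by (simp add: N_def)
  then have "norm (x, y) = \<sigma>" using assms by (simp add: norm_prod_def)
  moreover have "G25 (x, y) = g" using x2 y by (simp add: G25_def algebra_simps)
  ultimately show ?thesis using that[of "(x, y)" g] x2 \<open>g > 0\<close> by simp
qed

text \<open>The ratio fixes \<open>x ^ 2 / g\<close> and \<open>y ^ 5 / g\<close>, and the norm then
  fixes \<open>g\<close>. What is left is a sign for \<open>x\<close> and a fifth root of unity for
  \<open>y\<close>, together one tenth root of unity.\<close>

lemma rot_orbit_of_ratio: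
  assumes "norm p = \<sigma>" "norm p' = \<sigma>" "g > 0" "g' > 0" "G25 p = of_real g" "G25 p' = of_real g'"
    and ratio: "fst p ^ 2 / G25 p = fst p' ^ 2 / G25 p'"
  shows "\<exists>j::int. p' = rot (2 * pi * j / 10) p"
proof -
  obtain x y x' y' where p: "p = (x, y)" and p': "p' = (x', y')" by fastforce
  define z where "z = x ^ 2 / g"
  have x: "x ^ 2 = z * g" and x': "x' ^ 2 = z * g'" using assms by (auto simp: z_def p p' field_simps)
  have y: "y ^ 5 = (z - 1) * g" and y': "y' ^ 5 = (z - 1) * g'"
    using assms(5,6) x x' by (simp_all add: G25_def p p' algebra_simps)
  have gg: "g = g'"
  proof -
    have nx: "norm x ^ 2 = norm z * g" "norm x' ^ 2 = norm z * g'"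
      using x x' assms(3,4) by (metis abs_of_pos norm_mult norm_of_real norm_power)+
    have ny: "norm y ^ 5 = norm (z-1) * g" "norm y' ^ 5 = norm (z-1) * g'"
      using y y' assms(3,4) by (metis abs_of_pos norm_mult norm_of_real norm_power)+
    have nn: "norm x ^ 2 + norm y ^ 2 = norm x' ^ 2 + norm y' ^ 2"
      using assms(1,2) by (metis fst_conv snd_conv norm_prod_def p p' real_sqrt_eq_iff)
    \<comment> \<open>The squared norm is strictly increasing in the scale, because \<open>z\<close>
      and \<open>z - 1\<close> do not vanish together.\<close>
    have mono: "u \<le> v" if "norm x1 ^ 2 = norm z * u" "norm x2 ^ 2 = norm z * v" "norm y1 ^ 5 = norm (z-1) * u"
      "norm y2 ^ 5 = norm (z-1) * v" "norm x1 ^ 2 + norm y1 ^ 2 = norm x2 ^ 2 + norm y2 ^ 2" "u > 0" "v > 0"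
      for u v :: real and x1 x2 y1 y2 :: complex
    proof (rule ccontr)
      assume "\<not> u \<le> v"
      then have uv: "v < u" by simp
      have 1: "norm x2 ^ 2 \<le> norm x1 ^ 2" using that uv by (simp add: mult_left_mono)
      have "norm y2 ^ 5 \<le> norm y1 ^ 5" using that uv by (simp add: mult_left_mono)
      then have 2: "norm y2 \<le> norm y1" by (simp add: power_mono_iff)
      have "norm x1 ^ 2 = norm x2 ^ 2" "norm y1 ^ 2 = norm y2 ^ 2"
        using 1 2 that(5) power_mono[OF 2 norm_ge_zero, of 2] by linarith+
      then have ny: "norm y1 = norm y2" using power2_eq_imp_eq[OF _ norm_ge_zero norm_ge_zero] by blast
      have "norm z * u = norm z * v" using \<open>norm x1 ^ 2 = norm x2 ^ 2\<close> that(1,2) by simp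
      then have "norm z = 0" using uv by simp
      then have "norm (z - 1) = 1" by simp
      moreover have "norm (z - 1) * u = norm (z - 1) * v" by (simp only: that(3)[symmetric] that(4)[symmetric] ny)
      ultimately show False using uv by simp
    qed
    show ?thesis
      using mono[OF nx(1,2) ny(1,2) nn assms(3,4)] mono[OF nx(2,1) ny(2,1) nn[symmetric] assms(4,3)] by simp
  qed
  have "x' ^ 2 = x ^ 2" using x x' gg by simp
  then have sx: "x' = x \<or> x' = - x" by (simp add: power2_eq_iff)
  have "y' ^ 5 = y ^ 5" using y y' gg by simp
  then obtain i :: nat where i: "y' = cis (2 * pi * i / 5) * y"
  proof (cases "y = 0")
    case True
    then show ?thesis using \<open>y' ^ 5 = y ^ 5\<close> that[of 0] by simp
  next
    case False
    have "(y' / y) ^ 5 = 1" using \<open>y' ^ 5 = y ^ 5\<close> False by (simp add: power_divide)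
    then have "y' / y \<in> {z. z ^ 5 = 1}" by simp
    then obtain i :: nat where "y' / y = exp (2 * of_real pi * \<i> * of_nat i / of_nat 5)"
      by (subst (asm) complex_roots_unity) auto
    then show ?thesis using that[of i] False by (simp add: cis_conv_exp field_simps)
  qed
  \<comment> \<open>Index \<open>i\<close> produces the required fifth root of unity on
    \<open>y\<close>. Adding 5 keeps it and changes the parity of the index, hence the sign on
    \<open>x\<close>.\<close>
  have "p' = rot (2 * pi * real_of_int i / 10) p \<or> p' = rot (2 * pi * real_of_int (i + 5) / 10) p"
  proof -
    have e: "cis (5 * (2 * pi * real_of_int k / 10)) = (if even k then 1 else -1)" for k :: int
    proof (cases "even k")
      case True
      then obtain l where "k = 2 * l" by blast
      then have "5 * (2 * pi * real_of_int k / 10) = 2 * pi * real_of_int l" by simp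
      then have "cis (5 * (2 * pi * real_of_int k / 10)) = 1" by (simp only: cis_multiple_2pi[OF Ints_of_int])
      then show ?thesis using True by simp
    next
      case False
      then obtain l where l: "k = 2 * l + 1" using oddE by blast
      have "5 * (2 * pi * real_of_int k / 10) = 2 * pi * real_of_int l + pi"
        by (simp add: l field_simps)
      then have "cis (5 * (2 * pi * real_of_int k / 10)) = cis (2 * pi * real_of_int l) * cis pi"
        by (simp only: cis_mult)
      then have "cis (5 * (2 * pi * real_of_int k / 10)) = -1" by (simp only: cis_multiple_2pi[OF Ints_of_int] cis_pi mult_1_left)
      then show ?thesis using False by simp
    qed
    have f: "cis (2 * (2 * pi * real_of_int (i + 5) / 10)) = cis (2 * pi * i / 5)"
    proof -
      have "2 * (2 * pi * real_of_int (i + 5) / 10) = 2 * pi * i / 5 + 2 * pi * of_int 1"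
        by (simp add: distrib_left)
      then show ?thesis by (simp only: cis_mult[symmetric] cis_multiple_2pi[OF Ints_of_int] mult_1_right)
    qed
    have f0: "2 * (2 * pi * real_of_int i / 10) = 2 * pi * i / 5" by simp
    show ?thesis
      using sx unfolding rot_def p p' fst_conv snd_conv e f f0 by (auto simp: i)
  qed
  then show ?thesis by metis
qed

text \<open>A loop \<open>c\<close> in the complement of \<open>T(2,5)\<close> satisfies \<open>10 [c] = lk(c) [orbit]\<close> in homology.
  Rotating \<open>c\<close> by minus a tenth of the argument of \<open>G25\<close> moves it into the set where \<open>G25\<close> is
  positive; there the product of \<open>u\<close> over the group of tenth roots of unity factors through
  \<open>fst p ^ 2 / G25 p\<close>, whose values fill the simply connected plane.\<close>

lemma orbit_winding_relation:
  fixes u :: "complex \<times> complex \<Rightarrow> complex" and c :: "real \<Rightarrow> complex \<times> complex"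
    and B :: "real \<times> real \<Rightarrow> complex" and A :: "real \<Rightarrow> complex" and N m k :: int
  assumes \<sigma>: "\<sigma> > 0"
    and u: "continuous_on {p \<in> sphere 0 \<sigma>. G25 p \<noteq> 0} u"
    and u0: "\<And>p. p \<in> sphere 0 \<sigma> \<Longrightarrow> G25 p \<noteq> 0 \<Longrightarrow> u p \<noteq> 0"
    and c: "continuous_on {0..1} c" "c ` {0..1} \<subseteq> {p \<in> sphere 0 \<sigma>. G25 p \<noteq> 0}" "c 1 = c 0"
    and B: "continuous_on ({0..1} \<times> UNIV) B"
      "\<And>t \<eta>. t \<in> {0..1} \<Longrightarrow> exp (B (t, \<eta>)) = u (rot \<eta> (c t))"
      "\<And>\<eta>. B (0, \<eta> + 2 * pi) = B (0, \<eta>) + 2 * pi * \<i> * N"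
      "\<And>\<eta>. B (1, \<eta>) = B (0, \<eta>) + 2 * pi * \<i> * m"
    and A: "continuous_on {0..1} A" "\<And>t. t \<in> {0..1} \<Longrightarrow> exp (A t) = G25 (c t)"
      "A 1 = A 0 + 2 * pi * \<i> * k"
  shows "10 * m = N * k"
proof -
  define q where "q p = fst p ^ 2 / G25 p" for p
  have qc: "continuous_on {0..1} (\<lambda>t. q (c t))"
    unfolding q_def by (intro continuous_intros c) (use c in auto)
  then have "bounded ((\<lambda>t. q (c t)) ` {0..1})"
    by (intro compact_imp_bounded compact_continuous_image) auto
  then obtain M where M: "\<And>t. t \<in> {0..1} \<Longrightarrow> norm (q (c t)) \<le> M"
    unfolding bounded_iff by blast
  \<comment> \<open>The bound on the ratio is stated without division, so \<open>K\<close> is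
    closed. It still forces \<open>G25 p \<noteq> 0\<close>: otherwise \<open>fst p = 0\<close>,
    hence \<open>snd p = 0\<close>, which the norm excludes.\<close>
  define K where "K = {p. norm p = \<sigma> \<and> Im (G25 p) = 0 \<and> 0 \<le> Re (G25 p) \<and> norm (fst p ^ 2) \<le> M * Re (G25 p)}"
  have "closed K"
    unfolding K_def by (intro closed_Collect_conj closed_Collect_eq closed_Collect_le continuous_intros)
  moreover have "K \<subseteq> sphere 0 \<sigma>" by (auto simp: K_def)
  ultimately have "compact K" by (metis compact_eq_bounded_closed bounded_subset bounded_sphere)
  have K: "\<exists>g>0. G25 p = of_real g" if "p \<in> K" for p
  proof -
    have "Re (G25 p) \<noteq> 0"
    proof
      assume 0: "Re (G25 p) = 0"
      then have x: "fst p = 0" using that by (simp add: K_def)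
      have "G25 p = 0" using 0 that by (simp add: K_def complex_eq_iff)
      then have "snd p = 0" using x by (simp add: G25_def)
      then show False using x that \<sigma> by (simp add: K_def norm_prod_def)
    qed
    then show ?thesis using that by (intro exI[of _ "Re (G25 p)"]) (auto simp: K_def complex_eq_iff)
  qed
  have KX: "norm p = \<sigma>" "G25 p \<noteq> 0" if "p \<in> K" for p
    using that K[OF that] by (auto simp: K_def)
  \<comment> \<open>Multiplying over all ten rotations makes \<open>U\<close> constant on the fibres
    of \<open>q\<close>, so it descends to a nonvanishing function on a disc, where a logarithm
    exists.\<close>
  define U where "U p = (\<Prod>j<10::nat. u (rot (2 * pi * j / 10) p))" for p
  have "continuous_on K q"
    unfolding q_def by (intro continuous_intros) (use K in fastforce)
  moreover have "continuous_on K U"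
    unfolding U_def
  proof (intro continuous_on_prod)
    fix j :: nat
    show "continuous_on K (\<lambda>p. u (rot (2 * pi * j / 10) p))"
    proof (rule continuous_on_compose2[OF u])
      show "(\<lambda>p. rot (2 * pi * j / 10) p) ` K \<subseteq> {p \<in> sphere 0 \<sigma>. G25 p \<noteq> 0}"
        using KX by force
    qed (intro continuous_intros)
  qed
  moreover have "U p = U p'" if pp: "p \<in> K" "p' \<in> K" "q p = q p'" for p p'
  proof -
    obtain g g' :: real where g: "g > 0" "G25 p = of_real g" "g' > 0" "G25 p' = of_real g'"
      using K[OF pp(1)] K[OF pp(2)] by auto
    obtain j :: int where j: "p' = rot (2 * pi * j / 10) p"
      using rot_orbit_of_ratio[OF KX(1)[OF pp(1)] KX(1)[OF pp(2)] g(1,3,2,4)] pp(3) by (auto simp only: q_def)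
    define f where "f i = u (rot (2 * pi * of_int i / 10) p)" for i :: int
    have per: "f (i + 10) = f i" for i
    proof -
      have "2 * pi * of_int (i + 10) / 10 = 2 * pi * of_int i / 10 + 2 * pi * of_int 1"
        by (simp add: field_simps)
      then show ?thesis unfolding f_def by (simp only: rot_2pi)
    qed
    have "U p' = (\<Prod>i<10::nat. f (int i + j))"
    proof -
      have "rot (2 * pi * i / 10) p' = rot (2 * pi * of_int (int i + j) / 10) p" for i :: nat
        by (simp add: j add_divide_distrib distrib_left add.commute)
      then show ?thesis by (simp only: U_def f_def)
    qed
    also have "\<dots> = (\<Prod>i<10::nat. f (int i))" by (rule prod_periodic_shift) (rule per)
    also have "\<dots> = U p" by (simp add: U_def f_def)
    finally show ?thesis by simp
  qed
  ultimately obtain V where V: "continuous_on (q ` K) V" "\<And>p. p \<in> K \<Longrightarrow> V (q p) = U p"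
    using descend_along_compact[OF \<open>compact K\<close>] by metis
  have K_img: "z \<in> q ` K" if "norm z \<le> M" for z
  proof -
    obtain p and g :: real where p: "norm p = \<sigma>" "g > 0" "G25 p = of_real g" "fst p ^ 2 = z * g"
      using exists_point_with_ratio[OF \<sigma>] by metis
    have "norm (fst p ^ 2) = norm z * g" using p by (simp add: norm_mult)
    also have "\<dots> \<le> M * g" using that p by (simp add: mult_right_mono)
    finally have "p \<in> K" using p by (simp add: K_def)
    moreover have "q p = z" using p by (simp add: q_def)
    ultimately show ?thesis by blast
  qed
  then have "continuous_on (cball 0 M) V" by (intro continuous_on_subset[OF V(1)]) auto
  moreover have "V z \<noteq> 0" if z: "z \<in> cball 0 M" for z
  proof -
    obtain p where p: "p \<in> K" "z = q p" using K_img[of z] z by (auto simp: image_iff)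
    have "u (rot \<eta> p) \<noteq> 0" for \<eta>
      by (intro u0) (use KX[OF p(1)] in auto)
    then have "U p \<noteq> 0" by (simp add: U_def)
    then show ?thesis using V p by simp
  qed
  ultimately obtain l where l: "continuous_on (cball 0 M) l" "\<And>z. z \<in> cball 0 M \<Longrightarrow> exp (l z) = V z"
    using continuous_log_on_convex[OF convex_cball] by metis
  \<comment> \<open>Rotation by \<open>- Im (A t) / 10\<close> makes \<open>G25\<close> positive at
    \<open>c t\<close>; the term with \<open>j\<close> then applies the \<open>j\<close>-th tenth
    root of unity.\<close>
  define e where "e j t = (2 * pi * real j - Im (A t)) / 10" for j :: nat and t
  define SB where "SB t = (\<Sum>j<10::nat. B (t, e j t))" for t
  \<comment> \<open>Both sides are logarithms of the same product along the loop. The second depends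
    only on \<open>q (c t)\<close>, so it returns to its initial value when the loop closes.\<close>
  have "SB 0 - l (q (c 0)) = SB 1 - l (q (c 1))"
  proof (rule logs_differ_by_constant[of "{0..1::real}"])
    show "continuous_on {0..1} SB"
      unfolding SB_def e_def
      by (intro continuous_intros continuous_on_compose2[OF B(1)] A(1)) auto
    show "continuous_on {0..1} (\<lambda>t. l (q (c t)))"
      by (intro continuous_on_compose2[OF l(1)] qc) (use M in auto)
    fix t :: real assume t: "t \<in> {0..1}"
    define p where "p = rot (- Im (A t) / 10) (c t)"
    have cx: "c t \<in> sphere 0 \<sigma>" "G25 (c t) \<noteq> 0" using c(2) t by (auto simp: image_subset_iff)
    have "G25 p = cis (- Im (A t)) * exp (A t)" by (simp add: p_def A(2)[OF t])
    also have "\<dots> = of_real (exp (Re (A t)))"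
      by (simp add: exp_eq_polar[of "A t"] cis_mult[symmetric]) (simp add: cis_mult)
    finally have Gp: "G25 p = of_real (exp (Re (A t)))" .
    have qp: "q p = q (c t)"
    proof -
      have "fst p ^ 2 = cis (10 * (- Im (A t) / 10)) * fst (c t) ^ 2"
        by (simp add: p_def rot_def power_mult_distrib Complex.DeMoivre)
      moreover have "G25 p = cis (10 * (- Im (A t) / 10)) * G25 (c t)"
        unfolding p_def by (rule G25_rot)
      ultimately show ?thesis by (simp add: q_def)
    qed
    have "norm (fst p ^ 2) = norm (q p) * norm (G25 p)"
      using Gp by (simp add: q_def norm_divide)
    also have "\<dots> \<le> M * norm (G25 p)" using M[OF t] by (simp add: qp mult_right_mono)
    finally have "p \<in> K" using cx Gp by (simp add: K_def p_def)
    then have "exp (l (q (c t))) = U p"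
      using l(2)[of "q (c t)"] M[OF t] V(2) qp by (metis mem_cball_0)
    also have "\<dots> = (\<Prod>j<10::nat. u (rot (e j t) (c t)))"
      by (simp add: U_def p_def e_def add_divide_distrib[symmetric] diff_divide_distrib)
    also have "\<dots> = exp (SB t)"
      by (simp add: SB_def exp_sum B(2)[OF t])
    finally show "exp (SB t) = exp (l (q (c t)))" by simp
  qed auto
  then have "SB 0 = SB 1" using c(3) by simp
  \<comment> \<open>At the end of the loop each of the ten terms has gained
    \<open>2 * pi * \<i> * m\<close>, while the increment of \<open>A\<close> has moved the angles
    back by \<open>k\<close> tenths of a turn.\<close>
  also have "SB 1 = (\<Sum>j<10::nat. B (0, (2 * pi * j - Im (A 0) - 2 * pi * k) / 10)) + 20 * pi * \<i> * m"
    by (simp add: SB_def e_def B(4) A(3) sum.distrib algebra_simps)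
  also have "(\<Sum>j<10::nat. B (0, (2 * pi * j - Im (A 0) - 2 * pi * k) / 10)) = SB 0 - of_int k * (2 * pi * \<i> * N)"
    unfolding SB_def e_def by (rule sum_quasi_periodic_shift) (rule B(3))
  finally have "(2 * pi * \<i>) * of_int (10 * m) = (2 * pi * \<i>) * of_int (N * k)"
    by (simp add: algebra_simps)
  then have "complex_of_int (10 * m) = of_int (N * k)"
    by (simp only: mult_cancel_left) simp
  then show ?thesis by (simp only: of_int_eq_iff)
qed

section \<open>The link of a cusp is not T(2,5)\<close>

text \<open>The strip parametrizes all orbits through the path. It is convex, so the logarithm
  exists on it, and connected, so the increment over a period is the same for every orbit.\<close>

lemma orbit_log:
  fixes u :: "complex \<times> complex \<Rightarrow> complex" and c :: "real \<Rightarrow> complex \<times> complex"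
  assumes u: "continuous_on {p \<in> sphere 0 \<sigma>. G25 p \<noteq> 0} u"
    and u0: "\<And>p. p \<in> sphere 0 \<sigma> \<Longrightarrow> G25 p \<noteq> 0 \<Longrightarrow> u p \<noteq> 0"
    and c: "continuous_on {a..b} c" "\<And>t. t \<in> {a..b} \<Longrightarrow> norm (c t) = \<sigma> \<and> G25 (c t) \<noteq> 0"
  obtains B and N :: int where "continuous_on ({a..b} \<times> UNIV) B"
    "\<And>t \<eta>. t \<in> {a..b} \<Longrightarrow> exp (B (t, \<eta>)) = u (rot \<eta> (c t))"
    "\<And>t \<eta>. t \<in> {a..b} \<Longrightarrow> B (t, \<eta> + 2 * pi) = B (t, \<eta>) + 2 * pi * \<i> * N"
proof -
  let ?S = "{a..b} \<times> (UNIV :: real set)"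
  define f where "f = (\<lambda>z. u (rot (snd z) (c (fst z))))"
  have cc: "continuous_on ?S (\<lambda>z. c (fst z))"
    by (rule continuous_on_compose2[OF c(1)]) (auto intro!: continuous_intros)
  have "continuous_on ?S f"
    unfolding f_def
  proof (rule continuous_on_compose2[OF u])
    show "continuous_on ?S (\<lambda>z. rot (snd z) (c (fst z)))"
      by (intro continuous_intros cc)
    show "(\<lambda>z. rot (snd z) (c (fst z))) ` ?S \<subseteq> {p \<in> sphere 0 \<sigma>. G25 p \<noteq> 0}"
      using c(2) by fastforce
  qed
  moreover have "f z \<noteq> 0" if "z \<in> ?S" for z
    unfolding f_def by (rule u0) (use c(2) that in fastforce)+
  moreover have conv: "convex ?S" by (intro convex_Times) auto
  ultimately obtain B where B: "continuous_on ?S B" "\<And>z. z \<in> ?S \<Longrightarrow> exp (B z) = f z"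
    using continuous_log_on_convex by metis
  have sh: "continuous_on ?S (\<lambda>z. B (fst z, snd z + 2 * pi))"
    by (rule continuous_on_compose2[OF B(1)]) (auto intro!: continuous_intros)
  have "\<exists>N::int. \<forall>z\<in>?S. B (fst z, snd z + 2 * pi) - B z = 2 * pi * \<i> * N"
  proof (rule exp_eq_one_constant)
    show "connected ?S" using conv by (rule convex_connected)
    show "continuous_on ?S (\<lambda>z. B (fst z, snd z + 2 * pi) - B z)"
      by (intro continuous_intros sh B)
    fix z assume z: "z \<in> ?S"
    then have "exp (B (fst z, snd z + 2 * pi)) = f (fst z, snd z + 2 * pi * of_int 1)"
      by (subst B(2)) auto
    also have "\<dots> = f z" unfolding f_def fst_conv snd_conv by (simp only: rot_2pi)
    finally show "exp (B (fst z, snd z + 2 * pi) - B z) = 1"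
      using B(2)[OF z] by (simp add: exp_diff) (metis exp_not_eq_zero)
  qed
  then obtain N :: int where N: "\<And>z. z \<in> ?S \<Longrightarrow> B (fst z, snd z + 2 * pi) - B z = 2 * pi * \<i> * N"
    by blast
  show ?thesis
  proof (rule that[of B N])
    show "continuous_on ?S B" by (rule B(1))
    show "exp (B (t, \<eta>)) = u (rot \<eta> (c t))" if "t \<in> {a..b}" for t \<eta>
      using B(2)[of "(t, \<eta>)"] that by (simp add: f_def)
    show "B (t, \<eta> + 2 * pi) = B (t, \<eta>) + 2 * pi * \<i> * N" if "t \<in> {a..b}" for t \<eta>
      using N[of "(t, \<eta>)"] that by (simp add: algebra_simps)
  qed
qed

lemma Ln_imaginary:
  assumes "a > 0"
  shows "Ln (\<i> * of_real a) = of_real (ln a) + \<i> * (pi / 2)"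
    and "Ln (- (\<i> * of_real a)) = of_real (ln a) - \<i> * (pi / 2)"
proof -
  have "exp (\<i> * (pi / 2)) = \<i>" by (metis cis_conv_exp cis_pi_half of_real_divide of_real_numeral)
  then have 1: "exp (of_real (ln a) + \<i> * (pi / 2)) = \<i> * of_real a"
    using assms by (simp add: exp_add exp_of_real)
  show "Ln (\<i> * of_real a) = of_real (ln a) + \<i> * (pi / 2)"
    by (rule Ln_unique[OF 1]) (auto simp: pi_gt_zero intro: order.strict_trans)
  have "exp (- (\<i> * (pi / 2))) = - \<i>" using \<open>exp (\<i> * (pi / 2)) = \<i>\<close> by (simp add: exp_minus)
  then have 2: "exp (of_real (ln a) - \<i> * (pi / 2)) = - (\<i> * of_real a)"
    using assms by (simp add: exp_add exp_of_real diff_conv_add_uminus del: add_uminus_conv_diff)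
  show "Ln (- (\<i> * of_real a)) = of_real (ln a) - \<i> * (pi / 2)"
    by (rule Ln_unique[OF 2]; simp; use pi_gt_zero in linarith)
qed

text \<open>From the upper to the lower imaginary half axis, \<open>g\<close> travels through the
  left half plane and turns by \<open>pi\<close>, while \<open>g'\<close> travels through the right
  one and turns by \<open>- pi\<close>.\<close>

lemma arc_log_change:
  fixes g g' D :: "real \<Rightarrow> complex"
  assumes c: "continuous_on {0..pi} g" "continuous_on {0..pi} g'" "continuous_on {0..pi} D"
    and nz: "\<And>t. t \<in> {0..pi} \<Longrightarrow> g t \<noteq> 0" "\<And>t. t \<in> {0..pi} \<Longrightarrow> g' t \<noteq> 0"
    and Re: "\<And>t. t \<in> {0..pi} \<Longrightarrow> Re (g t) \<le> 0" "\<And>t. t \<in> {0..pi} \<Longrightarrow> Re (g' t) \<ge> 0"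
    and D: "\<And>t. t \<in> {0..pi} \<Longrightarrow> exp (D t) = g' t / g t"
    and ends: "a > 0" "b > 0" "g 0 = \<i> * of_real a" "g' 0 = \<i> * of_real a"
      "g pi = - (\<i> * of_real b)" "g' pi = - (\<i> * of_real b)"
  shows "D pi - D 0 = - (2 * pi * \<i>)"
proof -
  \<comment> \<open>\<open>- g\<close> lies in the closed right half plane, where \<open>Ln\<close>
    is continuous away from 0; the summand \<open>\<i> * pi\<close> restores the sign.\<close>
  let ?L = "\<lambda>t. Ln (g' t) - Ln (- g t) + \<i> * pi"
  have np: "z \<notin> \<real>\<^sub>\<le>\<^sub>0" if "Re z \<ge> 0" "z \<noteq> 0" for z
    using that by (auto simp: complex_nonpos_Reals_iff complex_eq_iff)
  have cancel: "c - a = d - b" if "a - b = c - d" for a b c d :: complex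
    using that by (simp add: algebra_simps)
  have "D 0 - ?L 0 = D pi - ?L pi"
  proof (rule logs_differ_by_constant[of "{0..pi}"])
    show "continuous_on {0..pi} ?L"
    proof (intro continuous_intros c)
      show "g' t \<notin> \<real>\<^sub>\<le>\<^sub>0" "- g t \<notin> \<real>\<^sub>\<le>\<^sub>0" if "t \<in> {0..pi}" for t
        by (rule np; use nz[OF that] Re[OF that] in simp)+
    qed
    fix t assume t: "t \<in> {0..pi}"
    show "exp (D t) = exp (?L t)"
      using nz[OF t] by (simp add: D[OF t] exp_add exp_diff)
  qed (use c in auto)
  then have "D pi - D 0 = ?L pi - ?L 0" by (rule cancel)
  also have "\<dots> = - (2 * pi * \<i>)"
    by (simp add: ends(3-6) Ln_imaginary ends(1,2) algebra_simps)
  finally show ?thesis .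
qed

text \<open>With \<open>x = t e\<^sup>-\<^sup>\<tau>\<^sup>/\<^sup>2\<close> and \<open>y = m s e\<^sup>-\<^sup>\<tau>\<^sup>/\<^sup>3\<close> one has \<open>x\<^sup>2 - y\<^sup>3 = 1\<close> up to the error term, an affine elliptic curve
  on which \<open>Re y + i Re x\<close> has no zero. This function detects the order six monodromy of the cusp.\<close>

lemma cusp_function_nonzero:
  fixes \<tau> s t Fv m :: complex
  assumes "exp \<tau> = Fv" "norm (Fv - (t\<^sup>2 - (m * s) ^ 3)) \<le> max (norm t ^ 2) (norm (m * s) ^ 3) / 2"
  shows "Complex (Re (m * s * exp (- \<tau> / 3))) (Re (t * exp (- \<tau> / 2))) \<noteq> 0"
proof
  assume 0: "Complex (Re (m * s * exp (- \<tau> / 3))) (Re (t * exp (- \<tau> / 2))) = 0"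
  define x y where "x = t * exp (- \<tau> / 2)" and "y = m * s * exp (- \<tau> / 3)"
  have re: "Re x = 0" "Re y = 0" using 0 by (auto simp: x_def y_def complex_eq_iff)
  have x2: "x ^ 2 = t ^ 2 * exp (- \<tau>)"
    by (simp add: x_def power_mult_distrib exp_of_nat_mult[symmetric])
  have y3: "y ^ 3 = (m * s) ^ 3 * exp (- \<tau>)"
    by (simp add: y_def power_mult_distrib exp_of_nat_mult[symmetric])
  have e: "Fv * exp (- \<tau>) = 1" by (simp add: assms(1)[symmetric] exp_minus)
  have "norm (1 - (x\<^sup>2 - y ^ 3)) = norm (Fv - (t\<^sup>2 - (m * s) ^ 3)) * norm (exp (- \<tau>))"
    unfolding e[symmetric] x2 y3 norm_mult[symmetric] by (simp add: algebra_simps)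
  also have "\<dots> \<le> max (norm t ^ 2) (norm (m * s) ^ 3) / 2 * norm (exp (- \<tau>))"
    using assms(2) by (rule mult_right_mono) simp
  also have "\<dots> = max (norm x ^ 2) (norm y ^ 3) / 2"
  proof -
    have "norm x ^ 2 = norm t ^ 2 * norm (exp (- \<tau>))" "norm y ^ 3 = norm (m * s) ^ 3 * norm (exp (- \<tau>))"
      using x2 y3 by (metis norm_mult norm_power)+
    then show ?thesis by (simp add: max_mult_distrib_right)
  qed
  finally have le: "norm (1 - (x\<^sup>2 - y ^ 3)) \<le> max (norm x ^ 2) (norm y ^ 3) / 2" .
  \<comment> \<open>For imaginary \<open>x\<close> and \<open>y\<close> the numbers
    \<open>1 - x ^ 2\<close> and \<open>y ^ 3\<close> are real and imaginary. So the norm of their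
    sum is at least \<open>1 + norm x ^ 2\<close> and at least \<open>norm y ^ 3\<close>, too much
    for the error bound.\<close>
  have xy: "x = \<i> * Im x" "y = \<i> * Im y" using re by (simp_all add: complex_eq_iff)
  have x2': "x ^ 2 = - of_real (Im x ^ 2)" by (subst xy(1)) (simp add: power_mult_distrib)
  have y3': "y ^ 3 = - \<i> * of_real (Im y ^ 3)"
    
  proof -
    have "\<i> ^ 3 = - \<i>" by (simp add: power3_eq_cube)
    then show ?thesis by (subst xy(2)) (simp only: power_mult_distrib of_real_power)
  qed
  have z: "1 - (x\<^sup>2 - y ^ 3) = Complex (1 + Im x ^ 2) (- (Im y ^ 3))"
    unfolding x2' y3' by (simp add: complex_eq_iff)
  have n1: "norm (1 - (x\<^sup>2 - y ^ 3)) \<ge> 1 + Im x ^ 2"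
    unfolding z using complex_Re_le_cmod[of "Complex (1 + Im x ^ 2) (- (Im y ^ 3))"] by simp
  have n2: "norm (1 - (x\<^sup>2 - y ^ 3)) \<ge> \<bar>Im y\<bar> ^ 3"
    unfolding z using abs_Im_le_cmod[of "Complex (1 + Im x ^ 2) (- (Im y ^ 3))"] by (simp add: power_abs)
  have nx: "norm x ^ 2 = Im x ^ 2" by (simp add: cmod_power2 re)
  have ny: "norm y = \<bar>Im y\<bar>" by (metis xy(2) norm_mult norm_ii mult_1 norm_of_real)
  show False using le n1 n2 unfolding nx ny
    by (smt (verit, best) field_sum_of_halves zero_le_power2)
qed


text \<open>On these great half circles, with \<open>\<zeta>\<close> a cube root of unity, \<open>t\<^sup>2 - (m s)\<^sup>3\<close> is a positive real number,
  so the principal logarithm lifts them to the infinite cyclic cover.\<close>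

definition cusp_arc :: "real \<Rightarrow> complex \<Rightarrow> complex \<Rightarrow> real \<Rightarrow> complex \<times> complex" where
  "cusp_arc r m \<zeta> \<theta> = (- (\<zeta> / sgn m) * of_real (r * sin \<theta>), of_real (r * cos \<theta>))"

lemma norm_cusp_arc:
  assumes "r > 0" "m \<noteq> 0" "norm \<zeta> = 1"
  shows "norm (cusp_arc r m \<zeta> \<theta>) = r"
proof -
  have "norm (cusp_arc r m \<zeta> \<theta>) = sqrt ((r * sin \<theta>)\<^sup>2 + (r * cos \<theta>)\<^sup>2)"
    using assms by (simp add: cusp_arc_def norm_prod_def norm_mult norm_divide norm_sgn power_mult_distrib del: of_real_mult)
  also have "(r * sin \<theta>)\<^sup>2 + (r * cos \<theta>)\<^sup>2 = r\<^sup>2"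
    by (simp add: power_mult_distrib distrib_left[symmetric])
  finally show ?thesis using assms by simp
qed

lemma mult_fst_cusp_arc: "m \<noteq> 0 \<Longrightarrow> m * fst (cusp_arc r m \<zeta> \<theta>) = - \<zeta> * of_real (norm m * (r * sin \<theta>))"
  by (simp add: cusp_arc_def sgn_div_norm divide_simps scaleR_conv_of_real)

lemma continuous_on_cusp_arc: "continuous_on S (cusp_arc r m \<zeta>)"
  unfolding cusp_arc_def by (intro continuous_intros)

text \<open>Along the arc the model value is \<open>a + b\<close> with nonnegative \<open>a\<close>,
  \<open>b\<close> that are not both zero, and the error is at most half of the larger one.\<close>

lemma Re_cusp_arc_pos:
  fixes F :: "complex \<times> complex \<Rightarrow> complex"
  assumes "r > 0" "m \<noteq> 0" "\<zeta> ^ 3 = 1" "norm \<zeta> = 1" "\<theta> \<in> {0..pi}"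
    and F: "\<And>s t. norm (s, t) = r \<Longrightarrow> norm (F (s, t) - (t\<^sup>2 - (m * s) ^ 3)) \<le> max (norm t ^ 2) (norm (m * s) ^ 3) / 2"
  shows "Re (F (cusp_arc r m \<zeta> \<theta>)) > 0"
proof -
  define s t where "s = fst (cusp_arc r m \<zeta> \<theta>)" and "t = snd (cusp_arc r m \<zeta> \<theta>)"
  have st: "cusp_arc r m \<zeta> \<theta> = (s, t)" by (simp add: s_def t_def)
  have n: "norm (s, t) = r" using norm_cusp_arc[OF assms(1,2,4), of \<theta>] by (simp add: st)
  define a b where "a = (r * cos \<theta>)\<^sup>2" and "b = (norm m * (r * sin \<theta>)) ^ 3"
  have sin: "sin \<theta> \<ge> 0" using assms(5) by (auto intro: sin_ge_zero)
  have ab: "a \<ge> 0" "b \<ge> 0" using sin assms(1) by (auto simp: a_def b_def)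
  have t2: "t ^ 2 = of_real a" by (simp add: t_def a_def cusp_arc_def)
  have s3: "(m * s) ^ 3 = - of_real b"
    unfolding s_def mult_fst_cusp_arc[OF assms(2)] using assms(3) by (simp add: b_def power_mult_distrib)
  have na: "norm t ^ 2 = a" using t2 ab by (metis abs_of_nonneg norm_of_real norm_power)
  have nb: "norm (m * s) ^ 3 = b" using s3 ab by (metis abs_of_nonneg norm_of_real norm_power norm_minus_cancel)
  have pos: "a + b > 0"
  proof (rule ccontr)
    assume "\<not> a + b > 0"
    then have "a = 0" "b = 0" using ab by auto
    then have "norm t = 0" "norm (m * s) = 0" using na nb by (metis power_eq_0_iff)+
    then show False using n assms(1,2) by simp
  qed
  have "norm (F (s, t) - of_real (a + b)) \<le> max a b / 2"
    using F[OF n] by (simp add: t2 s3 na nb)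
  then have "Re (of_real (a + b) - F (s, t)) \<le> max a b / 2"
    using complex_Re_le_cmod order_trans norm_minus_commute by metis
  then show ?thesis using pos ab by (simp add: st max_def split: if_splits)
qed

text \<open>A third of the argument of \<open>z\<close> stays below \<open>pi / 6\<close>, which
  leaves room for a rotation by \<open>pi / 3\<close> within the right half plane.\<close>

lemma cis_rotation_Re_pos:
  assumes "Re z > 0" "\<bar>\<kappa>\<bar> \<le> pi / 3"
  shows "Re (cis \<kappa> * exp (- Ln z / 3)) > 0"
proof -
  have "z \<noteq> 0" using assms by auto
  then have "\<bar>Im (Ln z)\<bar> < pi / 2" using Re_Ln_pos_lt assms(1) by blast
  then have "\<bar>\<kappa> - Im (Ln z) / 3\<bar> < pi / 2" using assms(2) by linarith
  then have "cos (\<kappa> - Im (Ln z) / 3) > 0" by (intro cos_gt_zero_pi) linarith+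
  moreover have "Re (cis \<kappa> * exp (- Ln z / 3)) = exp (- Re (Ln z) / 3) * cos (\<kappa> - Im (Ln z) / 3)"
    by (simp add: Re_exp Im_exp cos_diff algebra_simps)
  ultimately show ?thesis by simp
qed

lemma Re_exp_half_Ln_pos:
  assumes "Re z > 0"
  shows "Re (exp (- Ln z / 2)) > 0"
proof -
  have "z \<noteq> 0" using assms by auto
  then have "\<bar>Im (Ln z)\<bar> < pi / 2" using Re_Ln_pos_lt assms(1) by blast
  then have "cos (Im (Ln z) / 2) > 0" by (intro cos_gt_zero_pi) auto
  then show ?thesis by (simp add: Re_exp)
qed

text \<open>Minus a primitive cube root of unity is a primitive sixth root, at angle
  \<open>pi / 3\<close> from the positive axis; this is the rotation
  \<open>cis_rotation_Re_pos\<close> tolerates.\<close>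

lemma cis_multiple_third:
  fixes N :: int
  assumes "\<not> 3 dvd N"
  obtains \<kappa> where "\<bar>\<kappa>\<bar> = pi / 3" "exp (- (4 * pi * \<i> * of_int N) / 3) = - cis \<kappa>"
proof -
  have "\<exists>j. N = 3 * j + 1 \<or> N = 3 * j - 1" using assms by presburger
  then obtain j :: int where "N = 3 * j + 1 \<or> N = 3 * j - 1" by blast
  then show ?thesis
  proof
    assume N: "N = 3 * j + 1"
    have "exp (- (4 * pi * \<i> * of_int N) / 3) = cis (- (4 * pi * N / 3))"
      by (simp add: cis_conv_exp field_simps)
    also have "- (4 * pi * N / 3) = 2 * pi * of_int (-2 * j - 1) + pi - pi / 3"
      by (simp add: N field_simps)
    also have "cis \<dots> = cis (2 * pi * of_int (-2 * j - 1)) * cis pi * cis (- (pi / 3))"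
      unfolding cis_mult by (simp only: diff_conv_add_uminus)
    also have "\<dots> = - cis (- (pi / 3))"
      by (simp only: cis_multiple_2pi[OF Ints_of_int] cis_pi) simp
    finally show ?thesis using that[of "- (pi / 3)"] by simp
  next
    assume N: "N = 3 * j - 1"
    have "exp (- (4 * pi * \<i> * of_int N) / 3) = cis (- (4 * pi * N / 3))"
      by (simp add: cis_conv_exp field_simps)
    also have "- (4 * pi * N / 3) = 2 * pi * of_int (-2 * j) + pi + pi / 3"
      by (simp add: N field_simps)
    also have "cis \<dots> = cis (2 * pi * of_int (-2 * j)) * cis pi * cis (pi / 3)"
      unfolding cis_mult ..
    also have "\<dots> = - cis (pi / 3)"
      by (simp only: cis_multiple_2pi[OF Ints_of_int] cis_pi) simp
    finally show ?thesis using that[of "pi / 3"] by simp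
  qed
qed

lemma exp_third_eq_one:
  fixes \<epsilon> :: complex
  shows "exp (- (4 * pi * \<i> * of_int N) / 3) ^ 3 = 1"
proof -
  have "exp (- (4 * pi * \<i> * of_int N) / 3) ^ 3 = exp (2 * pi * \<i> * of_int (- 2 * N))"
    by (simp add: exp_of_nat_mult[symmetric] algebra_simps)
  then show ?thesis by (simp only: exp_integer_2pi Ints_of_int exp_eq_1) (auto intro: exI[of _ "-2*N"])
qed

text \<open>On the circle \<open>s = 0\<close> the quotient of \<open>F\<close> by the square of the
  second coordinate stays in the disc of radius 1/2 about 1, so \<open>F\<close> winds as often as
  that square.\<close>

lemma loop_winding_two:
  fixes F :: "complex \<times> complex \<Rightarrow> complex" and B :: "real \<Rightarrow> complex"
  assumes "r > 0" "continuous_on (sphere 0 r) F"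
    and F: "\<And>s t. norm (s, t) = r \<Longrightarrow> norm (F (s, t) - (t\<^sup>2 - (m * s) ^ 3)) \<le> max (norm t ^ 2) (norm (m * s) ^ 3) / 2"
    and B: "continuous_on {0..1} B" "\<And>x. x \<in> {0..1} \<Longrightarrow> exp (B x) = F (0, r * cis (2 * pi * x))"
  shows "B 1 - B 0 = 4 * pi * \<i>"
proof -
  define c where "c x = (0 :: complex, r * cis (2 * pi * x))" for x :: real
  define w where "w x = F (c x) / (r * cis (2 * pi * x))\<^sup>2" for x
  have nc: "norm (c x) = r" for x using assms(1) by (simp add: c_def norm_mult)
  have w: "Re (w x) > 0" for x
  proof -
    define t where "t = r * cis (2 * pi * x)"
    have t: "norm t = r" "t \<noteq> 0" using assms(1) by (auto simp: t_def norm_mult)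
    have "norm (F (0, t) - t\<^sup>2) \<le> norm t ^ 2 / 2" using F[of 0 t] t assms(1) by simp
    then have "norm (F (0, t) - t\<^sup>2) / norm (t\<^sup>2) \<le> 1 / 2" using t assms(1) by (simp add: norm_power divide_simps)
    then have "norm (w x - 1) \<le> 1 / 2"
      using t by (simp add: w_def c_def t_def[symmetric] norm_divide[symmetric] diff_divide_distrib)
    then have "Re (1 - w x) \<le> 1 / 2" by (metis complex_Re_le_cmod norm_minus_commute order_trans)
    then show ?thesis by simp
  qed
  have wn: "w x \<notin> \<real>\<^sub>\<le>\<^sub>0" for x using w[of x] by (auto simp: complex_nonpos_Reals_iff)
  have cw: "continuous_on {0..1} w"
    unfolding w_def
  proof (intro continuous_intros continuous_on_compose2[OF assms(2)])
    show "continuous_on {0..1} c" unfolding c_def by (intro continuous_intros)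
  qed (use assms(1) nc in auto)
  let ?l = "\<lambda>x::real. 2 * of_real (ln r) + 4 * pi * \<i> * x + Ln (w x)"
  have "B 1 - ?l 1 = B 0 - ?l 0"
  proof (rule logs_differ_by_constant[of "{0..1}"])
    show "continuous_on {0..1} ?l" by (intro continuous_intros cw wn)
    fix x :: real assume x: "x \<in> {0..1}"
    have "exp (2 * of_real (ln r) + 4 * pi * \<i> * x) = (r * cis (2 * pi * x))\<^sup>2"
    proof -
      have "2 * of_real (ln r) + 4 * pi * \<i> * x = of_nat 2 * (of_real (ln r) + \<i> * of_real (2 * pi * x))"
        by (simp add: algebra_simps)
      then show ?thesis using assms(1)
        by (simp only: exp_of_nat_mult exp_add exp_of_real exp_ln cis_conv_exp)
    qed
    moreover have "exp (Ln (w x)) = w x" using wn[of x] by (intro exp_Ln) auto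
    moreover have "(r * cis (2 * pi * x))\<^sup>2 \<noteq> 0" using assms(1) by simp
    ultimately show "exp (B x) = exp (?l x)"
      by (simp only: exp_add B(2)[OF x] w_def c_def) simp
  qed (use B in auto)
  moreover have "w 1 = w 0"
  proof -
    have "cis (2 * pi * 1) = cis (2 * pi * 0)" by simp
    then show ?thesis unfolding w_def c_def by metis
  qed
  ultimately show ?thesis by (simp add: algebra_simps)
qed

text \<open>Transport the function of \<open>cusp_function_nonzero\<close> to the complement of \<open>T(2,5)\<close>. If \<open>N\<close> is the winding
  number of \<open>u\<close> along an orbit, going twice around the orbits shows that the deck transformation
  \<open>\<tau> \<mapsto> \<tau> + 4 \<pi> i N\<close> changes the function only by a factor that has a logarithm. As \<open>N\<close> divides \<open>20\<close>, it
  multiplies \<open>y\<close> by a primitive cube root of unity, and the loop formed by two cusp arcs then sees a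
  nonzero winding number of that factor.\<close>

lemma cusp_link_not_T25:
  fixes F :: "complex \<times> complex \<Rightarrow> complex"
  assumes "r > 0" "\<sigma> > 0" "m \<noteq> 0" and Fc: "continuous_on (sphere 0 r) F"
    and F: "\<And>s t. norm (s, t) = r \<Longrightarrow> norm (F (s, t) - (t\<^sup>2 - (m * s) ^ 3)) \<le> max (norm t ^ 2) (norm (m * s) ^ 3) / 2"
    and h: "homeomorphism (sphere 0 r) (sphere 0 \<sigma>) h \<psi>"
    and hF: "h ` ({p. F p = 0} \<inter> sphere 0 r) = {p. G25 p = 0} \<inter> sphere 0 \<sigma>"
  shows False
proof -
  define X where "X = {p \<in> sphere 0 \<sigma>. G25 p \<noteq> 0}"
  define u where "u p = F (\<psi> p)" for p
  have h1: "continuous_on (sphere 0 r) h" "continuous_on (sphere 0 \<sigma>) \<psi>"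
    "\<And>p. norm p = r \<Longrightarrow> norm (h p) = \<sigma>" "\<And>p. norm p = \<sigma> \<Longrightarrow> norm (\<psi> p) = r"
    "\<And>p. norm p = r \<Longrightarrow> \<psi> (h p) = p" "\<And>p. norm p = \<sigma> \<Longrightarrow> h (\<psi> p) = p"
  proof -
    show "norm (h p) = \<sigma>" if "norm p = r" for p
      using homeomorphism_image1[OF h] that by (metis imageI mem_sphere_0)
    show "norm (\<psi> p) = r" if "norm p = \<sigma>" for p
      using homeomorphism_image2[OF h] that by (metis imageI mem_sphere_0)
  qed (use homeomorphism_cont1[OF h] homeomorphism_cont2[OF h] homeomorphism_apply1[OF h] homeomorphism_apply2[OF h] in auto)
  have zero_iff: "F p = 0 \<longleftrightarrow> G25 (h p) = 0" if p: "norm p = r" for p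
  proof
    assume "F p = 0"
    then have "h p \<in> h ` ({p. F p = 0} \<inter> sphere 0 r)" using p by auto
    then show "G25 (h p) = 0" unfolding hF by simp
  next
    assume "G25 (h p) = 0"
    then have "h p \<in> h ` ({p. F p = 0} \<inter> sphere 0 r)" unfolding hF using h1(3)[OF p] by simp
    then obtain p' where p': "F p' = 0" "norm p' = r" "h p = h p'" by auto
    then have "p' = p" using h1(5) p by metis
    then show "F p = 0" using p' by simp
  qed
  have uc: "continuous_on {p \<in> sphere 0 \<sigma>. G25 p \<noteq> 0} u"
    unfolding u_def
    by (rule continuous_on_compose2[OF Fc continuous_on_subset[OF h1(2)]]) (use h1(4) in auto)
  have u0: "u p \<noteq> 0" if "p \<in> sphere 0 \<sigma>" "G25 p \<noteq> 0" for p
    using zero_iff[of "\<psi> p"] h1(4,6)[of p] that by (simp add: u_def)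
  have uh: "u (h p) = F p" if "norm p = r" for p using that h1(5) by (simp add: u_def)

  \<comment> \<open>The image of the circle \<open>s = 0\<close>, on which \<open>F\<close> winds
    twice; this is the source of the factor 2 in \<open>10 * 2 = N * k\<close>.\<close>
  define c where "c x = h (0, r * cis (2 * pi * x))" for x :: real
  have cn: "norm (0::complex, r * cis (2 * pi * x)) = r" for x using assms(1) by (simp add: norm_mult)
  have cF: "F (0, r * cis (2 * pi * x)) \<noteq> 0" for x
  proof
    assume "F (0, r * cis (2 * pi * x)) = 0"
    then show False using F[OF cn[of x]] assms(1) by (simp add: norm_mult norm_power)
  qed
  have cc: "continuous_on {0..1} c"
    unfolding c_def by (rule continuous_on_compose2[OF h1(1)]) (use cn in \<open>auto intro!: continuous_intros\<close>)
  have cX: "norm (c x) = \<sigma>" "G25 (c x) \<noteq> 0" for x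
    using cn[of x] h1(3) zero_iff[OF cn[of x]] cF[of x] by (auto simp: c_def)
  have c10: "c 1 = c 0"
  proof -
    have "cis (2 * pi * 1) = cis (2 * pi * 0)" by simp
    then show ?thesis unfolding c_def by metis
  qed
  obtain B N where B: "continuous_on ({0..1} \<times> UNIV) B"
    "\<And>t \<eta>. t \<in> {0..1} \<Longrightarrow> exp (B (t, \<eta>)) = u (rot \<eta> (c t))"
    "\<And>t \<eta>. t \<in> {0..1} \<Longrightarrow> B (t, \<eta> + 2 * pi) = B (t, \<eta>) + 2 * pi * \<i> * of_int N"
    using orbit_log[OF uc u0 cc] cX by metis
  have Bc: "continuous_on UNIV (\<lambda>\<eta>. B (t, \<eta>))" if "t \<in> {0..1}" for t
    by (rule continuous_on_compose2[OF B(1)]) (use that in \<open>auto intro!: continuous_intros\<close>)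
  have "B (1, 0) - B (0, 0) = 4 * pi * \<i>"
  proof (rule loop_winding_two[OF assms(1) Fc F])
    show "continuous_on {0..1} (\<lambda>x. B (x, 0))"
      by (rule continuous_on_compose2[OF B(1)]) (auto intro!: continuous_intros)
    show "exp (B (x, 0)) = F (0, r * cis (2 * pi * x))" if "x \<in> {0..1}" for x
      using B(2)[OF that, of 0] uh[OF cn[of x]] by (simp add: c_def)
  qed
  moreover have "B (1, \<eta>) - B (0, \<eta>) = B (1, 0) - B (0, 0)" for \<eta>
    by (rule logs_differ_by_constant[of UNIV]) (use Bc B(2) c10 in auto)
  ultimately have B1: "B (1, \<eta>) = B (0, \<eta>) + 2 * pi * \<i> * of_int 2" for \<eta>
    by (simp add: algebra_simps)
  obtain A where A: "continuous_on {0..1} A" "\<And>t. t \<in> {0..1} \<Longrightarrow> exp (A t) = G25 (c t)"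
    using continuous_log_on_convex[of "{0..1}" "\<lambda>t. G25 (c t)"] cX cc
    by (metis continuous_on_G25 convex_real_interval(5))
  have "exp (A 1) = exp (A 0)" using A(2)[of 0] A(2)[of 1] c10 by simp
  then obtain k :: int where k: "A 1 = A 0 + 2 * pi * \<i> * k"
    unfolding exp_eq by (metis (no_types, lifting) mult.assoc mult.commute of_int_mult of_int_numeral of_real_mult of_real_of_int_eq)
  have "10 * 2 = N * k"
  proof (rule orbit_winding_relation[OF assms(2) uc u0 cc _ c10 B(1,2) _ B1 A k])
    show "c ` {0..1} \<subseteq> {p \<in> sphere 0 \<sigma>. G25 p \<noteq> 0}" using cX by auto
    show "B (0, \<eta> + 2 * pi) = B (0, \<eta>) + 2 * pi * \<i> * of_int N" for \<eta> using B(3)[of 0] by simp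
  qed auto
  have N3: "\<not> 3 dvd N"
  proof
    assume "3 dvd N"
    then have "3 dvd N * k" by simp
    then show False using \<open>10 * 2 = N * k\<close> by presburger
  qed

  define \<Gamma> where "\<Gamma> p \<tau> = Complex (Re (m * fst (\<psi> p) * exp (- \<tau> / 3))) (Re (snd (\<psi> p) * exp (- \<tau> / 2)))" for p \<tau>
  have \<Gamma>0: "\<Gamma> p \<tau> \<noteq> 0" if "norm p = \<sigma>" "exp \<tau> = u p" for p \<tau>
    unfolding \<Gamma>_def using that h1(4)[of p] F[of "fst (\<psi> p)" "snd (\<psi> p)"]
    by (intro cusp_function_nonzero[of _ "u p"]) (auto simp: u_def)
  define \<epsilon> where "\<epsilon> = exp (- (4 * pi * \<i> * of_int N) / 3)"
  \<comment> \<open>\<open>B\<close> lifts the orbits through an arc to the infinite cyclic cover,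
    starting from the principal logarithm on the arc; \<open>\<Lambda>\<close> is a logarithm of
    \<open>\<Gamma>\<close> on this convex strip.\<close>
  have ex: "\<exists>B \<Lambda>. continuous_on ({0..pi} \<times> UNIV) B \<and> continuous_on ({0..pi} \<times> UNIV) \<Lambda> \<and>
      (\<forall>\<theta>\<in>{0..pi}. B (\<theta>, 0) = Ln (F (cusp_arc r m \<zeta> \<theta>))) \<and>
      (\<forall>\<theta>\<in>{0..pi}. \<forall>\<eta>. exp (B (\<theta>, \<eta>)) = u (rot \<eta> (h (cusp_arc r m \<zeta> \<theta>))) \<and>
         B (\<theta>, \<eta> + 2 * pi) = B (\<theta>, \<eta>) + 2 * pi * \<i> * of_int N \<and>
         exp (\<Lambda> (\<theta>, \<eta>)) = \<Gamma> (rot \<eta> (h (cusp_arc r m \<zeta> \<theta>))) (B (\<theta>, \<eta>)))"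
    if \<zeta>: "\<zeta> ^ 3 = 1" "norm \<zeta> = 1" for \<zeta>
  proof -
    define d where "d \<theta> = h (cusp_arc r m \<zeta> \<theta>)" for \<theta>
    note an = norm_cusp_arc[OF assms(1,3) \<zeta>(2)]
    note aF = Re_cusp_arc_pos[OF assms(1,3) \<zeta> _ F]
    have aF0: "F (cusp_arc r m \<zeta> \<theta>) \<noteq> 0" if "\<theta> \<in> {0..pi}" for \<theta>
      using aF[OF that] by auto
    have cc: "continuous_on {0..pi} d"
      unfolding d_def by (rule continuous_on_compose2[OF h1(1) continuous_on_cusp_arc]) (use an in auto)
    have cX: "norm (d \<theta>) = \<sigma> \<and> G25 (d \<theta>) \<noteq> 0" if "\<theta> \<in> {0..pi}" for \<theta>
      using h1(3)[OF an] zero_iff[OF an] aF0[OF that] by (simp add: d_def)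
    have cu: "u (d \<theta>) = F (cusp_arc r m \<zeta> \<theta>)" for \<theta> using uh[OF an] by (simp add: d_def)
    obtain B0 N' where B0: "continuous_on ({0..pi} \<times> UNIV) B0"
      "\<And>t \<eta>. t \<in> {0..pi} \<Longrightarrow> exp (B0 (t, \<eta>)) = u (rot \<eta> (d t))"
      "\<And>t \<eta>. t \<in> {0..pi} \<Longrightarrow> B0 (t, \<eta> + 2 * pi) = B0 (t, \<eta>) + 2 * pi * \<i> * of_int N'"
      using orbit_log[OF uc u0 cc cX] by metis
    define L where "L \<theta> = Ln (F (cusp_arc r m \<zeta> \<theta>))" for \<theta>
    have L: "exp (L \<theta>) = u (d \<theta>)" if "\<theta> \<in> {0..pi}" for \<theta>
      using aF0[OF that] by (simp add: L_def cu)
    have Lc: "continuous_on {0..pi} L"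
      unfolding L_def
    proof (intro continuous_intros continuous_on_compose2[OF Fc continuous_on_cusp_arc])
      show "F (cusp_arc r m \<zeta> \<theta>) \<notin> \<real>\<^sub>\<le>\<^sub>0" if "\<theta> \<in> {0..pi}" for \<theta>
        using aF[OF that] by (auto simp: complex_nonpos_Reals_iff)
    qed (use an in auto)
    have z: "0 \<in> {0..pi}" "(0::real) \<in> {0..1}" by auto
    define B' where "B' x = B0 x + (L 0 - B0 (0, 0))" for x
    have B'c: "continuous_on ({0..pi} \<times> UNIV) B'"
      unfolding B'_def by (intro continuous_intros B0)
    have B'exp: "exp (B' (\<theta>, \<eta>)) = u (rot \<eta> (d \<theta>))" if "\<theta> \<in> {0..pi}" for \<theta> \<eta>
    proof -
      have "exp (L 0 - B0 (0, 0)) = 1"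
        using L[OF z(1)] B0(2)[OF z(1), of 0] by (simp add: exp_diff) (metis exp_not_eq_zero)
      then show ?thesis using B0(2)[OF that] by (simp add: B'_def exp_add)
    qed
    have B'0: "B' (\<theta>, 0) = L \<theta>" if "\<theta> \<in> {0..pi}" for \<theta>
    proof -
      have "B' (\<theta>, 0) - L \<theta> = B' (0, 0) - L 0"
      proof (rule logs_differ_by_constant[of "{0..pi}" "\<lambda>\<theta>. B' (\<theta>, 0)" L])
        show "continuous_on {0..pi} (\<lambda>\<theta>. B' (\<theta>, 0))"
          by (rule continuous_on_compose2[OF B'c]) (auto intro!: continuous_intros)
      qed (use Lc L B'exp that in auto)
      then show ?thesis by (simp add: B'_def)
    qed
    \<comment> \<open>The arc starts at the point \<open>c 0\<close> of the loop, so the two strips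
      share an orbit and hence the increment along it.\<close>
    have "N' = N"
    proof -
      have c0: "d 0 = c 0" by (simp add: d_def c_def cusp_arc_def)
      have "B0 (0, 2 * pi) - B (0, 2 * pi) = B0 (0, 0) - B (0, 0)"
      proof (rule logs_differ_by_constant[of UNIV "\<lambda>\<eta>. B0 (0, \<eta>)" "\<lambda>\<eta>. B (0, \<eta>)"])
        show "continuous_on UNIV (\<lambda>\<eta>. B0 (0, \<eta>))"
          by (rule continuous_on_compose2[OF B0(1)]) (auto intro!: continuous_intros)
        show "continuous_on UNIV (\<lambda>\<eta>. B (0, \<eta>))" using Bc by simp
        show "exp (B0 (0, \<eta>)) = exp (B (0, \<eta>))" for \<eta>
          using B0(2)[OF z(1), of \<eta>] B(2)[OF z(2), of \<eta>] by (simp add: c0)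
      qed auto
      then have "of_int N' = (of_int N :: complex)"
        using B0(3)[OF z(1), of 0] B(3)[OF z(2), of 0] by simp
      then show ?thesis by (simp only: of_int_eq_iff)
    qed
    have cd: "continuous_on ({0..pi} \<times> (UNIV :: real set)) (\<lambda>x. d (fst x))"
      by (rule continuous_on_compose2[OF cc]) (auto intro!: continuous_intros)
    have "convex ({0..pi} \<times> (UNIV :: real set))" by (intro convex_Times) auto
    moreover have "continuous_on ({0..pi} \<times> UNIV) (\<lambda>x. \<Gamma> (rot (snd x) (d (fst x))) (B' x))"
      unfolding \<Gamma>_def Complex_eq
      by (intro continuous_intros B'c continuous_on_compose2[OF h1(2)] cd) (use cX in auto)
    moreover have "\<Gamma> (rot (snd x) (d (fst x))) (B' x) \<noteq> 0" if "x \<in> {0..pi} \<times> UNIV" for x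
      using that cX[of "fst x"] B'exp[of "fst x" "snd x"] by (intro \<Gamma>0) auto
    ultimately obtain \<Lambda> where \<Lambda>: "continuous_on ({0..pi} \<times> UNIV) \<Lambda>"
      "\<And>x. x \<in> {0..pi} \<times> UNIV \<Longrightarrow> exp (\<Lambda> x) = \<Gamma> (rot (snd x) (d (fst x))) (B' x)"
      using continuous_log_on_convex[of "{0..pi} \<times> (UNIV :: real set)"] by blast
    show ?thesis
      using B'c \<Lambda> B'0 B'exp B0(3) \<open>N' = N\<close>
      by (intro exI[of _ B'] exI[of _ \<Lambda>]) (auto simp: B'_def d_def L_def)
  qed
  have ends: "cusp_arc r m \<zeta> 0 = (0, of_real r)" "cusp_arc r m \<zeta> pi = (0, - of_real r)" for \<zeta>
    by (simp_all add: cusp_arc_def)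
  have \<psi>h: "\<psi> (h (cusp_arc r m \<zeta> \<theta>)) = cusp_arc r m \<zeta> \<theta>" if "norm \<zeta> = 1" for \<zeta> \<theta>
    using h1(5) norm_cusp_arc[OF assms(1,3) that] by blast
  have three: "\<epsilon> ^ 3 = 1" unfolding \<epsilon>_def by (rule exp_third_eq_one)
  obtain \<kappa> where \<kappa>: "\<bar>\<kappa>\<bar> = pi / 3" "\<epsilon> = - cis \<kappa>"
    using cis_multiple_third[OF N3] unfolding \<epsilon>_def by metis
  define L where "L \<zeta> \<theta> = Ln (F (cusp_arc r m \<zeta> \<theta>))" for \<zeta> \<theta>
  define g where "g \<zeta> \<xi> \<theta> = Complex (Re (- (\<zeta> * \<xi>) * exp (- L \<zeta> \<theta> / 3)) * (norm m * (r * sin \<theta>)))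
      (r * cos \<theta> * Re (exp (- L \<zeta> \<theta> / 2)))" for \<zeta> \<xi> \<theta>
  have \<Gamma>g: "\<Gamma> (h (cusp_arc r m \<zeta> \<theta>)) (L \<zeta> \<theta> + 2 * (2 * pi * \<i> * of_int N)) = g \<zeta> \<epsilon> \<theta>"
     "\<Gamma> (h (cusp_arc r m \<zeta> \<theta>)) (L \<zeta> \<theta>) = g \<zeta> 1 \<theta>" if "norm \<zeta> = 1" for \<zeta> \<theta>
  proof -
    have fs: "m * fst (\<psi> (h (cusp_arc r m \<zeta> \<theta>))) = - \<zeta> * of_real (norm m * (r * sin \<theta>))"
      "snd (\<psi> (h (cusp_arc r m \<zeta> \<theta>))) = of_real (r * cos \<theta>)"
      unfolding \<psi>h[OF that] by (simp_all only: mult_fst_cusp_arc[OF assms(3)]) (simp add: cusp_arc_def)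
    \<comment> \<open>Two turns add \<open>4 * pi * \<i> * N\<close> to \<open>\<tau>\<close>. The
      factor with exponent \<open>- \<tau> / 2\<close> returns to itself, while the one with
      exponent \<open>- \<tau> / 3\<close> is multiplied by \<open>\<epsilon>\<close>. A single turn
      could change the sign of the former.\<close>
    have e3: "exp (- (L \<zeta> \<theta> + 2 * (2 * pi * \<i> * of_int N)) / 3) = \<epsilon> * exp (- L \<zeta> \<theta> / 3)"
      unfolding \<epsilon>_def exp_add[symmetric] by (rule arg_cong[where f=exp]) (simp add: field_simps)
    have "exp (- (L \<zeta> \<theta> + 2 * (2 * pi * \<i> * of_int N)) / 2) = exp (- L \<zeta> \<theta> / 2) * exp (2 * of_int (- N) * pi * \<i>)"
      unfolding exp_add[symmetric] by (rule arg_cong[where f=exp]) (simp add: field_simps)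
    moreover have "exp (2 * of_int (- N) * pi * \<i>) = 1"
      unfolding exp_eq_1 by (auto intro: exI[of _ "- N"])
    ultimately have e2: "exp (- (L \<zeta> \<theta> + 2 * (2 * pi * \<i> * of_int N)) / 2) = exp (- L \<zeta> \<theta> / 2)" by simp
    have mv: "- \<zeta> * of_real a * (\<epsilon> * y) = of_real a * (- (\<zeta> * \<epsilon>) * y)"
      "- \<zeta> * of_real a * y = of_real a * (- \<zeta> * y)" for a y
      by (simp_all add: algebra_simps)
    have rr: "Re (of_real a * z) = Re z * a" "Re (of_real a * z) = a * Re z" for a z
      by simp_all
    show "\<Gamma> (h (cusp_arc r m \<zeta> \<theta>)) (L \<zeta> \<theta> + 2 * (2 * pi * \<i> * of_int N)) = g \<zeta> \<epsilon> \<theta>"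
      unfolding \<Gamma>_def g_def e3 e2 fs mv(1) rr(1) by (simp only: mult.commute)
    show "\<Gamma> (h (cusp_arc r m \<zeta> \<theta>)) (L \<zeta> \<theta>) = g \<zeta> 1 \<theta>"
      unfolding \<Gamma>_def g_def fs mv(2) rr(1) mult_1_right by (simp only: mult.commute)
  qed
  define P where "P \<zeta> B \<Lambda> D \<longleftrightarrow> continuous_on {0..pi} D \<and> (\<forall>\<theta>\<in>{0..pi}. exp (D \<theta>) = g \<zeta> \<epsilon> \<theta> / g \<zeta> 1 \<theta>) \<and>
     (\<forall>\<theta>\<in>{0..pi}. g \<zeta> \<epsilon> \<theta> \<noteq> 0 \<and> g \<zeta> 1 \<theta> \<noteq> 0) \<and>
     (\<forall>\<theta>. D \<theta> = \<Lambda> (\<theta>, 4 * pi) - \<Lambda> (\<theta>, 0)) \<and>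
     (\<forall>\<theta>\<in>{0..pi}. continuous_on UNIV (\<lambda>\<eta>. B (\<theta>, \<eta>)) \<and> continuous_on UNIV (\<lambda>\<eta>. \<Lambda> (\<theta>, \<eta>)) \<and> B (\<theta>, 0) = L \<zeta> \<theta> \<and>
       (\<forall>\<eta>. exp (B (\<theta>, \<eta>)) = u (rot \<eta> (h (cusp_arc r m \<zeta> \<theta>))) \<and>
         exp (\<Lambda> (\<theta>, \<eta>)) = \<Gamma> (rot \<eta> (h (cusp_arc r m \<zeta> \<theta>))) (B (\<theta>, \<eta>))))" for \<zeta> and B \<Lambda> :: "real \<times> real \<Rightarrow> complex" and D
  have Dex: "\<exists>B \<Lambda> D. P \<zeta> B \<Lambda> D"
    if \<zeta>: "\<zeta> ^ 3 = 1" "norm \<zeta> = 1" for \<zeta>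
  proof -
    obtain B \<Lambda> where B: "continuous_on ({0..pi} \<times> UNIV) B" "continuous_on ({0..pi} \<times> UNIV) \<Lambda>"
      "\<And>\<theta>. \<theta> \<in> {0..pi} \<Longrightarrow> B (\<theta>, 0) = L \<zeta> \<theta>"
      "\<And>\<theta> \<eta>. \<theta> \<in> {0..pi} \<Longrightarrow> exp (B (\<theta>, \<eta>)) = u (rot \<eta> (h (cusp_arc r m \<zeta> \<theta>)))"
      "\<And>\<theta> \<eta>. \<theta> \<in> {0..pi} \<Longrightarrow> B (\<theta>, \<eta> + 2 * pi) = B (\<theta>, \<eta>) + 2 * pi * \<i> * of_int N"
      "\<And>\<theta> \<eta>. \<theta> \<in> {0..pi} \<Longrightarrow> exp (\<Lambda> (\<theta>, \<eta>)) = \<Gamma> (rot \<eta> (h (cusp_arc r m \<zeta> \<theta>))) (B (\<theta>, \<eta>))"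
      using ex[OF \<zeta>] unfolding L_def by metis
    have sl: "continuous_on {0..pi} (\<lambda>\<theta>. \<Lambda> (\<theta>, \<eta>))" for \<eta>
      by (rule continuous_on_compose2[OF B(2)]) (auto intro!: continuous_intros)
    have sl2: "continuous_on UNIV (\<lambda>\<eta>. \<Lambda> (\<theta>, \<eta>))" "continuous_on UNIV (\<lambda>\<eta>. B (\<theta>, \<eta>))" if "\<theta> \<in> {0..pi}" for \<theta>
      by (rule continuous_on_compose2[OF B(2)] continuous_on_compose2[OF B(1)]; use that in \<open>auto intro!: continuous_intros\<close>)+
    have e0: "exp (\<Lambda> (\<theta>, 0)) = g \<zeta> 1 \<theta>" if "\<theta> \<in> {0..pi}" for \<theta>
      using B(6)[OF that, of 0] B(3)[OF that] \<Gamma>g(2)[OF \<zeta>(2)] by simp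
    have e4: "exp (\<Lambda> (\<theta>, 4 * pi)) = g \<zeta> \<epsilon> \<theta>" if "\<theta> \<in> {0..pi}" for \<theta>
    proof -
      have "B (\<theta>, 4 * pi) = L \<zeta> \<theta> + 2 * (2 * pi * \<i> * of_int N)"
        using B(5)[OF that, of 0] B(5)[OF that, of "2 * pi"] B(3)[OF that] by simp
      moreover have "rot (4 * pi) p = p" for p
        using rot_2pi[of 0 2 p] by simp
      ultimately show ?thesis
        using B(6)[OF that, of "4 * pi"] \<Gamma>g(1)[OF \<zeta>(2), of \<theta>] by simp
    qed
    have gn: "g \<zeta> \<epsilon> \<theta> \<noteq> 0 \<and> g \<zeta> 1 \<theta> \<noteq> 0" if "\<theta> \<in> {0..pi}" for \<theta>
      unfolding e0[OF that, symmetric] e4[OF that, symmetric] by simp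
    have eD: "exp (\<Lambda> (\<theta>, 4 * pi) - \<Lambda> (\<theta>, 0)) = g \<zeta> \<epsilon> \<theta> / g \<zeta> 1 \<theta>" if "\<theta> \<in> {0..pi}" for \<theta>
      unfolding exp_diff e0[OF that] e4[OF that] ..
    have cD: "continuous_on {0..pi} (\<lambda>\<theta>. \<Lambda> (\<theta>, 4 * pi) - \<Lambda> (\<theta>, 0))"
      by (intro continuous_intros sl)
    show ?thesis unfolding P_def
      by (intro exI[of _ B] exI[of _ \<Lambda>] exI[of _ "\<lambda>\<theta>. \<Lambda> (\<theta>, 4 * pi) - \<Lambda> (\<theta>, 0)"] conjI ballI allI)
        (rule cD refl | (rule eD gn[THEN conjunct1] gn[THEN conjunct2] sl2 B(3,4,6), assumption))+
  qed
  have one: "(1::complex) ^ 3 = 1" "norm (1::complex) = 1" by simp_all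
  have \<epsilon>n: "norm \<epsilon> = 1" using \<kappa> by simp
  have \<epsilon>0: "\<epsilon> \<noteq> 0" using \<epsilon>n by auto
  have i3: "inverse \<epsilon> ^ 3 = 1" "norm (inverse \<epsilon>) = 1" using three \<epsilon>n by (simp_all add: power_inverse norm_inverse)
  obtain B0 \<Lambda>0 D0 where "P 1 B0 \<Lambda>0 D0" using Dex[OF one] by blast
  then have D0: "continuous_on {0..pi} D0" "\<And>\<theta>. \<theta>\<in>{0..pi} \<Longrightarrow> exp (D0 \<theta>) = g 1 \<epsilon> \<theta> / g 1 1 \<theta>"
     "\<And>\<theta>. \<theta>\<in>{0..pi} \<Longrightarrow> g 1 \<epsilon> \<theta> \<noteq> 0 \<and> g 1 1 \<theta> \<noteq> 0"
     "\<And>\<theta>. D0 \<theta> = \<Lambda>0 (\<theta>, 4 * pi) - \<Lambda>0 (\<theta>, 0)"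
     "\<And>\<theta>. \<theta>\<in>{0..pi} \<Longrightarrow> continuous_on UNIV (\<lambda>\<eta>. B0 (\<theta>, \<eta>)) \<and> continuous_on UNIV (\<lambda>\<eta>. \<Lambda>0 (\<theta>, \<eta>)) \<and> B0 (\<theta>, 0) = L 1 \<theta>"
     "\<And>\<theta> \<eta>. \<theta>\<in>{0..pi} \<Longrightarrow> exp (B0 (\<theta>, \<eta>)) = u (rot \<eta> (h (cusp_arc r m 1 \<theta>))) \<and>
         exp (\<Lambda>0 (\<theta>, \<eta>)) = \<Gamma> (rot \<eta> (h (cusp_arc r m 1 \<theta>))) (B0 (\<theta>, \<eta>))"
    unfolding P_def by blast+
  obtain B1 \<Lambda>1 D1 where "P (inverse \<epsilon>) B1 \<Lambda>1 D1" using Dex[OF i3] by blast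
  then have D1: "continuous_on {0..pi} D1" "\<And>\<theta>. \<theta>\<in>{0..pi} \<Longrightarrow> exp (D1 \<theta>) = g (inverse \<epsilon>) \<epsilon> \<theta> / g (inverse \<epsilon>) 1 \<theta>"
     "\<And>\<theta>. \<theta>\<in>{0..pi} \<Longrightarrow> g (inverse \<epsilon>) \<epsilon> \<theta> \<noteq> 0 \<and> g (inverse \<epsilon>) 1 \<theta> \<noteq> 0"
     "\<And>\<theta>. D1 \<theta> = \<Lambda>1 (\<theta>, 4 * pi) - \<Lambda>1 (\<theta>, 0)"
     "\<And>\<theta>. \<theta>\<in>{0..pi} \<Longrightarrow> continuous_on UNIV (\<lambda>\<eta>. B1 (\<theta>, \<eta>)) \<and> continuous_on UNIV (\<lambda>\<eta>. \<Lambda>1 (\<theta>, \<eta>)) \<and> B1 (\<theta>, 0) = L (inverse \<epsilon>) \<theta>"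
     "\<And>\<theta> \<eta>. \<theta>\<in>{0..pi} \<Longrightarrow> exp (B1 (\<theta>, \<eta>)) = u (rot \<eta> (h (cusp_arc r m (inverse \<epsilon>) \<theta>))) \<and>
         exp (\<Lambda>1 (\<theta>, \<eta>)) = \<Gamma> (rot \<eta> (h (cusp_arc r m (inverse \<epsilon>) \<theta>))) (B1 (\<theta>, \<eta>))"
    unfolding P_def by blast+
  \<comment> \<open>The difference of logarithms is the increment of \<open>\<Lambda>\<close> along
    the twice traversed orbit. The two arcs have the same end points, hence the same orbits
    there.\<close>
  have D01: "D0 \<theta> = D1 \<theta>" if \<theta>: "\<theta> = 0 \<or> \<theta> = pi" for \<theta>
  proof -
    have I: "\<theta> \<in> {0..pi}" using \<theta> by auto
    have eq: "cusp_arc r m 1 \<theta> = cusp_arc r m (inverse \<epsilon>) \<theta>" using \<theta> ends by auto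
    have Leq: "L 1 \<theta> = L (inverse \<epsilon>) \<theta>" by (simp add: L_def eq)
    have "B0 (\<theta>, \<eta>) - B1 (\<theta>, \<eta>) = B0 (\<theta>, 0) - B1 (\<theta>, 0)" for \<eta>
      by (rule logs_differ_by_constant[of UNIV "\<lambda>\<eta>. B0 (\<theta>, \<eta>)" "\<lambda>\<eta>. B1 (\<theta>, \<eta>)"])
        (use D0(5,6)[OF I] D1(5,6)[OF I] eq in auto)
    then have BB: "B0 (\<theta>, \<eta>) = B1 (\<theta>, \<eta>)" for \<eta>
      using D0(5)[OF I] D1(5)[OF I] Leq by simp
    have "\<Lambda>0 (\<theta>, 4 * pi) - \<Lambda>1 (\<theta>, 4 * pi) = \<Lambda>0 (\<theta>, 0) - \<Lambda>1 (\<theta>, 0)"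
      by (rule logs_differ_by_constant[of UNIV "\<lambda>\<eta>. \<Lambda>0 (\<theta>, \<eta>)" "\<lambda>\<eta>. \<Lambda>1 (\<theta>, \<eta>)"])
        (use D0(5,6)[OF I] D1(5,6)[OF I] eq BB in auto)
    then show ?thesis unfolding D0(4) D1(4) by (simp add: algebra_simps)
  qed
  have FRe: "Re (F (cusp_arc r m \<zeta> \<theta>)) > 0" if "\<zeta> ^ 3 = 1" "norm \<zeta> = 1" "\<theta> \<in> {0..pi}" for \<zeta> \<theta>
    by (rule Re_cusp_arc_pos[OF assms(1,3) that F])
  have gc: "continuous_on {0..pi} (g \<zeta> \<xi>)" if \<zeta>: "\<zeta> ^ 3 = 1" "norm \<zeta> = 1" for \<zeta> \<xi>
  proof -
    have "continuous_on {0..pi} (L \<zeta>)"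
      unfolding L_def
    proof (intro continuous_intros continuous_on_compose2[OF Fc continuous_on_cusp_arc])
      show "F (cusp_arc r m \<zeta> \<theta>) \<notin> \<real>\<^sub>\<le>\<^sub>0" if "\<theta> \<in> {0..pi}" for \<theta>
        using FRe[OF \<zeta> that] by (auto simp: complex_nonpos_Reals_iff)
    qed (use norm_cusp_arc[OF assms(1,3) \<zeta>(2)] in auto)
    then show ?thesis unfolding g_def Complex_eq by (intro continuous_intros) auto
  qed
  have sinpos: "norm m * (r * sin \<theta>) \<ge> 0" if "\<theta> \<in> {0..pi}" for \<theta>
    using that assms(1) by (auto intro!: mult_nonneg_nonneg sin_ge_zero)
  have neg: "Re (g \<zeta> \<xi> \<theta>) \<le> 0" if \<zeta>: "\<zeta> ^ 3 = 1" "norm \<zeta> = 1" "\<zeta> * \<xi> = 1" "\<theta> \<in> {0..pi}" for \<zeta> \<xi> \<theta>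
    using cis_rotation_Re_pos[OF FRe[OF \<zeta>(1,2,4)], of 0] sinpos[OF \<zeta>(4)]
    by (simp add: g_def \<zeta>(3) L_def mult_nonneg_nonneg)
  have pos: "Re (g \<zeta> \<xi> \<theta>) \<ge> 0" if \<zeta>: "\<zeta> ^ 3 = 1" "norm \<zeta> = 1" "- (\<zeta> * \<xi>) = cis \<mu>" "\<bar>\<mu>\<bar> = pi / 3" "\<theta> \<in> {0..pi}" for \<zeta> \<xi> \<theta> \<mu>
  proof -
    have "Re (cis \<mu> * exp (- Ln (F (cusp_arc r m \<zeta> \<theta>)) / 3)) > 0"
      by (rule cis_rotation_Re_pos[OF FRe[OF \<zeta>(1,2,5)]]) (simp add: \<zeta>(4))
    then show ?thesis
      unfolding g_def \<zeta>(3) L_def complex.sel by (intro mult_nonneg_nonneg[OF less_imp_le sinpos[OF \<zeta>(5)]])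
  qed
  define a where "a = r * Re (exp (- Ln (F (0, of_real r)) / 2))"
  define b where "b = r * Re (exp (- Ln (F (0, - of_real r)) / 2))"
  have Fr: "Re (F (0, of_real r)) > 0" "Re (F (0, - of_real r)) > 0"
    using FRe[of 1 0] FRe[of 1 pi] ends[of 1] by simp_all
  have ab: "a > 0" "b > 0"
    unfolding a_def b_def by (intro mult_pos_pos assms(1) Re_exp_half_Ln_pos Fr)+
  have gends: "g \<zeta> \<xi> 0 = \<i> * of_real a" "g \<zeta> \<xi> pi = - (\<i> * of_real b)" for \<zeta> \<xi>
    by (simp_all add: g_def L_def ends a_def b_def complex_eq_iff)
  have ie: "- (inverse \<epsilon> * 1) = cis (- \<kappa>)" by (simp add: \<kappa>(2) cis_inverse)
  have d0: "D0 pi - D0 0 = - (2 * pi * \<i>)"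
  proof (rule arc_log_change[where g = "g 1 1" and g' = "g 1 \<epsilon>" and D = D0 and a = a and b = b])
    show "Re (g 1 1 \<theta>) \<le> 0" "Re (g 1 \<epsilon> \<theta>) \<ge> 0" if "\<theta> \<in> {0..pi}" for \<theta>
      using neg[OF one _ that] pos[OF one _ \<kappa>(1) that] \<kappa>(2) by simp_all
  qed (use gc[OF one] D0(1,2,3) ab gends in simp_all)
  \<comment> \<open>Replacing 1 by \<open>inverse \<epsilon>\<close> exchanges the half planes: now
    \<open>\<zeta> * \<epsilon> = 1\<close>, so the function after two turns is the one on the left.
    Thus \<open>D0\<close> and \<open>D1\<close> agree at both ends but have opposite nonzero
    increments.\<close>
  have d1: "(- D1 pi) - (- D1 0) = - (2 * pi * \<i>)"
  proof (rule arc_log_change[where g = "g (inverse \<epsilon>) \<epsilon>" and g' = "g (inverse \<epsilon>) 1" and D = "\<lambda>t. - D1 t" and a = a and b = b])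
    show "Re (g (inverse \<epsilon>) \<epsilon> \<theta>) \<le> 0" "Re (g (inverse \<epsilon>) 1 \<theta>) \<ge> 0" if "\<theta> \<in> {0..pi}" for \<theta>
      using neg[OF i3 _ that, of \<epsilon>] pos[OF i3 ie _ that] \<kappa>(1) \<epsilon>0 by simp_all
    show "continuous_on {0..pi} (\<lambda>t. - D1 t)" by (intro continuous_intros D1)
    show "exp (- D1 t) = g (inverse \<epsilon>) 1 t / g (inverse \<epsilon>) \<epsilon> t" if "t \<in> {0..pi}" for t
      using D1(2)[OF that] by (simp add: exp_minus)
  qed (use gc[OF i3] D1(3) ab gends in simp_all)
  have "Im (D0 pi) - Im (D0 0) = - (2 * pi)" "Im (D1 0) - Im (D1 pi) = - (2 * pi)"
    using arg_cong[OF d0, of Im] arg_cong[OF d1, of Im] by simp_all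
  then show False
    using D01[of 0] D01[of pi] pi_gt_zero by (simp del: pi_gt_zero)
qed

section \<open>Germs with two smooth branches\<close>

text \<open>Each curve \<open>t = w * s ^ k\<close> with \<open>s\<close> positive real meets the
  sphere in one point depending continuously on \<open>w\<close>; so zeros can be sought on a fixed
  sphere with \<open>w\<close> as the only unknown.\<close>

lemma radius_function:
  assumes "r > 0" "k = 1 \<or> k = 2"
  obtains \<sigma> :: "complex \<Rightarrow> real" where "continuous_on UNIV \<sigma>" "\<And>w. \<sigma> w > 0"
    "\<And>w. norm (of_real (\<sigma> w) :: complex, of_real (\<sigma> w) ^ k * w) = r"
proof -
  have n: "norm (of_real x :: complex, of_real x ^ k * w) = r" if "x\<^sup>2 + (x ^ k)\<^sup>2 * (norm w)\<^sup>2 = r\<^sup>2" for x and w :: complex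
  proof -
    have "(\<bar>x\<bar> ^ k)\<^sup>2 = (x ^ k)\<^sup>2" by (simp flip: power_abs)
    then show ?thesis
      using that assms(1) by (simp add: norm_prod_def norm_mult norm_power power_mult_distrib)
  qed
  from assms(2) show ?thesis
  proof
    assume k: "k = 1"
    show ?thesis
    proof (rule that[of "\<lambda>w. r / sqrt (1 + (norm w)\<^sup>2)"])
      fix w :: complex
      have p: "1 + (norm w)\<^sup>2 > 0" by (simp add: add_pos_nonneg)
      show "r / sqrt (1 + (norm w)\<^sup>2) > 0" using assms(1) p by simp
      show "norm (of_real (r / sqrt (1 + (norm w)\<^sup>2)) :: complex, of_real (r / sqrt (1 + (norm w)\<^sup>2)) ^ k * w) = r"
      proof (rule n)
        have "(r / sqrt (1 + (norm w)\<^sup>2))\<^sup>2 = r\<^sup>2 / (1 + (norm w)\<^sup>2)" using p by (simp add: power_divide)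
        then have "(r / sqrt (1 + (norm w)\<^sup>2))\<^sup>2 * (1 + (norm w)\<^sup>2) = r\<^sup>2" using p by simp
        then show "(r / sqrt (1 + (norm w)\<^sup>2))\<^sup>2 + ((r / sqrt (1 + (norm w)\<^sup>2)) ^ k)\<^sup>2 * (norm w)\<^sup>2 = r\<^sup>2"
          by (simp only: k power_one_right distrib_left mult_1_right)
      qed
      show "continuous_on UNIV (\<lambda>w::complex. r / sqrt (1 + (norm w)\<^sup>2))"
      proof (intro continuous_intros ballI)
        show "sqrt (1 + (norm w)\<^sup>2) \<noteq> 0" for w :: complex
          using add_pos_nonneg[OF zero_less_one zero_le_power2[of "norm w"]] by simp
      qed
    qed
  next
    assume k: "k = 2"
    define D where "D w = sqrt (1 + 4 * r\<^sup>2 * (norm w)\<^sup>2)" for w :: complex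
    have D: "D w \<ge> 0" for w by (simp add: D_def)
    have D2: "(D w)\<^sup>2 = 1 + 4 * r\<^sup>2 * (norm w)\<^sup>2" for w by (simp add: D_def)
    show ?thesis
    \<comment> \<open>The square of the radius is the positive root \<open>y\<close> of
      \<open>y + y\<^sup>2 * (norm w)\<^sup>2 = r\<^sup>2\<close>, written with the square root in
      the denominator so that \<open>w = 0\<close> is no exception.\<close>
    proof (rule that[of "\<lambda>w. sqrt (2 * r\<^sup>2 / (1 + D w))"])
      fix w :: complex
      have p: "1 + D w > 0" using D[of w] by simp
      show "sqrt (2 * r\<^sup>2 / (1 + D w)) > 0" using assms(1) p by simp
      define y where "y = 2 * r\<^sup>2 / (1 + D w)"
      have y: "y \<ge> 0" using p by (simp add: y_def)
      have "y + y\<^sup>2 * (norm w)\<^sup>2 = r\<^sup>2"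
      proof -
        have yE: "y * (1 + D w) = 2 * r\<^sup>2" using p by (simp add: y_def)
        have "(y + y\<^sup>2 * (norm w)\<^sup>2) * (1 + D w)\<^sup>2 = (y * (1 + D w)) * (1 + D w) + (y * (1 + D w))\<^sup>2 * (norm w)\<^sup>2"
          by (simp add: power2_eq_square algebra_simps)
        also have "\<dots> = 2 * r\<^sup>2 * (1 + D w) + r\<^sup>2 * (4 * r\<^sup>2 * (norm w)\<^sup>2)"
          unfolding yE by (simp add: power2_eq_square)
        also have "4 * r\<^sup>2 * (norm w)\<^sup>2 = (D w)\<^sup>2 - 1" by (simp add: D2)
        also have "2 * r\<^sup>2 * (1 + D w) + r\<^sup>2 * ((D w)\<^sup>2 - 1) = r\<^sup>2 * (1 + D w)\<^sup>2"
          by (simp add: power2_eq_square algebra_simps)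
        finally show ?thesis using p by simp
      qed
      then show "norm (of_real (sqrt (2 * r\<^sup>2 / (1 + D w))) :: complex, of_real (sqrt (2 * r\<^sup>2 / (1 + D w))) ^ k * w) = r"
        unfolding y_def[symmetric] using y by (intro n) (simp add: k)
      show "continuous_on UNIV (\<lambda>w. sqrt (2 * r\<^sup>2 / (1 + D w)))"
      proof (intro continuous_intros ballI)
        show "1 + D w \<noteq> 0" for w using D[of w] by linarith
        show "continuous_on UNIV D" unfolding D_def by (intro continuous_intros)
      qed
    qed
  qed
qed

text \<open>For distinct \<alpha>, \<beta> this is a node if \<open>k = 1\<close> and a tacnode if
  \<open>k = 2\<close>. The error is small against the leading form when \<open>s\<close> has weight
  1 and \<open>t\<close> has weight \<open>k\<close>.\<close>

definition two_branches :: "nat \<Rightarrow> complex \<Rightarrow> complex \<Rightarrow> (complex \<times> complex \<Rightarrow> complex) \<Rightarrow> bool" where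
  "two_branches k \<alpha> \<beta> F \<longleftrightarrow> (\<forall>\<epsilon>>0. \<exists>\<delta>>0. \<forall>s t. norm (s, t) < \<delta> \<longrightarrow>
     norm (F (s, t) - (t - \<alpha> * s ^ k) * (t - \<beta> * s ^ k)) \<le> \<epsilon> * (max (norm s ^ k) (norm t))\<^sup>2)"

lemma two_branches_commute: "two_branches k \<alpha> \<beta> F \<Longrightarrow> two_branches k \<beta> \<alpha> F"
  by (simp add: two_branches_def mult.commute)

text \<open>The points are produced directly on the sphere of radius \<open>r\<close>: in \<open>t = s\<^sup>k w\<close> with \<open>s\<close> the positive real
  determined by \<open>w\<close>, a zero is a fixed point of a perturbed Newton step, and Brouwer applies.\<close>

lemma point_on_branch:
  assumes "two_branches k \<alpha> \<beta> F" "continuous_on UNIV F" "\<alpha> \<noteq> \<beta>" "k = 1 \<or> k = 2"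
  shows "\<exists>e>0. \<forall>r. 0 < r \<and> r < e \<longrightarrow>
    (\<exists>s t. norm (s, t) = r \<and> F (s, t) = 0 \<and> norm (t - \<alpha> * s ^ k) < norm (t - \<beta> * s ^ k))"
proof -
  define d where "d = norm (\<alpha> - \<beta>)"
  have d: "d > 0" using assms(3) by (simp add: d_def)
  \<comment> \<open>\<open>W\<close> bounds \<open>max 1 (norm w)\<close> on the ball of radius
    \<open>d / 4\<close> about \<alpha>; the constant \<open>d\<^sup>2 / (8 * W\<^sup>2)\<close> is
    chosen so that the error of \<open>P\<close> there is at most
    \<open>d\<^sup>2 / 8\<close>.\<close>
  define W where "W = 1 + norm \<alpha> + d"
  have W: "W > 0" using d by (simp add: W_def add_pos_nonneg)
  obtain e where e: "e > 0" "\<And>s t. norm (s, t) < e \<Longrightarrow>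
     norm (F (s, t) - (t - \<alpha> * s ^ k) * (t - \<beta> * s ^ k)) \<le> d\<^sup>2 / (8 * W\<^sup>2) * (max (norm s ^ k) (norm t))\<^sup>2"
    using assms(1)[unfolded two_branches_def, rule_format, of "d\<^sup>2 / (8 * W\<^sup>2)"] d W by auto
  have "\<exists>s t. norm (s, t) = r \<and> F (s, t) = 0 \<and> norm (t - \<alpha> * s ^ k) < norm (t - \<beta> * s ^ k)"
    if r: "0 < r" "r < e" for r
  proof -
    obtain \<sigma> :: "complex \<Rightarrow> real" where \<sigma>: "continuous_on UNIV \<sigma>" "\<And>w. \<sigma> w > 0"
      "\<And>w. norm (of_real (\<sigma> w) :: complex, of_real (\<sigma> w) ^ k * w) = r"
      using radius_function[OF r(1) assms(4)] by blast
    define x where "x w = complex_of_real (\<sigma> w)" for w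
    have x0: "x w \<noteq> 0" for w using \<sigma>(2)[of w] by (simp add: x_def)
    have xc: "continuous_on S x" for S
      unfolding x_def by (intro continuous_intros continuous_on_subset[OF \<sigma>(1)]) auto
    define P where "P w = F (x w, x w ^ k * w) / (x w ^ k)\<^sup>2" for w
    \<comment> \<open>A Newton step with the derivative frozen at \<open>\<alpha> - \<beta>\<close>,
      its value for \<open>(w - \<alpha>) * (w - \<beta>)\<close> at \<alpha>. The ball of radius
      \<open>d / 4\<close> is preserved since \<open>1 / 16 + 1 / 8 < 1 / 4\<close>.\<close>
    define T where "T w = w - P w / (\<alpha> - \<beta>)" for w
    have est: "norm (P w - (w - \<alpha>) * (w - \<beta>)) \<le> d\<^sup>2 / 8" if w: "w \<in> cball \<alpha> (d / 4)" for w
    proof -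
      have "norm w \<le> norm \<alpha> + norm (w - \<alpha>)" using norm_triangle_ineq[of \<alpha> "w - \<alpha>"] by simp
      also have "\<dots> \<le> W" using w d by (simp add: W_def dist_norm norm_minus_commute)
      finally have "norm w \<le> W" .
      moreover have "1 \<le> W" using d by (simp add: W_def)
      ultimately have mW: "(max 1 (norm w))\<^sup>2 \<le> W\<^sup>2" by (intro power_mono) auto
      have nx: "norm ((x w ^ k)\<^sup>2) > 0" using x0[of w] by simp
      have "P w - (w - \<alpha>) * (w - \<beta>) =
         (F (x w, x w ^ k * w) - (x w ^ k * w - \<alpha> * x w ^ k) * (x w ^ k * w - \<beta> * x w ^ k)) / (x w ^ k)\<^sup>2"
        unfolding P_def using x0[of w] by (simp add: field_simps power2_eq_square)
      also have "norm \<dots> \<le> d\<^sup>2 / (8 * W\<^sup>2) * (max (norm (x w) ^ k) (norm (x w ^ k * w)))\<^sup>2 / norm ((x w ^ k)\<^sup>2)"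
        unfolding norm_divide using \<sigma>(3)[of w] r
        by (intro divide_right_mono e(2)) (auto simp: x_def)
      also have "max (norm (x w) ^ k) (norm (x w ^ k * w)) = norm (x w ^ k) * max 1 (norm w)"
        by (simp add: norm_mult norm_power max_mult_distrib_left)
        also have "d\<^sup>2 / (8 * W\<^sup>2) * (norm (x w ^ k) * max 1 (norm w))\<^sup>2 / norm ((x w ^ k)\<^sup>2) = d\<^sup>2 / (8 * W\<^sup>2) * (max 1 (norm w))\<^sup>2"
        proof -
          have "a * (b * c)\<^sup>2 / b\<^sup>2 = a * c\<^sup>2" if "b \<noteq> 0" for a b c :: real
            using that by (simp add: power_mult_distrib)
          moreover have "norm (x w ^ k) \<noteq> 0" using x0[of w] by simp
          ultimately show ?thesis unfolding norm_power[of "x w ^ k" 2] by blast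
        qed
      also have "\<dots> \<le> d\<^sup>2 / (8 * W\<^sup>2) * W\<^sup>2" using mW by (intro mult_left_mono) auto
      also have "\<dots> = d\<^sup>2 / 8" using W by simp
      finally show ?thesis .
    qed
    obtain w where w: "w \<in> cball \<alpha> (d / 4)" "T w = w"
    proof (rule brouwer[of "cball \<alpha> (d / 4)" T])
      have "continuous_on (cball \<alpha> (d / 4)) P"
        unfolding P_def
        by (intro continuous_intros continuous_on_compose2[OF assms(2)] xc) (use x0 in auto)
      then show "continuous_on (cball \<alpha> (d / 4)) T"
        unfolding T_def by (intro continuous_intros) (use assms(3) in auto)
      show "T \<in> cball \<alpha> (d / 4) \<rightarrow> cball \<alpha> (d / 4)"
      proof
        fix w assume w: "w \<in> cball \<alpha> (d / 4)"
        have nw: "norm (w - \<alpha>) \<le> d / 4" using w by (simp add: dist_norm norm_minus_commute)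
        have "T w - \<alpha> = - ((w - \<alpha>)\<^sup>2 + (P w - (w - \<alpha>) * (w - \<beta>))) / (\<alpha> - \<beta>)"
          unfolding T_def using assms(3) by (simp add: field_simps power2_eq_square)
        then have "norm (T w - \<alpha>) = norm ((w - \<alpha>)\<^sup>2 + (P w - (w - \<alpha>) * (w - \<beta>))) / d"
          by (simp only: norm_divide d_def norm_minus_cancel)
        also have "\<dots> \<le> ((d / 4)\<^sup>2 + d\<^sup>2 / 8) / d"
          using d est[OF w] power_mono[OF nw, of 2]
          by (intro divide_right_mono order_trans[OF norm_triangle_ineq] add_mono) (auto simp: norm_power)
        also have "\<dots> \<le> d / 4" using d by (simp add: field_simps power2_eq_square)
        finally show "T w \<in> cball \<alpha> (d / 4)" by (simp add: dist_norm norm_minus_commute)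
      qed
    qed (use d in auto)
    then have "P w = 0" using assms(3) by (simp add: T_def)
    then have F0: "F (x w, x w ^ k * w) = 0" using x0[of w] by (simp add: P_def)
    have nw: "norm (w - \<alpha>) \<le> d / 4" using w by (simp add: dist_norm norm_minus_commute)
    have "d \<le> norm (w - \<alpha>) + norm (w - \<beta>)"
      unfolding d_def using norm_triangle_ineq4[of "w - \<beta>" "w - \<alpha>"] by simp
    then have "norm (w - \<alpha>) < norm (w - \<beta>)" using nw d by linarith
    then have "norm (x w ^ k) * norm (w - \<alpha>) < norm (x w ^ k) * norm (w - \<beta>)"
      using x0[of w] by simp
    then have "norm (x w ^ k * w - \<alpha> * x w ^ k) < norm (x w ^ k * w - \<beta> * x w ^ k)"
      by (simp add: norm_mult[symmetric] algebra_simps)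
    then show ?thesis using F0 \<sigma>(3)[of w] by (intro exI[of _ "x w"] exI[of _ "x w ^ k * w"]) (simp add: x_def)
  qed
  then show ?thesis using e(1) by blast
qed

text \<open>If both distances equal \<open>y\<close>, their difference bounds
  \<open>norm s ^ k\<close> by a multiple of \<open>y\<close>, and then also \<open>norm t\<close>.
  The product of the two factors has modulus \<open>y\<^sup>2\<close>, but on the zero set the error
  estimate allows only half of that.\<close>

lemma branches_separate:
  assumes "two_branches k \<alpha> \<beta> F" "\<alpha> \<noteq> \<beta>" "k > 0"
  shows "\<exists>e>0. \<forall>s t. norm (s, t) < e \<and> F (s, t) = 0 \<and> norm (t - \<alpha> * s ^ k) = norm (t - \<beta> * s ^ k) \<longrightarrow> s = 0 \<and> t = 0"
proof -
  define d where "d = norm (\<alpha> - \<beta>)"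
  have d: "d > 0" using assms(2) by (simp add: d_def)
  define c where "c = 1 + 2 / d + norm \<alpha> * (2 / d)"
  have c: "c > 0" using d by (simp add: c_def add_pos_nonneg)
  obtain e where e: "e > 0" "\<And>s t. norm (s, t) < e \<Longrightarrow>
     norm (F (s, t) - (t - \<alpha> * s ^ k) * (t - \<beta> * s ^ k)) \<le> 1 / (2 * c\<^sup>2) * (max (norm s ^ k) (norm t))\<^sup>2"
    using assms(1)[unfolded two_branches_def, rule_format, of "1 / (2 * c\<^sup>2)"] c by auto
  have "s = 0 \<and> t = 0" if st: "norm (s, t) < e" "F (s, t) = 0" "norm (t - \<alpha> * s ^ k) = norm (t - \<beta> * s ^ k)" for s t
  proof -
    define y where "y = norm (t - \<alpha> * s ^ k)"
    have y0: "y \<ge> 0" by (simp add: y_def)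
    have "d * norm s ^ k = norm ((t - \<beta> * s ^ k) - (t - \<alpha> * s ^ k))"
      by (simp add: d_def norm_mult[symmetric] norm_power[symmetric] algebra_simps)
    also have "\<dots> \<le> 2 * y" using norm_triangle_ineq4[of "t - \<beta> * s ^ k" "t - \<alpha> * s ^ k"] st(3) by (simp add: y_def)
    finally have s: "norm s ^ k \<le> 2 / d * y" using d by (simp add: field_simps)
    have "norm t \<le> norm (t - \<alpha> * s ^ k) + norm (\<alpha> * s ^ k)" using norm_triangle_ineq[of "t - \<alpha> * s ^ k" "\<alpha> * s ^ k"] by simp
    also have "\<dots> \<le> y + norm \<alpha> * (2 / d * y)"
      unfolding norm_mult norm_power y_def[symmetric] using mult_left_mono[OF s norm_ge_zero[of \<alpha>]] by simp
    finally have t: "norm t \<le> y + norm \<alpha> * (2 / d * y)" .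
    have "max (norm s ^ k) (norm t) \<le> c * y"
    proof -
      have "0 \<le> 2 / d * y" "0 \<le> norm \<alpha> * (2 / d * y)" using y0 d by simp_all
      moreover have "c * y = y + 2 / d * y + norm \<alpha> * (2 / d * y)" by (simp add: c_def algebra_simps)
      ultimately show ?thesis using s t y0 by (simp only: max.bounded_iff) linarith
    qed
    then have "(max (norm s ^ k) (norm t))\<^sup>2 \<le> (c * y)\<^sup>2" by (intro power_mono) (auto simp: le_max_iff_disj)
    then have "1 / (2 * c\<^sup>2) * (max (norm s ^ k) (norm t))\<^sup>2 \<le> 1 / (2 * c\<^sup>2) * (c * y)\<^sup>2" by (intro mult_left_mono) auto
    also have "\<dots> = y\<^sup>2 / 2" using c by (simp add: power_mult_distrib)
    finally have "norm (F (s, t) - (t - \<alpha> * s ^ k) * (t - \<beta> * s ^ k)) \<le> y\<^sup>2 / 2"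
      using e(2)[OF st(1)] by linarith
    then have "y\<^sup>2 \<le> y\<^sup>2 / 2" using st(2,3) by (simp add: norm_mult y_def power2_eq_square)
    then have y: "y = 0" by simp
    then have "norm s ^ k \<le> 0" "norm t \<le> 0" using s t by simp_all
    then have "norm s ^ k = 0" by (meson antisym norm_ge_zero zero_le_power)
    then show ?thesis using assms(3) \<open>norm t \<le> 0\<close> by simp
  qed
  then show ?thesis using e(1) by blast
qed

text \<open>The points nearer to one branch than to the other form two disjoint open sets. Each
  contains a point of the link, and no point of the link is equidistant.\<close>

lemma two_branches_not_connected:
  assumes "two_branches k \<alpha> \<beta> F" "continuous_on UNIV F" "\<alpha> \<noteq> \<beta>" "k = 1 \<or> k = 2"
  shows "\<exists>e>0. \<forall>r. 0 < r \<and> r < e \<longrightarrow> \<not> connected ({p. F p = 0} \<inter> sphere 0 r)"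
proof -
  obtain e1 where e1: "e1 > 0" "\<And>r. 0 < r \<Longrightarrow> r < e1 \<Longrightarrow>
    \<exists>s t. norm (s, t) = r \<and> F (s, t) = 0 \<and> norm (t - \<alpha> * s ^ k) < norm (t - \<beta> * s ^ k)"
    using point_on_branch[OF assms] by metis
  obtain e2 where e2: "e2 > 0" "\<And>r. 0 < r \<Longrightarrow> r < e2 \<Longrightarrow>
    \<exists>s t. norm (s, t) = r \<and> F (s, t) = 0 \<and> norm (t - \<beta> * s ^ k) < norm (t - \<alpha> * s ^ k)"
    using point_on_branch[OF two_branches_commute[OF assms(1)] assms(2) assms(3)[symmetric] assms(4)] by metis
  have k0: "k > 0" using assms(4) by auto
  obtain e3 where e3: "e3 > 0" "\<And>s t. norm (s, t) < e3 \<Longrightarrow> F (s, t) = 0 \<Longrightarrow>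
      norm (t - \<alpha> * s ^ k) = norm (t - \<beta> * s ^ k) \<Longrightarrow> s = 0 \<and> t = 0"
    using branches_separate[OF assms(1,3)] k0 by metis
  have "\<not> connected ({p. F p = 0} \<inter> sphere 0 r)" if r: "0 < r" "r < min e1 (min e2 e3)" for r
  proof
    let ?A = "{p. F p = 0} \<inter> sphere 0 r"
    let ?U = "{p. norm (snd p - \<alpha> * fst p ^ k) < norm (snd p - \<beta> * fst p ^ k)}"
    let ?V = "{p. norm (snd p - \<beta> * fst p ^ k) < norm (snd p - \<alpha> * fst p ^ k)}"
    assume "connected ?A"
    moreover have "open ?U" "open ?V" by (intro open_Collect_less continuous_intros)+
    moreover have "?U \<inter> ?V \<inter> ?A = {}" by auto
    moreover have "?A \<subseteq> ?U \<union> ?V"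
    proof
      fix p assume p: "p \<in> ?A"
      obtain s t where st: "p = (s, t)" by fastforce
      show "p \<in> ?U \<union> ?V"
      proof (rule ccontr)
        assume "p \<notin> ?U \<union> ?V"
        then have "s = 0 \<and> t = 0" using p r by (intro e3(2)) (auto simp: st)
        then show False using p r by (simp add: st norm_prod_def)
      qed
    qed
    ultimately have "?U \<inter> ?A = {} \<or> ?V \<inter> ?A = {}" by (rule connectedD)
    moreover have "?U \<inter> ?A \<noteq> {}"
    proof -
      obtain s t where "norm (s, t) = r" "F (s, t) = 0" "norm (t - \<alpha> * s ^ k) < norm (t - \<beta> * s ^ k)"
        using e1(2)[of r] r by auto
      then have "(s, t) \<in> ?U \<inter> ?A" by simp
      then show ?thesis by blast
    qed
    moreover have "?V \<inter> ?A \<noteq> {}"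
    proof -
      obtain s t where "norm (s, t) = r" "F (s, t) = 0" "norm (t - \<beta> * s ^ k) < norm (t - \<alpha> * s ^ k)"
        using e2(2)[of r] r by auto
      then have "(s, t) \<in> ?V \<inter> ?A" by simp
      then show ?thesis by blast
    qed
    ultimately show False by blast
  qed
  then show ?thesis using e1(1) e2(1) e3(1) by (intro exI[of _ "min e1 (min e2 e3)"]) auto
qed

text \<open>The map taking \<open>w\<close> to \<open>(w ^ n, w\<^sup>2)\<close> parametrizes the
  curve, and its norm depends strictly monotonically on \<open>norm w\<close>, so the link is the
  image of one circle.\<close>

lemma connected_torus_knot:
  assumes "odd n" "r > 0"
  shows "connected ({(x, y). x\<^sup>2 = y ^ n} \<inter> sphere (0 :: complex \<times> complex) r)"
proof -
  define N where "N x = (x ^ n)\<^sup>2 + (x\<^sup>2)\<^sup>2" for x :: real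
  have n: "n > 0" using assms(1) by (rule odd_pos)
  have mono: "N x < N y" if "0 \<le> x" "x < y" for x y
    unfolding N_def using that n by (intro add_strict_mono power_strict_mono) auto
  have "\<exists>x\<ge>0. x \<le> 1 + r \<and> N x = r\<^sup>2"
  proof (rule IVT')
    show "N 0 \<le> r\<^sup>2" by (simp add: N_def zero_power[OF n])
    have "r\<^sup>2 \<le> ((1 + r)\<^sup>2)\<^sup>2"
    proof (rule power_mono)
      have "1 + r \<le> (1 + r) ^ 2" using assms(2) by (intro self_le_power) auto
      then show "r \<le> (1 + r)\<^sup>2" by simp
    qed (use assms in auto)
    then show "r\<^sup>2 \<le> N (1 + r)" by (simp add: N_def add_increasing)
    show "continuous_on {0..1 + r} N" unfolding N_def by (intro continuous_intros)
  qed (use assms in auto)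
  then obtain \<rho> where \<rho>: "\<rho> \<ge> 0" "N \<rho> = r\<^sup>2" by blast
  have uniq: "x = \<rho>" if "x \<ge> 0" "N x = r\<^sup>2" for x
    using mono[of x \<rho>] mono[of \<rho> x] that \<rho> by (cases x \<rho> rule: linorder_cases) auto
  have "{(x, y). x\<^sup>2 = y ^ n} \<inter> sphere 0 r = (\<lambda>w::complex. (w ^ n, w\<^sup>2)) ` sphere 0 \<rho>"
  proof (intro equalityI subsetI)
    fix p :: "complex \<times> complex" assume p: "p \<in> {(x, y). x\<^sup>2 = y ^ n} \<inter> sphere 0 r"
    obtain x y where xy: "p = (x, y)" by fastforce
    define w0 where "w0 = csqrt y"
    have w0: "w0\<^sup>2 = y" by (simp add: w0_def)
    have "(w0 ^ n)\<^sup>2 = (w0\<^sup>2) ^ n" by (simp only: power_mult[symmetric] mult.commute)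
    then have "x\<^sup>2 = (w0 ^ n)\<^sup>2" using p w0 by (simp add: xy)
    \<comment> \<open>Since \<open>n\<close> is odd, changing the sign of the square root of
      \<open>y\<close> changes the sign of its \<open>n\<close>-th power.\<close>
    then have "x = w0 ^ n \<or> x = (- w0) ^ n" using assms(1) by (simp add: power2_eq_iff)
    then obtain w where w: "x = w ^ n" "y = w\<^sup>2" using w0 by (metis power2_minus)
    have "sqrt (N (norm w)) = r" using p by (simp add: xy w norm_prod_def N_def norm_power)
    then have "N (norm w) = r\<^sup>2" by (metis N_def real_sqrt_pow2 add_nonneg_nonneg zero_le_power2)
    then have "norm w = \<rho>" by (intro uniq) auto
    then show "p \<in> (\<lambda>w. (w ^ n, w\<^sup>2)) ` sphere 0 \<rho>" using w xy by auto
  next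
    fix p assume "p \<in> (\<lambda>w::complex. (w ^ n, w\<^sup>2)) ` sphere 0 \<rho>"
    then obtain w where w: "p = (w ^ n, w\<^sup>2)" "norm w = \<rho>" by auto
    have "norm p = sqrt (N \<rho>)" by (simp add: w norm_prod_def N_def norm_power)
    then show "p \<in> {(x, y). x\<^sup>2 = y ^ n} \<inter> sphere 0 r"
      using \<rho> assms(2) by (simp add: w power_mult[symmetric] mult.commute)
  qed
  moreover have "connected ((\<lambda>w::complex. (w ^ n, w\<^sup>2)) ` sphere 0 \<rho>)"
    by (intro connected_continuous_image continuous_intros connected_sphere) simp
  ultimately show ?thesis by simp
qed

section \<open>Links of plane curve germs\<close>

text \<open>What is kept of \<open>same_link\<close>: the isotopy is forgotten, and a homeomorphism
  of spheres matching the links remains, on spheres that are not rescaled.\<close>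

definition knot_link :: "(complex \<times> complex) set \<Rightarrow> nat \<Rightarrow> bool" where
  "knot_link V n \<longleftrightarrow> (\<exists>e>0. \<forall>r s. 0 < r \<and> r < e \<and> 0 < s \<and> s < e \<longrightarrow>
     (\<exists>h k. homeomorphism (sphere 0 r) (sphere 0 s) h k \<and>
        h ` (V \<inter> sphere 0 r) = {(x :: complex, y). x\<^sup>2 = y ^ n} \<inter> sphere 0 s))"

lemma homeomorphism_scaleR_sphere:
  fixes r s :: real
  assumes "r > 0" "s > 0"
  shows "homeomorphism (sphere 0 r) (sphere (0 :: 'a::real_normed_vector) s)
    (\<lambda>w. (s / r) *\<^sub>R w) (\<lambda>w. (r / s) *\<^sub>R w)"
proof -
  have im: "(\<lambda>w. (s / r) *\<^sub>R w) ` sphere 0 r = sphere (0 :: 'a) s" if "r > 0" "s > 0" for r s :: real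
  proof (intro equalityI subsetI)
    fix w :: 'a assume "w \<in> sphere 0 s"
    then have "w = (s / r) *\<^sub>R ((r / s) *\<^sub>R w)" "(r / s) *\<^sub>R w \<in> sphere 0 r" using that by auto
    then show "w \<in> (\<lambda>w. (s / r) *\<^sub>R w) ` sphere 0 r" by blast
  qed (use that in auto)
  show ?thesis
    unfolding homeomorphism_def using assms im[OF assms] im[OF assms(2,1)]
    by (auto intro!: continuous_intros)
qed

lemma same_link_imp_knot_link:
  assumes "same_link V {(x :: complex, y). x\<^sup>2 = y ^ n}"
  shows "knot_link V n"
proof -
  let ?W = "{(x :: complex, y). x\<^sup>2 = y ^ n}"
  obtain e where e: "e > 0" "\<And>r s. 0 < r \<Longrightarrow> r < e \<Longrightarrow> 0 < s \<Longrightarrow> s < e \<Longrightarrow>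
      ambient_isotopic (sphere 0 1) (link_at_radius V r) (link_at_radius ?W s)"
    using assms unfolding same_link_def by metis
  have "\<exists>h k. homeomorphism (sphere 0 r) (sphere 0 s) h k \<and> h ` (V \<inter> sphere 0 r) = ?W \<inter> sphere 0 s"
    if rs: "0 < r" "r < e" "0 < s" "s < e" for r s
  proof -
    obtain h where h: "homotopic_with_canon (\<lambda>\<phi>. \<exists>\<psi>. homeomorphism (sphere 0 1) (sphere 0 1) \<phi> \<psi>)
        (sphere 0 1) (sphere (0 :: complex \<times> complex) 1) id h" "h ` link_at_radius V r = link_at_radius ?W s"
      using e(2)[OF rs] unfolding ambient_isotopic_def by blast
    obtain k where k: "homeomorphism (sphere 0 1) (sphere 0 1) h k"
      using homotopic_with_imp_property[OF h(1)] by blast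
    have h1: "homeomorphism (sphere 0 r) (sphere (0 :: complex \<times> complex) 1) (\<lambda>w. (1 / r) *\<^sub>R w) (\<lambda>w. (r / 1) *\<^sub>R w)"
      by (rule homeomorphism_scaleR_sphere) (use rs in auto)
    have h2: "homeomorphism (sphere 0 1) (sphere (0 :: complex \<times> complex) s) (\<lambda>w. (s / 1) *\<^sub>R w) (\<lambda>w. (1 / s) *\<^sub>R w)"
      by (rule homeomorphism_scaleR_sphere) (use rs in auto)
    let ?h = "(\<lambda>w. (s / 1) *\<^sub>R w) \<circ> (h \<circ> (\<lambda>w. (1 / r) *\<^sub>R w))"
    have "homeomorphism (sphere 0 r) (sphere 0 s) ?h (((\<lambda>w. (r / 1) *\<^sub>R w) \<circ> k) \<circ> (\<lambda>w. (1 / s) *\<^sub>R w))"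
      by (rule homeomorphism_compose[OF homeomorphism_compose[OF h1 k] h2])
    moreover have "?h ` (V \<inter> sphere 0 r) = ?W \<inter> sphere 0 s"
    proof -
      have "?h ` (V \<inter> sphere 0 r) = (\<lambda>w. s *\<^sub>R w) ` h ` link_at_radius V r"
        unfolding link_at_radius_def by (simp add: image_comp[symmetric] image_image divide_inverse_commute)
      also have "\<dots> = (\<lambda>w. s *\<^sub>R w) ` link_at_radius ?W s" by (simp only: h(2))
      also have "\<dots> = ?W \<inter> sphere 0 s" unfolding link_at_radius_def using rs by (simp add: image_image)
      finally show ?thesis .
    qed
    ultimately show ?thesis by blast
  qed
  then show ?thesis unfolding knot_link_def using e(1) by blast
qed

lemma knot_link_linear_isometry:
  fixes U U' :: "complex \<times> complex \<Rightarrow> complex \<times> complex"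
  assumes "knot_link {p. F p = 0} n" "continuous_on UNIV U" "continuous_on UNIV U'"
    "\<And>p. norm (U p) = norm p" "\<And>p. norm (U' p) = norm p" "\<And>p. U (U' p) = p" "\<And>p. U' (U p) = p"
  shows "knot_link {p. F (U p) = 0} n"
proof -
  obtain e where e: "e > 0" "\<And>r s. 0 < r \<Longrightarrow> r < e \<Longrightarrow> 0 < s \<Longrightarrow> s < e \<Longrightarrow>
     \<exists>h k. homeomorphism (sphere 0 r) (sphere 0 s) h k \<and>
        h ` ({p. F p = 0} \<inter> sphere 0 r) = {(x :: complex, y). x\<^sup>2 = y ^ n} \<inter> sphere 0 s"
    using assms(1) unfolding knot_link_def by metis
  have "\<exists>h k. homeomorphism (sphere 0 r) (sphere 0 s) h k \<and>
        h ` ({p. F (U p) = 0} \<inter> sphere 0 r) = {(x :: complex, y). x\<^sup>2 = y ^ n} \<inter> sphere 0 s"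
    if rs: "0 < r" "r < e" "0 < s" "s < e" for r s
  proof -
    obtain h k where h: "homeomorphism (sphere 0 r) (sphere 0 s) h k"
      "h ` ({p. F p = 0} \<inter> sphere 0 r) = {(x :: complex, y). x\<^sup>2 = y ^ n} \<inter> sphere 0 s"
      using e(2)[OF rs] by blast
    have surj: "p \<in> U ` A" if "U' p \<in> A" for p A using that assms(6) by (metis imageI)
    have "homeomorphism (sphere 0 r) (sphere 0 r) U U'"
    proof (rule homeomorphismI)
      show "continuous_on (sphere 0 r) U" "continuous_on (sphere 0 r) U'"
        using assms(2,3) continuous_on_subset by blast+
    qed (use assms(4-7) in auto)
    then have "homeomorphism (sphere 0 r) (sphere 0 s) (h \<circ> U) (U' \<circ> k)"
      using h(1) homeomorphism_compose by blast
    moreover have "U ` ({p. F (U p) = 0} \<inter> sphere 0 r) = {p. F p = 0} \<inter> sphere 0 r"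
      using surj assms(4-7) by auto
    then have "(h \<circ> U) ` ({p. F (U p) = 0} \<inter> sphere 0 r) = {(x :: complex, y). x\<^sup>2 = y ^ n} \<inter> sphere 0 s"
      by (simp only: image_comp[symmetric] h(2))
    ultimately show ?thesis by blast
  qed
  then show ?thesis unfolding knot_link_def using e(1) by blast
qed

text \<open>Links are cut out by round spheres, so a change of coordinates must be an isometry. This
  one is in SU(2) and sends \<open>(0, 1)\<close> to \<open>(x, y)\<close>.\<close>

lemma knot_link_unitary:
  fixes x y :: complex
  assumes "knot_link {p. F p = 0} n" "(norm x)\<^sup>2 + (norm y)\<^sup>2 = 1"
  shows "knot_link {p. F (cnj y * fst p + x * snd p, y * snd p - cnj x * fst p) = 0} n"
proof -
  have one: "cnj x * x + cnj y * y = 1"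
  proof -
    have "complex_of_real ((norm x)\<^sup>2 + (norm y)\<^sup>2) = x * cnj x + y * cnj y"
      by (simp only: of_real_add complex_norm_square)
    then show ?thesis using assms(2) by (simp add: mult.commute)
  qed
  define U where "U = (\<lambda>p :: complex \<times> complex. (cnj y * fst p + x * snd p, y * snd p - cnj x * fst p))"
  define U' where "U' = (\<lambda>p :: complex \<times> complex. (y * fst p - x * snd p, cnj x * fst p + cnj y * snd p))"
  have UU: "U (U' p) = p" "U' (U p) = p" for p
  proof -
    have e: "cnj y * (y * a - x * b) + x * (cnj x * a + cnj y * b) = a"
      "y * (cnj x * a + cnj y * b) - cnj x * (y * a - x * b) = b"
      "y * (cnj y * a + x * b) - x * (y * b - cnj x * a) = a"
      "cnj x * (cnj y * a + x * b) + cnj y * (y * b - cnj x * a) = b" for a b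
      using one by algebra+
    show "U (U' p) = p" "U' (U p) = p" by (simp_all add: U_def U'_def e)
  qed
  have sq: "of_real ((norm z)\<^sup>2) = z * cnj z" for z :: complex by (rule complex_norm_square)
  have nU: "norm (U p) = norm p" for p
  proof -
    have "complex_of_real ((norm (fst (U p)))\<^sup>2 + (norm (snd (U p)))\<^sup>2) = of_real ((norm (fst p))\<^sup>2 + (norm (snd p))\<^sup>2)"
      unfolding of_real_add sq U_def using one by (simp; algebra)
    then show ?thesis unfolding norm_prod_def by (simp only: of_real_eq_iff)
  qed
  have nU': "norm (U' p) = norm p" for p using nU[of "U' p"] by (simp add: UU)
  have "knot_link {p. F (U p) = 0} n"
    by (rule knot_link_linear_isometry[OF assms(1) _ _ nU nU' UU]) (simp_all add: U_def U'_def continuous_intros)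
  then show ?thesis by (simp add: U_def)
qed

lemma knot_link_connected:
  assumes "knot_link V n" "odd n"
  shows "\<exists>e>0. \<forall>r. 0 < r \<and> r < e \<longrightarrow> connected (V \<inter> sphere 0 r)"
proof -
  obtain e where e: "e > 0" "\<And>r s. 0 < r \<Longrightarrow> r < e \<Longrightarrow> 0 < s \<Longrightarrow> s < e \<Longrightarrow>
     \<exists>h k. homeomorphism (sphere 0 r) (sphere 0 s) h k \<and>
        h ` (V \<inter> sphere 0 r) = {(x :: complex, y). x\<^sup>2 = y ^ n} \<inter> sphere 0 s"
    using assms(1) unfolding knot_link_def by metis
  have "connected (V \<inter> sphere 0 r)" if r: "0 < r" "r < e" for r
  proof -
    obtain h k where h: "homeomorphism (sphere 0 r) (sphere 0 r) h k"
      "h ` (V \<inter> sphere 0 r) = {(x :: complex, y). x\<^sup>2 = y ^ n} \<inter> sphere 0 r"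
      using e(2)[OF r r] by blast
    have "V \<inter> sphere 0 r = k ` h ` (V \<inter> sphere 0 r)"
      using homeomorphism_apply1[OF h(1)] by (force simp: image_image)
    also have "\<dots> = k ` ({(x :: complex, y). x\<^sup>2 = y ^ n} \<inter> sphere 0 r)" by (simp only: h(2))
    finally have eq: "V \<inter> sphere 0 r = k ` ({(x :: complex, y). x\<^sup>2 = y ^ n} \<inter> sphere 0 r)" .
    show ?thesis unfolding eq
      by (intro connected_continuous_image connected_torus_knot assms r
          continuous_on_subset[OF homeomorphism_cont2[OF h(1)]]) auto
  qed
  then show ?thesis using e(1) by blast
qed

section \<open>Weighted order estimates for polynomial germs\<close>

definition bipoly :: "(nat \<Rightarrow> nat \<Rightarrow> complex) \<Rightarrow> complex \<times> complex \<Rightarrow> complex" where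
  "bipoly c p = (\<Sum>i\<le>5. \<Sum>j\<le>5. c i j * fst p ^ i * snd p ^ j)"

definition negligible_rel :: "(complex \<Rightarrow> complex \<Rightarrow> real) \<Rightarrow> (complex \<times> complex \<Rightarrow> complex) \<Rightarrow> bool" where
  "negligible_rel M f \<longleftrightarrow> (\<forall>\<epsilon>>0. \<exists>\<delta>>0. \<forall>s t. norm (s, t) < \<delta> \<longrightarrow> norm (f (s, t)) \<le> \<epsilon> * M s t)"

lemma negligible_rel_zero:
  "(\<And>s t. M s t \<ge> 0) \<Longrightarrow> negligible_rel M (\<lambda>p. 0)"
  unfolding negligible_rel_def by (auto intro!: exI[of _ 1])

lemma negligible_rel_add:
  assumes "negligible_rel M f" "negligible_rel M g"
  shows "negligible_rel M (\<lambda>p. f p + g p)"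
  unfolding negligible_rel_def
proof (intro allI impI)
  fix \<epsilon> :: real assume "\<epsilon> > 0"
  then have e: "\<epsilon> / 2 > 0" by simp
  obtain d1 where d1: "d1 > 0" "\<And>s t. norm (s, t) < d1 \<Longrightarrow> norm (f (s, t)) \<le> \<epsilon> / 2 * M s t"
    using assms(1) e unfolding negligible_rel_def by metis
  obtain d2 where d2: "d2 > 0" "\<And>s t. norm (s, t) < d2 \<Longrightarrow> norm (g (s, t)) \<le> \<epsilon> / 2 * M s t"
    using assms(2) e unfolding negligible_rel_def by metis
  have "norm (f (s, t) + g (s, t)) \<le> \<epsilon> * M s t" if "norm (s, t) < min d1 d2" for s t
  proof -
    have "norm (f (s, t) + g (s, t)) \<le> norm (f (s, t)) + norm (g (s, t))" by (rule norm_triangle_ineq)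
    also have "\<dots> \<le> \<epsilon> / 2 * M s t + \<epsilon> / 2 * M s t" using d1(2) d2(2) that by (intro add_mono) auto
    finally show ?thesis by (simp add: field_simps)
  qed
  then show "\<exists>\<delta>>0. \<forall>s t. norm (s, t) < \<delta> \<longrightarrow> norm (f (s, t) + g (s, t)) \<le> \<epsilon> * M s t"
    using d1(1) d2(1) by (intro exI[of _ "min d1 d2"]) auto
qed

lemma negligible_rel_sum:
  assumes "\<And>s t. M s t \<ge> 0" "\<And>i. i \<in> I \<Longrightarrow> negligible_rel M (f i)"
  shows "negligible_rel M (\<lambda>p. \<Sum>i\<in>I. f i p)"
proof (cases "finite I")
  case True
  from True assms(2) show ?thesis
    by (induction I rule: finite_induct) (auto simp: negligible_rel_zero[OF assms(1)] intro!: negligible_rel_add)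
qed (simp add: negligible_rel_zero[OF assms(1)])

text \<open>The square root is dictated by the cusp: the monomial \<open>s\<^sup>2 * t\<close> is
  smaller than the leading form only by half a power of the norm.\<close>

lemma negligible_rel_bound:
  assumes "\<And>s t. M s t \<ge> 0"
    "\<And>s t. norm (s, t) \<le> 1 \<Longrightarrow> norm (f (s, t)) \<le> sqrt (norm (s, t)) * M s t"
  shows "negligible_rel M (\<lambda>p. a * f p)"
  unfolding negligible_rel_def
proof (intro allI impI)
  fix \<epsilon> :: real assume e: "\<epsilon> > 0"
  define b where "b = norm a + 1"
  have b: "b > 0" "norm a \<le> b" by (auto simp: b_def add_nonneg_pos)
  show "\<exists>\<delta>>0. \<forall>s t. norm (s, t) < \<delta> \<longrightarrow> norm (a * f (s, t)) \<le> \<epsilon> * M s t"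
  proof (intro exI[of _ "min 1 ((\<epsilon> / b)\<^sup>2)"] conjI allI impI)
    show "0 < min 1 ((\<epsilon> / b)\<^sup>2)" using e b by simp
    fix s t :: complex assume st: "norm (s, t) < min 1 ((\<epsilon> / b)\<^sup>2)"
    have "sqrt (norm (s, t)) \<le> \<epsilon> / b" using st e b by (intro real_le_lsqrt) auto
    have "norm (a * f (s, t)) \<le> b * (sqrt (norm (s, t)) * M s t)"
      unfolding norm_mult using st assms b by (intro mult_mono) auto
    also have "\<dots> \<le> b * (\<epsilon> / b * M s t)"
      using \<open>sqrt (norm (s, t)) \<le> \<epsilon> / b\<close> assms(1) b by (intro mult_left_mono mult_right_mono) auto
    also have "\<dots> = \<epsilon> * M s t" using b by simp
    finally show "norm (a * f (s, t)) \<le> \<epsilon> * M s t" .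
  qed
qed

lemma negligible_rel_bipoly:
  assumes "\<And>s t. M s t \<ge> 0"
    "\<And>i j. c i j \<noteq> 0 \<Longrightarrow> i \<le> 5 \<Longrightarrow> j \<le> 5 \<Longrightarrow> (\<And>s t. norm (s, t) \<le> 1 \<Longrightarrow> norm (s ^ i * t ^ j) \<le> sqrt (norm (s, t)) * M s t)"
  shows "negligible_rel M (bipoly c)"
proof -
  have "negligible_rel M (\<lambda>p. c i j * (fst p ^ i * snd p ^ j))" if "i \<le> 5" "j \<le> 5" for i j
  proof (cases "c i j = 0")
    case True
    then show ?thesis using negligible_rel_zero[OF assms(1)] by simp
  next
    case False
    then show ?thesis using assms(2)[OF False that] by (intro negligible_rel_bound[OF assms(1)]) auto
  qed
  then show ?thesis
    unfolding bipoly_def[abs_def] mult.assoc by (intro negligible_rel_sum assms(1)) auto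
qed

lemma monomial_le_max:
  fixes x y z :: real
  assumes "0 \<le> x" "0 \<le> y" "x \<le> z" "y \<le> z" "z \<le> 1" "i > 0 \<or> n > 0"
  shows "x ^ i * y ^ n \<le> z"
proof -
  have pw: "u ^ k \<le> u" if "k > 0" "0 \<le> u" "u \<le> z" for u :: real and k
    using power_decreasing[of 1 k u] that assms(5) by simp
  have p1: "u ^ k \<le> 1" if "0 \<le> u" "u \<le> z" for u :: real and k
    using that assms(5) by (auto intro!: power_le_one)
  from assms(6) show ?thesis
  proof
    assume "i > 0"
    then have "x ^ i * y ^ n \<le> x * 1" using pw p1 assms by (intro mult_mono) auto
    then show ?thesis using assms by simp
  next
    assume "n > 0"
    then have "x ^ i * y ^ n \<le> 1 * y" using pw p1 assms by (intro mult_mono) auto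
    then show ?thesis using assms by simp
  qed
qed

text \<open>Give \<open>s\<close> weight 1 and \<open>t\<close> weight \<open>k\<close>. From a
  monomial of weight above \<open>2 * k\<close> one can split off two factors bounded by the
  maximum, and at least one further \<open>s\<close> or \<open>t\<close> is left to supply
  smallness.\<close>

lemma branch_monomial_bound:
  assumes "norm (s, t) \<le> (1::real)" "k * 2 < i + k * j" "k > 0"
  shows "norm (s ^ i * t ^ j :: complex) \<le> sqrt (norm (s, t)) * (max (norm s ^ k) (norm t))\<^sup>2"
proof -
  define x y z M where "x = norm s" and "y = norm t" and "z = norm (s, t)" and "M = max (x ^ k) y"
  have xyz: "0 \<le> x" "0 \<le> y" "x \<le> z" "y \<le> z" "z \<le> 1"
    using assms(1) norm_fst_le[of s t] norm_snd_le[of t s] by (auto simp: x_def y_def z_def)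
  have M: "x ^ k \<le> M" "y \<le> M" "0 \<le> M" using xyz by (auto simp: M_def)
  have zs: "z \<le> sqrt z" using xyz by (intro real_le_rsqrt) (simp add: power2_eq_square mult_left_le)
  have pw: "x ^ n \<le> x" if "n > 0" for n
    using power_decreasing[of 1 n x] that xyz by simp
  have "x ^ i * y ^ j \<le> z * M\<^sup>2"
  proof -
    consider "j = 0" | "j = 1" | "j \<ge> 2" by linarith
    then show ?thesis
    proof cases
      case 1
      then obtain n where n: "i = k + k + Suc n" using assms(2) less_imp_Suc_add by fastforce
      have "x ^ i * y ^ j = x ^ Suc n * (x ^ k * x ^ k)" by (simp add: 1 n power_add)
      also have "\<dots> \<le> z * (M * M)" using pw[of "Suc n"] xyz M by (intro mult_mono) auto
      finally show ?thesis by (simp add: power2_eq_square)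
    next
      case 2
      then obtain n where n: "i = k + Suc n" using assms(2) less_imp_Suc_add by fastforce
      have "x ^ i * y ^ j = x ^ Suc n * (x ^ k * y)" by (simp add: 2 n power_add)
      also have "\<dots> \<le> z * (M * M)" using pw[of "Suc n"] xyz M by (intro mult_mono) auto
      finally show ?thesis by (simp add: power2_eq_square)
    next
      case 3
      then obtain n where n: "j = n + 2" using le_Suc_ex by (metis add.commute)
      then have "x ^ i * y ^ n \<le> z" using monomial_le_max[OF xyz] assms(2,3) by simp
      then have "(x ^ i * y ^ n) * (y * y) \<le> z * (M * M)" using xyz M by (intro mult_mono) auto
      then show ?thesis by (simp only: n power_add power2_eq_square mult.assoc)
    qed
  qed
  also have "\<dots> \<le> sqrt z * M\<^sup>2" using zs by (intro mult_right_mono) auto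
  finally show ?thesis by (simp add: norm_mult norm_power x_def y_def z_def M_def)
qed

text \<open>Here \<open>s\<close> has weight 2, \<open>t\<close> has weight 3, and the critical
  weight is 6. The delicate monomial is \<open>s\<^sup>2 * t\<close> of weight 7, whose square is
  \<open>s\<close> times the product of \<open>s ^ 3\<close> and \<open>t\<^sup>2\<close>.\<close>

lemma cusp_monomial_bound:
  assumes "norm (s, t) \<le> (1::real)" "6 < 2 * i + 3 * j"
  shows "norm (s ^ i * t ^ j :: complex) \<le> sqrt (norm (s, t)) * max (norm t ^ 2) (norm s ^ 3)"
proof -
  define x y z M where "x = norm s" and "y = norm t" and "z = norm (s, t)" and "M = max (y ^ 2) (x ^ 3)"
  have xyz: "0 \<le> x" "0 \<le> y" "x \<le> z" "y \<le> z" "z \<le> 1"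
    using assms(1) norm_fst_le[of s t] norm_snd_le[of t s] by (auto simp: x_def y_def z_def)
  have M: "x ^ 3 \<le> M" "y\<^sup>2 \<le> M" "0 \<le> M" using xyz by (auto simp: M_def le_max_iff_disj)
  have zs: "z \<le> sqrt z" using xyz by (intro real_le_rsqrt) (simp add: power2_eq_square mult_left_le)
  have pw: "x ^ n \<le> x" if "n > 0" for n
    using power_decreasing[of 1 n x] that xyz by simp
  have "x ^ i * y ^ j \<le> sqrt z * M"
  proof -
    consider "j = 0" | "j = 1" | "j \<ge> 2" by linarith
    then show ?thesis
    proof cases
      case 1
      then obtain n where n: "i = 3 + Suc n" using assms(2) less_imp_Suc_add[of 3 i] by auto
      have "x ^ i * y ^ j = x ^ Suc n * x ^ 3"
        by (simp only: 1 n power_add power_0 mult_1_right mult.commute[of "x ^ 3"])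
      also have "\<dots> \<le> sqrt z * M" using pw[of "Suc n"] xyz M zs by (intro mult_mono) auto
      finally show ?thesis .
    next
      case 2
      then obtain n where n: "i = n + 2" using assms(2) le_Suc_ex[of 2 i] by auto
      have "(x\<^sup>2 * y)\<^sup>2 = x * (x ^ 3 * y\<^sup>2)" by (simp add: power2_eq_square power3_eq_cube)
      also have "\<dots> \<le> z * (M * M)" using xyz M by (intro mult_mono) auto
      finally have "x\<^sup>2 * y \<le> sqrt z * M"
        using xyz M real_le_rsqrt[of "x\<^sup>2 * y" "z * (M * M)"] by (simp add: real_sqrt_mult)
      moreover have "x ^ n * (x\<^sup>2 * y) \<le> 1 * (x\<^sup>2 * y)" using xyz by (intro mult_right_mono power_le_one) auto
      moreover have "x ^ i * y ^ j = x ^ n * (x\<^sup>2 * y)"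
        by (simp only: 2 n power_add power_one_right mult.assoc)
      ultimately show ?thesis by simp
    next
      case 3
      then obtain n where n: "j = n + 2" using le_Suc_ex by (metis add.commute)
      then have "x ^ i * y ^ n \<le> z" using monomial_le_max[OF xyz] assms(2) by simp
      then have "(x ^ i * y ^ n) * y\<^sup>2 \<le> sqrt z * M" using xyz M zs by (intro mult_mono) auto
      then show ?thesis by (simp only: n power_add power2_eq_square mult.assoc)
    qed
  qed
  then show ?thesis by (simp add: norm_mult norm_power x_def y_def z_def M_def)
qed


lemma continuous_on_bipoly: "continuous_on S (bipoly c)"
  unfolding bipoly_def[abs_def] by (intro continuous_intros)

lemma bipoly_diff: "bipoly c p - bipoly c' p = bipoly (\<lambda>i j. c i j - c' i j) p"
  by (simp add: bipoly_def sum_subtractf algebra_simps)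

lemma bipoly_divide: "bipoly c p / a = bipoly (\<lambda>i j. c i j / a) p"
  by (simp add: bipoly_def sum_divide_distrib)

lemma atMost_5: "{..5::nat} = {0, 1, 2, 3, 4, 5}"
  by auto

lemma bipoly_two_branches:
  assumes k: "k = 1 \<or> k = 2"
    and "c 0 2 = 1" "c k 1 = - (\<alpha> + \<beta>)" "c (2 * k) 0 = \<alpha> * \<beta>"
    and low: "\<And>i j. i + k * j < 2 * k \<Longrightarrow> c i j = 0"
  shows "two_branches k \<alpha> \<beta> (bipoly c)"
proof -
  define c0 where "c0 i j = (if i = 0 \<and> j = 2 then 1 else if i = k \<and> j = 1 then - (\<alpha> + \<beta>)
      else if i = 2 * k \<and> j = 0 then \<alpha> * \<beta> else 0 :: complex)" for i j :: nat
  have main: "bipoly c0 (s, t) = (t - \<alpha> * s ^ k) * (t - \<beta> * s ^ k)" for s t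
    using k unfolding bipoly_def atMost_5
    by (auto simp: c0_def algebra_simps power2_eq_square power4_eq_xxxx)
  have "negligible_rel (\<lambda>s t. (max (norm s ^ k) (norm t))\<^sup>2) (bipoly (\<lambda>i j. c i j - c0 i j))"
  proof (rule negligible_rel_bipoly)
    fix i j :: nat and s t :: complex
    assume "c i j - c0 i j \<noteq> 0" "norm (s, t) \<le> 1"
    have "k * 2 < i + k * j"
    proof (rule ccontr)
      assume "\<not> k * 2 < i + k * j"
      then consider "i + k * j < 2 * k" | "i + k * j = 2 * k" by linarith
      then show False
      proof cases
        case 1
        then have "j < 2" using k by auto
        then have "c0 i j = 0" using 1 k by (auto simp: c0_def)
        then show False using low[OF 1] \<open>c i j - c0 i j \<noteq> 0\<close> by simp
      next
        case 2
        then have "j \<le> 2" using k by auto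
        then have "j = 0 \<or> j = 1 \<or> j = 2" by linarith
        then have "j = 0 \<and> i = 2 * k \<or> j = 1 \<and> i = k \<or> j = 2 \<and> i = 0" using 2 k by auto
        then show False using \<open>c i j - c0 i j \<noteq> 0\<close> assms(2-4) k by (auto simp: c0_def)
      qed
    qed
    then show "norm (s ^ i * t ^ j) \<le> sqrt (norm (s, t)) * (max (norm s ^ k) (norm t))\<^sup>2"
      by (rule branch_monomial_bound[OF \<open>norm (s, t) \<le> 1\<close>]) (use k in auto)
  qed auto
  then show ?thesis
    unfolding two_branches_def negligible_rel_def bipoly_diff[symmetric] main .
qed

text \<open>Otherwise the weighted leading form splits into two distinct factors and the link is
  disconnected. The case \<open>k = 1\<close> makes the quadratic part a square;
  \<open>k = 2\<close> excludes a tacnode.\<close>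

lemma knot_link_not_two_branches:
  assumes "knot_link {p. bipoly c p = 0} n" "odd n" "k = 1 \<or> k = 2" "c 0 2 \<noteq> 0"
    and low: "\<And>i j. i + k * j < 2 * k \<Longrightarrow> c i j = 0"
  shows "(c k 1)\<^sup>2 = 4 * c (2 * k) 0 * c 0 2"
proof (rule ccontr)
  assume ne: "(c k 1)\<^sup>2 \<noteq> 4 * c (2 * k) 0 * c 0 2"
  define a where "a = c 0 2"
  have a: "a \<noteq> 0" using assms(4) by (simp add: a_def)
  define w where "w = csqrt ((c k 1)\<^sup>2 - 4 * c (2 * k) 0 * a)"
  have w2: "w\<^sup>2 = (c k 1)\<^sup>2 - 4 * c (2 * k) 0 * a" by (simp add: w_def)
  have w: "w \<noteq> 0" using w2 ne by (auto simp: a_def)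
  define \<alpha> \<beta> where "\<alpha> = (w - c k 1) / (2 * a)" and "\<beta> = (- w - c k 1) / (2 * a)"
  have "\<alpha> \<noteq> \<beta>" using w a by (simp add: \<alpha>_def \<beta>_def)
  have "two_branches k \<alpha> \<beta> (bipoly (\<lambda>i j. c i j / a))"
  proof (rule bipoly_two_branches[OF assms(3)])
    show "c k 1 / a = - (\<alpha> + \<beta>)" using a by (simp add: \<alpha>_def \<beta>_def field_simps)
    have "\<alpha> * \<beta> = ((c k 1)\<^sup>2 - w\<^sup>2) / (4 * a * a)"
      by (simp add: \<alpha>_def \<beta>_def power2_eq_square algebra_simps)
    then show "c (2 * k) 0 / a = \<alpha> * \<beta>" using a by (simp add: w2)
  qed (use a low in \<open>auto simp: a_def\<close>)
  then obtain e where e: "e > 0" "\<And>r. 0 < r \<Longrightarrow> r < e \<Longrightarrow>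
      \<not> connected ({p. bipoly (\<lambda>i j. c i j / a) p = 0} \<inter> sphere 0 r)"
    using two_branches_not_connected[OF _ continuous_on_bipoly \<open>\<alpha> \<noteq> \<beta>\<close> assms(3)] by metis
  have eq: "{p. bipoly (\<lambda>i j. c i j / a) p = 0} = {p. bipoly c p = 0}"
    using a by (simp add: bipoly_divide[symmetric])
  obtain e' where e': "e' > 0" "\<And>r. 0 < r \<Longrightarrow> r < e' \<Longrightarrow> connected ({p. bipoly c p = 0} \<inter> sphere 0 r)"
    using knot_link_connected[OF assms(1,2)] by metis
  have "0 < min e e' / 2" "min e e' / 2 < e" "min e e' / 2 < e'" using e(1) e'(1) by auto
  then show False using e(2) e'(2) eq by metis
qed

lemma knot_link_T25_not_cusp:
  assumes "knot_link {p. bipoly c p = 0} 5" "c 0 2 \<noteq> 0"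
    and "c 0 0 = 0" "c 1 0 = 0" "c 0 1 = 0" "c 2 0 = 0" "c 1 1 = 0"
  shows "c 3 0 = 0"
proof (rule ccontr)
  assume c3: "c 3 0 \<noteq> 0"
  define a where "a = c 0 2"
  have a: "a \<noteq> 0" using assms(2) by (simp add: a_def)
  \<comment> \<open>After division by \<open>a\<close> the weighted leading form is
    \<open>t\<^sup>2 - (m * s) ^ 3\<close>.\<close>
  define m where "m = exp (Ln (- c 3 0 / a) / 3)"
  have m3: "m ^ 3 = - c 3 0 / a" using a c3 by (simp add: m_def exp_of_nat_mult[symmetric])
  have m0: "m \<noteq> 0" by (simp add: m_def)
  define F where "F = bipoly (\<lambda>i j. c i j / a)"
  define c0 where "c0 i j = (if i = 0 \<and> j = 2 then 1 else if i = 3 \<and> j = 0 then - (m ^ 3) else 0)" for i j :: nat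
  have main: "bipoly c0 (s, t) = t\<^sup>2 - (m * s) ^ 3" for s t
    unfolding bipoly_def atMost_5 by (simp add: c0_def power_mult_distrib)
  have "negligible_rel (\<lambda>s t. max (norm t ^ 2) (norm s ^ 3)) (bipoly (\<lambda>i j. c i j / a - c0 i j))"
  proof (rule negligible_rel_bipoly)
    fix i j :: nat and s t :: complex
    assume nz: "c i j / a - c0 i j \<noteq> 0" "norm (s, t) \<le> 1"
    have "6 < 2 * i + 3 * j"
    proof (rule ccontr)
      assume "\<not> 6 < 2 * i + 3 * j"
      then have "(i, j) \<in> {(0,0), (1,0), (2,0), (3,0), (0,1), (1,1), (0,2)}"
        by (cases j; cases "j - 1"; cases "j - 2"; auto)
      then show False using nz(1) a m3 assms by (auto simp: c0_def a_def)
    qed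
    then show "norm (s ^ i * t ^ j) \<le> sqrt (norm (s, t)) * max (norm t ^ 2) (norm s ^ 3)"
      using cusp_monomial_bound nz(2) by blast
  qed (auto simp: le_max_iff_disj)
  then have "negligible_rel (\<lambda>s t. max (norm t ^ 2) (norm s ^ 3)) (\<lambda>p. F p - bipoly c0 p)"
    unfolding F_def bipoly_diff by simp
  \<comment> \<open>The factor \<open>norm m ^ 3\<close> converts a bound in \<open>norm s\<close>
    into one in \<open>norm (m * s)\<close>; the 2 is the margin that the cusp argument
    requires.\<close>
  moreover define b where "b = min 1 (norm m ^ 3) / 2"
  have "b > 0" using m0 by (simp add: b_def)
  ultimately obtain d where d: "d > 0"
    "\<And>s t. norm (s, t) < d \<Longrightarrow> norm (F (s, t) - (t\<^sup>2 - (m * s) ^ 3)) \<le> b * max (norm t ^ 2) (norm s ^ 3)"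
    unfolding negligible_rel_def main by metis
  have bmax: "b * max (norm t ^ 2) (norm s ^ 3) \<le> max (norm t ^ 2) (norm (m * s) ^ 3) / 2" for s t
  proof -
    have "2 * b * norm t ^ 2 \<le> 1 * norm t ^ 2" "2 * b * norm s ^ 3 \<le> norm m ^ 3 * norm s ^ 3"
      unfolding b_def by (intro mult_right_mono; simp)+
    then have "2 * b * norm t ^ 2 \<le> max (norm t ^ 2) (norm (m * s) ^ 3)"
      "2 * b * norm s ^ 3 \<le> max (norm t ^ 2) (norm (m * s) ^ 3)"
      by (auto simp: norm_mult power_mult_distrib le_max_iff_disj)
    then have "2 * b * max (norm t ^ 2) (norm s ^ 3) \<le> max (norm t ^ 2) (norm (m * s) ^ 3)"
      by (cases "norm t ^ 2 \<le> norm s ^ 3") (simp_all only: max.absorb1 max.absorb2 linear not_le less_imp_le)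
    then show ?thesis by simp
  qed
  obtain e where e: "e > 0" "\<And>r s. 0 < r \<Longrightarrow> r < e \<Longrightarrow> 0 < s \<Longrightarrow> s < e \<Longrightarrow>
     \<exists>h k. homeomorphism (sphere 0 r) (sphere 0 s) h k \<and>
        h ` ({p. bipoly c p = 0} \<inter> sphere 0 r) = {(x :: complex, y). x\<^sup>2 = y ^ 5} \<inter> sphere 0 s"
    using assms(1) unfolding knot_link_def by metis
  define r where "r = min d e / 2"
  have r: "0 < r" "r < d" "r < e" using d(1) e(1) by (auto simp: r_def)
  obtain h k where h: "homeomorphism (sphere 0 r) (sphere 0 r) h k"
     "h ` ({p. bipoly c p = 0} \<inter> sphere 0 r) = {(x :: complex, y). x\<^sup>2 = y ^ 5} \<inter> sphere 0 r"
    using e(2)[OF r(1,3) r(1,3)] by blast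
  show False
  proof (rule cusp_link_not_T25[OF r(1) r(1) m0 _ _ h(1)])
    show "continuous_on (sphere 0 r) F" unfolding F_def by (rule continuous_on_bipoly)
    show "norm (F (s, t) - (t\<^sup>2 - (m * s) ^ 3)) \<le> max (norm t ^ 2) (norm (m * s) ^ 3) / 2"
      if "norm (s, t) = r" for s t
      using d(2)[of s t] bmax[of t s] that r(2) by linarith
    have "{p. F p = 0} = {p. bipoly c p = 0}" using a by (simp add: F_def bipoly_divide[symmetric])
    moreover have "{(x :: complex, y). x\<^sup>2 = y ^ 5} = {p. G25 p = 0}" by (auto simp: G25_def)
    ultimately show "h ` ({p. F p = 0} \<inter> sphere 0 r) = {p. G25 p = 0} \<inter> sphere 0 r"
      using h(2) by simp
  qed
qed

section \<open>Linear changes of coordinates\<close>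

definition coeff3 :: "poly3 \<Rightarrow> nat \<Rightarrow> nat \<Rightarrow> nat \<Rightarrow> complex" where
  "coeff3 f i j k = coeff (coeff (coeff f i) j) k"

lemma eval3_add [simp]: "eval3 (f + g) v = eval3 f v + eval3 g v"
  and eval3_mult [simp]: "eval3 (f * g) v = eval3 f v * eval3 g v"
  and eval3_diff [simp]: "eval3 (f - g) v = eval3 f v - eval3 g v"
  and eval3_one [simp]: "eval3 1 v = 1"
  and eval3_power [simp]: "eval3 (f ^ n) v = eval3 f v ^ n"
  and eval3_const [simp]: "eval3 [:[:[:c:]:]:] v = c"
  by (simp_all add: eval3_def)

lemma eval3_sum: "eval3 (\<Sum>i\<in>I. f i) v = (\<Sum>i\<in>I. eval3 (f i) v)"
  by (simp add: eval3_def poly_sum)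

lemma poly_eq_0_if_infinite_zeros:
  fixes p :: "'a::idom poly"
  assumes "infinite S" "\<And>x. x \<in> S \<Longrightarrow> poly p x = 0"
  shows "p = 0"
proof (rule ccontr)
  assume "p \<noteq> 0"
  then have "finite {x. poly p x = 0}" by (rule poly_roots_finite)
  moreover have "S \<subseteq> {x. poly p x = 0}" using assms(2) by blast
  ultimately show False using assms(1) finite_subset by blast
qed

lemma infinite_range_const_poly:
  fixes e :: "'a::zero \<Rightarrow> 'b::zero"
  assumes "infinite (UNIV :: 'a set)" "inj e"
  shows "infinite (range (\<lambda>x. [:e x:]))"
proof
  assume "finite (range (\<lambda>x. [:e x:]))"
  moreover have "inj (\<lambda>x. [:e x:])" using assms(2) by (auto simp: inj_on_def)
  ultimately show False using assms(1) finite_imageD by blast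
qed

lemma eval3_eq_0_imp:
  assumes "\<And>v. eval3 f v = 0"
  shows "f = 0"
proof (rule poly_eq_0_if_infinite_zeros)
  show "infinite (range (\<lambda>x::complex. [:[:x:]:]))"
    by (intro infinite_range_const_poly infinite_UNIV_char_0) (auto simp: inj_on_def)
  fix p assume "p \<in> range (\<lambda>x::complex. [:[:x:]:])"
  then obtain x where p: "p = [:[:x:]:]" by blast
  show "poly f p = 0"
  proof (rule poly_eq_0_if_infinite_zeros)
    show "infinite (range (\<lambda>y::complex. [:y:]))"
      by (intro infinite_range_const_poly infinite_UNIV_char_0) (auto simp: inj_on_def)
    fix q assume "q \<in> range (\<lambda>y::complex. [:y:])"
    then obtain y where q: "q = [:y:]" by blast
    have "poly (poly (poly f p) q) z = 0" for z
      using assms[of "vector [x, y, z]"] by (simp add: eval3_def p q)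
    then show "poly (poly f p) q = 0" using poly_all_0_iff_0 by blast
  qed
qed

lemma eval3_eqI:
  assumes "\<And>v. eval3 f v = eval3 g v"
  shows "f = g"
  using eval3_eq_0_imp[of "f - g"] assms by simp

lemma poly_eq_sum_atMost:
  fixes p :: "'a::comm_ring_1 poly"
  assumes "degree p \<le> D"
  shows "poly p x = (\<Sum>i\<le>D. coeff p i * x ^ i)"
  unfolding poly_altdef using assms
  by (intro sum.mono_neutral_left) (auto simp: coeff_eq_0)

lemma eval3_altdef:
  assumes "degree f \<le> D" "\<And>i. degree (coeff f i) \<le> D" "\<And>i j. degree (coeff (coeff f i) j) \<le> D"
  shows "eval3 f v = (\<Sum>i\<le>D. \<Sum>j\<le>D. \<Sum>k\<le>D. coeff3 f i j k * v $ 1 ^ i * v $ 2 ^ j * v $ 3 ^ k)"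
proof -
  have "eval3 f v = (\<Sum>i\<le>D. poly (poly (coeff f i) [:v $ 2:]) (v $ 3) * v $ 1 ^ i)"
    unfolding eval3_def by (subst poly_eq_sum_atMost[OF assms(1)]) (simp add: poly_sum)
  also have "\<dots> = (\<Sum>i\<le>D. (\<Sum>j\<le>D. poly (coeff (coeff f i) j) (v $ 3) * v $ 2 ^ j) * v $ 1 ^ i)"
    by (subst poly_eq_sum_atMost[OF assms(2)]) (simp add: poly_sum)
  also have "\<dots> = (\<Sum>i\<le>D. (\<Sum>j\<le>D. (\<Sum>k\<le>D. coeff3 f i j k * v $ 3 ^ k) * v $ 2 ^ j) * v $ 1 ^ i)"
    by (subst poly_eq_sum_atMost[OF assms(3)]) (simp add: coeff3_def)
  finally show ?thesis unfolding sum_distrib_right by (simp only: mult_ac)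
qed

lemma degree_bound3:
  fixes f :: poly3
  obtains D where "degree f \<le> D" "\<And>i. degree (coeff f i) \<le> D" "\<And>i j. degree (coeff (coeff f i) j) \<le> D"
proof -
  define B where "B = insert (degree f) ((\<lambda>i. degree (coeff f i)) ` {..degree f} \<union>
     (\<lambda>(i, j). degree (coeff (coeff f i) j)) ` (SIGMA i:{..degree f}. {..degree (coeff f i)}))"
  have "finite B" by (simp add: B_def)
  then have M: "x \<le> Max B" if "x \<in> B" for x using that by simp
  have 0: "coeff f i = 0" if "i > degree f" for i using that by (rule coeff_eq_0)
  show ?thesis
  proof (rule that[of "Max B"])
    show "degree f \<le> Max B" by (rule M) (simp add: B_def)
    show *: "degree (coeff f i) \<le> Max B" for i
    proof (cases "i \<le> degree f")
      case True
      then show ?thesis by (intro M) (force simp: B_def)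
    qed (simp add: 0)
    show "degree (coeff (coeff f i) j) \<le> Max B" for i j
    proof (cases "i \<le> degree f \<and> j \<le> degree (coeff f i)")
      case True
      then show ?thesis by (intro M) (force simp: B_def)
    next
      case False
      then have "coeff (coeff f i) j = 0" using 0 by (auto simp: coeff_eq_0)
      then show ?thesis by simp
    qed
  qed
qed

text \<open>Serves to read identities between values as identities between coefficients.\<close>

definition build3 :: "nat \<Rightarrow> (nat \<Rightarrow> nat \<Rightarrow> nat \<Rightarrow> complex) \<Rightarrow> poly3" where
  "build3 D c = (\<Sum>i\<le>D. monom (\<Sum>j\<le>D. monom (\<Sum>k\<le>D. monom (c i j k) k) j) i)"

lemma coeff_sum_monom: "coeff (\<Sum>i\<le>D. monom (a i) i) n = (if n \<le> D then a n else 0)"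
  by (simp add: coeff_sum)

lemma coeff3_build3: "coeff3 (build3 D c) i j k = (if i \<le> D \<and> j \<le> D \<and> k \<le> D then c i j k else 0)"
  by (simp add: coeff3_def build3_def coeff_sum_monom)

lemma eval3_build3:
  "eval3 (build3 D c) v = (\<Sum>i\<le>D. \<Sum>j\<le>D. \<Sum>k\<le>D. c i j k * v $ 1 ^ i * v $ 2 ^ j * v $ 3 ^ k)"
proof -
  have "eval3 (build3 D c) v = (\<Sum>i\<le>D. (\<Sum>j\<le>D. (\<Sum>k\<le>D. c i j k * v $ 3 ^ k) * v $ 2 ^ j) * v $ 1 ^ i)"
    by (simp add: eval3_def build3_def poly_sum poly_monom)
  then show ?thesis unfolding sum_distrib_right by (simp only: mult_ac)
qed

lemma homogeneous_coeff3: "homogeneous d f \<Longrightarrow> coeff3 f i j k \<noteq> 0 \<Longrightarrow> i + j + k = d"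
  unfolding homogeneous_def coeff3_def by blast

lemma homogeneous_degrees:
  assumes "homogeneous d f"
  shows "degree f \<le> d" "degree (coeff f i) \<le> d" "degree (coeff (coeff f i) j) \<le> d"
proof -
  have z: "coeff3 f i j k = 0" if "i + j + k \<noteq> d" for i j k
    using homogeneous_coeff3[OF assms] that by blast
  show "degree (coeff (coeff f i) j) \<le> d"
    by (rule degree_le) (use z in \<open>auto simp: coeff3_def\<close>)
  show "degree (coeff f i) \<le> d"
    by (rule degree_le) (use z in \<open>auto simp: coeff3_def poly_eq_iff\<close>)
  show "degree f \<le> d"
    by (rule degree_le) (use z in \<open>auto simp: coeff3_def poly_eq_iff\<close>)
qed

lemma eval3_homogeneous:
  assumes "homogeneous d f"
  shows "eval3 f v = (\<Sum>i\<le>d. \<Sum>j\<le>d. \<Sum>k\<le>d. coeff3 f i j k * v $ 1 ^ i * v $ 2 ^ j * v $ 3 ^ k)"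
  by (rule eval3_altdef) (rule homogeneous_degrees[OF assms])+

lemma eval3_scale:
  assumes "homogeneous d f"
  shows "eval3 f (c *s v) = c ^ d * eval3 f v"
proof -
  have eq: "coeff3 f i j k * (c *s v) $ 1 ^ i * (c *s v) $ 2 ^ j * (c *s v) $ 3 ^ k =
      c ^ d * (coeff3 f i j k * v $ 1 ^ i * v $ 2 ^ j * v $ 3 ^ k)" for i j k
  proof (cases "coeff3 f i j k = 0")
    case False
    then have "d = i + j + k" using homogeneous_coeff3[OF assms] by simp
    then show ?thesis by (simp add: power_mult_distrib power_add)
  qed simp
  show ?thesis by (simp only: eval3_homogeneous[OF assms] eq sum_distrib_left)
qed

definition degree3 :: "poly3 \<Rightarrow> nat" where
  "degree3 f = (SOME D. degree f \<le> D \<and> (\<forall>i. degree (coeff f i) \<le> D) \<and> (\<forall>i j. degree (coeff (coeff f i) j) \<le> D))"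

lemma degree3:
  "degree f \<le> degree3 f" "degree (coeff f i) \<le> degree3 f" "degree (coeff (coeff f i) j) \<le> degree3 f"
proof -
  have "\<exists>D. degree f \<le> D \<and> (\<forall>i. degree (coeff f i) \<le> D) \<and> (\<forall>i j. degree (coeff (coeff f i) j) \<le> D)"
    by (rule degree_bound3[of f]) blast
  from someI_ex[OF this]
  show "degree f \<le> degree3 f" "degree (coeff f i) \<le> degree3 f" "degree (coeff (coeff f i) j) \<le> degree3 f"
    by (simp_all add: degree3_def)
qed

text \<open>Scaling by 2 is enough: it multiplies a monomial of degree \<open>n\<close> by
  \<open>2 ^ n\<close>, and distinct powers of 2 are distinct complex numbers.\<close>

lemma homogeneousI:
  assumes "\<And>c v. eval3 f (c *s v) = c ^ d * eval3 f v"
  shows "homogeneous d f"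
proof -
  define D where "D = degree3 f"
  note D = degree3[of f, folded D_def]
  have "build3 D (\<lambda>i j k. coeff3 f i j k * (2 ^ (i + j + k) - 2 ^ d)) = 0"
  proof (rule eval3_eq_0_imp)
    fix v
    have "eval3 (build3 D (\<lambda>i j k. coeff3 f i j k * (2 ^ (i + j + k) - 2 ^ d))) v
       = eval3 f (2 *s v) - 2 ^ d * eval3 f v"
      unfolding eval3_build3 eval3_altdef[OF D]
      by (simp add: sum_distrib_left sum_subtractf[symmetric] power_mult_distrib power_add algebra_simps)
    then show "eval3 (build3 D (\<lambda>i j k. coeff3 f i j k * (2 ^ (i + j + k) - 2 ^ d))) v = 0"
      by (simp add: assms)
  qed
  then have z: "coeff3 f i j k * (2 ^ (i + j + k) - 2 ^ d) = 0" if "i \<le> D" "j \<le> D" "k \<le> D" for i j k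
    using coeff3_build3[of D "\<lambda>i j k. coeff3 f i j k * (2 ^ (i + j + k) - 2 ^ d)" i j k] that
    by (simp add: coeff3_def)
  have "i + j + k = d" if nz: "coeff3 f i j k \<noteq> 0" for i j k
  proof -
    have "coeff f i \<noteq> 0" "coeff (coeff f i) j \<noteq> 0" "coeff (coeff (coeff f i) j) k \<noteq> 0"
      using nz by (auto simp: coeff3_def)
    then have "i \<le> D" "j \<le> D" "k \<le> D" using D le_degree order_trans by metis+
    then have "(2::complex) ^ (i + j + k) = 2 ^ d" using z nz by force
    then have "of_nat (2 ^ (i + j + k)) = (of_nat (2 ^ d) :: complex)" by simp
    then have "(2::nat) ^ (i + j + k) = 2 ^ d" by (simp only: of_nat_eq_iff)
    then show ?thesis by simp
  qed
  then show ?thesis unfolding homogeneous_def coeff3_def by blast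
qed

definition lin_form :: "complex^3 \<Rightarrow> poly3" where
  "lin_form w = [:[:[:0, w $ 3:], [:w $ 2:]:], [:[:w $ 1:]:]:]"

lemma eval3_lin_form: "eval3 (lin_form w) v = w $ 1 * v $ 1 + w $ 2 * v $ 2 + w $ 3 * v $ 3"
  by (simp add: lin_form_def eval3_def algebra_simps)

text \<open>The expansion matters only through its values: by \<open>eval3_eqI\<close> a polynomial
  is determined by them, so multiplicativity and invertibility follow from those of the matrix
  action.\<close>

definition lin_subst :: "complex^3^3 \<Rightarrow> poly3 \<Rightarrow> poly3" where
  "lin_subst M f = (\<Sum>i\<le>degree3 f. \<Sum>j\<le>degree3 f. \<Sum>k\<le>degree3 f.
     [:[:[:coeff3 f i j k:]:]:] * lin_form (M $ 1) ^ i * lin_form (M $ 2) ^ j * lin_form (M $ 3) ^ k)"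

lemma eval3_lin_subst: "eval3 (lin_subst M f) v = eval3 f (M *v v)"
proof -
  have l: "eval3 (lin_form (M $ i)) v = (M *v v) $ i" for i
    by (simp add: eval3_lin_form matrix_vector_mult_def sum_3)
  show ?thesis
    unfolding lin_subst_def eval3_sum eval3_mult eval3_power eval3_const l
    by (rule eval3_altdef[symmetric]) (rule degree3)+
qed

lemma lin_subst_mult: "lin_subst M (f * g) = lin_subst M f * lin_subst M g"
  by (rule eval3_eqI) (simp add: eval3_lin_subst)

lemma lin_subst_one: "lin_subst M 1 = 1"
  by (rule eval3_eqI) (simp add: eval3_lin_subst)

lemma lin_subst_inverse:
  assumes "M ** N = mat 1"
  shows "lin_subst N (lin_subst M f) = f"
  by (rule eval3_eqI) (simp add: eval3_lin_subst matrix_vector_mul_assoc assms)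

lemma homogeneous_lin_subst:
  assumes "homogeneous d f"
  shows "homogeneous d (lin_subst M f)"
  by (rule homogeneousI) (simp add: eval3_lin_subst eval3_scale[OF assms] vector_scalar_commute)

lemma squarefree_lin_subst:
  assumes "squarefree f" "M ** N = mat 1"
  shows "squarefree (lin_subst M f)"
  unfolding squarefree_def
proof (intro allI impI)
  have NM: "N ** M = mat 1" using assms(2) matrix_left_right_inverse by blast
  fix g assume "g\<^sup>2 dvd lin_subst M f"
  then obtain h where "lin_subst M f = g * g * h" by (auto simp: power2_eq_square)
  then have "lin_subst N (lin_subst M f) = lin_subst N g * lin_subst N g * lin_subst N h"
    by (simp add: lin_subst_mult)
  then have "(lin_subst N g)\<^sup>2 dvd f"
    unfolding lin_subst_inverse[OF assms(2)] by (simp add: power2_eq_square)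
  then have "lin_subst N g dvd 1" using assms(1) unfolding squarefree_def by blast
  then obtain k where "1 = lin_subst N g * k" ..
  then have "lin_subst M 1 = lin_subst M (lin_subst N g) * lin_subst M k"
    by (metis lin_subst_mult)
  then have "1 = g * lin_subst M k" by (simp add: lin_subst_one lin_subst_inverse[OF NM])
  then show "g dvd 1" by (rule dvdI)
qed

lemma basis_matrix:
  fixes v a b :: "complex^3"
  assumes "vec.span {v, a, b} = UNIV"
  shows "\<exists>M N :: complex^3^3. M ** N = mat 1 \<and> N ** M = mat 1 \<and>
    (\<forall>x y z. M *v vector [x, y, z] = x *s v + y *s a + z *s b)"
proof -
  define M :: "complex^3^3" where "M = (\<chi> i j. (if j = 1 then v else if j = 2 then a else b) $ i)"
  have col: "column 1 M = v" "column 2 M = a" "column 3 M = b"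
    by (simp_all add: column_def M_def vec_eq_iff)
  have "columns M = (\<lambda>i. column i M) ` UNIV" by (auto simp: columns_def)
  then have "columns M = {v, a, b}" by (simp add: UNIV_3 col)
  then obtain N where MN: "M ** N = mat 1"
    using assms matrix_right_invertible_span_columns[of M] by metis
  then have "N ** M = mat 1" using matrix_left_right_inverse by blast
  moreover have "M *v vector [x, y, z] = x *s v + y *s a + z *s b" for x y z
    by (simp add: matrix_vector_mult_def M_def vec_eq_iff sum_3 algebra_simps)
  ultimately show ?thesis using MN by blast
qed

lemma change_of_basis:
  assumes "vec.span {v, a, b} = UNIV" "squarefree f" "homogeneous d f"
  obtains f' where "squarefree f'" "homogeneous d f'"
    "\<And>x y z. eval3 f' (vector [x, y, z]) = eval3 f (x *s v + y *s a + z *s b)"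
proof -
  obtain M N :: "complex^3^3" where MN: "M ** N = mat 1" "N ** M = mat 1"
    and M: "\<And>x y z. M *v vector [x, y, z] = x *s v + y *s a + z *s b"
    using basis_matrix[OF assms(1)] by blast
  show ?thesis
    using that[of "lin_subst M f"] squarefree_lin_subst[OF assms(2) MN(1)] homogeneous_lin_subst[OF assms(3)]
    by (simp add: eval3_lin_subst M)
qed

lemma basis_injective:
  fixes v a b :: "complex^3"
  assumes "vec.span {v, a, b} = UNIV" "x *s v + y *s a + z *s b = 0"
  shows "x = 0 \<and> y = 0 \<and> z = 0"
proof -
  obtain M N :: "complex^3^3" where MN: "M ** N = mat 1" "N ** M = mat 1"
    and M: "\<And>x y z. M *v vector [x, y, z] = x *s v + y *s a + z *s b"
    using basis_matrix[OF assms(1)] by blast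
  have "N *v (M *v vector [x, y, z]) = 0" using assms(2) by (simp add: M)
  then have "vector [x, y, z] = (0 :: complex^3)" by (simp add: matrix_vector_mul_assoc MN(2))
  then show ?thesis by (simp add: vec_eq_iff forall_3)
qed

section \<open>Second-order behaviour at singular points\<close>

lemma has_derivative_poly2:
  fixes g :: "complex poly poly"
  assumes "(Y has_field_derivative Y') (at e)" "(Z has_field_derivative Z') (at e)"
  shows "((\<lambda>t. poly (poly g [:Y t:]) (Z t)) has_field_derivative
    (Y' * poly (poly (pderiv g) [:Y e:]) (Z e) + Z' * poly (poly (map_poly pderiv g) [:Y e:]) (Z e))) (at e)"
proof (induction g rule: pCons_induct)
  case 0
  then show ?case by simp
next
  case (pCons h g)
  have "((\<lambda>t. poly h (Z t)) has_field_derivative (poly (pderiv h) (Z e) * Z')) (at e)"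
    by (rule DERIV_chain2[OF poly_DERIV assms(2)])
  from DERIV_add[OF this DERIV_mult[OF assms(1) pCons.IH]]
  show ?case
    by (simp add: pderiv_pCons map_poly_pCons algebra_simps)
qed

lemma has_derivative_eval3:
  assumes "(X has_field_derivative X') (at e)" "(Y has_field_derivative Y') (at e)" "(Z has_field_derivative Z') (at e)"
  shows "((\<lambda>t. eval3 f (vector [X t, Y t, Z t])) has_field_derivative
    (X' * gradient f (vector [X e, Y e, Z e]) $ 1 + Y' * gradient f (vector [X e, Y e, Z e]) $ 2
      + Z' * gradient f (vector [X e, Y e, Z e]) $ 3)) (at e)"
proof (induction f rule: pCons_induct)
  case 0
  then show ?case by (simp add: eval3_def gradient_def)
next
  case (pCons g f)
  from DERIV_add[OF has_derivative_poly2[OF assms(2,3), of g] DERIV_mult[OF assms(1) pCons.IH]]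
  show ?case
    by (simp add: eval3_def gradient_def pderiv_pCons map_poly_pCons algebra_simps)
qed

lemma eval3_directional_derivative:
  assumes "gradient f v = 0"
  shows "((\<lambda>t. eval3 f (v + t *s w)) has_field_derivative 0) (at 0)"
proof -
  have "v + t *s w = vector [v $ 1 + t * w $ 1, v $ 2 + t * w $ 2, v $ 3 + t * w $ 3]" for t
    by (simp add: vec_eq_iff forall_3)
  moreover have "((\<lambda>t. eval3 f (vector [v $ 1 + t * w $ 1, v $ 2 + t * w $ 2, v $ 3 + t * w $ 3]))
     has_field_derivative 0) (at 0)"
  proof -
    have d: "((\<lambda>t. v $ i + t * w $ i) has_field_derivative w $ i) (at 0)" for i
      by (auto intro!: derivative_eq_intros)
    have "vector [v $ 1 + 0 * w $ 1, v $ 2 + 0 * w $ 2, v $ 3 + 0 * w $ 3] = v"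
      by (simp add: vec_eq_iff forall_3)
    then show ?thesis using has_derivative_eval3[OF d d d, of f 1 2 3] assms by simp
  qed
  ultimately show ?thesis by simp
qed

lemma span3_eq_UNIV_iff:
  fixes v a b :: "complex^3"
  shows "vec.span {v, a, b} = UNIV \<longleftrightarrow> (\<forall>w. \<exists>x y z. w = x *s v + y *s a + z *s b)"
proof -
  have "w \<in> vec.span {v, a, b} \<longleftrightarrow> (\<exists>x y z. w = x *s v + y *s a + z *s b)" for w
    by (simp add: vec.span_insert algebra_simps)
  then show ?thesis by blast
qed

text \<open>The second-order part at \<open>v\<close> is the square of a linear form. This includes the vanishing of the value
  and the gradient at \<open>v\<close>, since otherwise the quotient has no limit.\<close>

definition degenerate :: "poly3 \<Rightarrow> complex^3 \<Rightarrow> bool" where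
  "degenerate f v \<longleftrightarrow> (\<exists>L :: complex^3. \<forall>w.
     ((\<lambda>t. eval3 f (v + t *s w) / t\<^sup>2) \<longlongrightarrow> (L $ 1 * w $ 1 + L $ 2 * w $ 2 + L $ 3 * w $ 3)\<^sup>2) (at 0))"

lemma degenerate_change_of_basis:
  assumes "degenerate f (x *s v + y *s a + z *s b)"
    and "\<And>x y z. eval3 f' (vector [x, y, z]) = eval3 f (x *s v + y *s a + z *s b)"
  shows "degenerate f' (vector [x, y, z])"
proof -
  obtain L :: "complex^3" where L: "\<And>w. ((\<lambda>t. eval3 f (x *s v + y *s a + z *s b + t *s w) / t\<^sup>2) \<longlongrightarrow> (L $ 1 * w $ 1 + L $ 2 * w $ 2 + L $ 3 * w $ 3)\<^sup>2) (at 0)"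
    using assms(1) unfolding degenerate_def by blast
  define l where "l w = L $ 1 * w $ 1 + L $ 2 * w $ 2 + L $ 3 * w $ 3" for w :: "complex^3"
  define L' :: "complex^3" where "L' = vector [l v, l a, l b]"
  show ?thesis
    unfolding degenerate_def
  proof (intro exI[of _ L'] allI)
    fix w :: "complex^3"
    define u where "u = w $ 1 *s v + w $ 2 *s a + w $ 3 *s b"
    have "eval3 f' (vector [x, y, z] + t *s w) = eval3 f (x *s v + y *s a + z *s b + t *s u)" for t
    proof -
      have "vector [x, y, z] + t *s w = vector [x + t * w $ 1, y + t * w $ 2, z + t * w $ 3]"
        by (simp add: vec_eq_iff forall_3)
      moreover have "(x + t * w $ 1) *s v + (y + t * w $ 2) *s a + (z + t * w $ 3) *s b
          = x *s v + y *s a + z *s b + t *s u"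
        by (simp add: u_def vec_eq_iff algebra_simps)
      ultimately show ?thesis by (simp only: assms(2))
    qed
    moreover have "l u = L' $ 1 * w $ 1 + L' $ 2 * w $ 2 + L' $ 3 * w $ 3"
      by (simp add: l_def u_def L'_def algebra_simps)
    ultimately show "((\<lambda>t. eval3 f' (vector [x, y, z] + t *s w) / t\<^sup>2) \<longlongrightarrow>
        (L' $ 1 * w $ 1 + L' $ 2 * w $ 2 + L' $ 3 * w $ 3)\<^sup>2) (at 0)"
      using L[of u] by (simp only: l_def)
  qed
qed

lemma degenerate_scale:
  assumes "degenerate f v" "homogeneous 5 f" "c \<noteq> 0"
  shows "degenerate f (c *s v)"
proof -
  obtain L :: "complex^3" where L: "\<And>w. ((\<lambda>t. eval3 f (v + t *s w) / t\<^sup>2) \<longlongrightarrow> (L $ 1 * w $ 1 + L $ 2 * w $ 2 + L $ 3 * w $ 3)\<^sup>2) (at 0)"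
    using assms(1) unfolding degenerate_def by blast
  \<comment> \<open>Rescaling gives \<open>c ^ 5\<close> by homogeneity and \<open>c\<^sup>2\<close>
    in the denominator from the new parameter; a square root of the remaining \<open>c ^ 3\<close>
    is absorbed into the linear form.\<close>
  define m where "m = csqrt (c ^ 3)"
  have m: "m\<^sup>2 = c ^ 3" by (simp add: m_def)
  show ?thesis
    unfolding degenerate_def
  proof (intro exI[of _ "m *s L"] allI)
    fix w :: "complex^3"
    have "((\<lambda>t. t / c) \<longlongrightarrow> 0) (at 0)" using assms(3) by (auto intro!: tendsto_eq_intros)
    then have "filterlim (\<lambda>t. t / c) (at 0) (at 0)"
      using assms(3) by (auto simp: filterlim_at eventually_at_filter)
    from filterlim_compose[OF L[of w] this]
    have "((\<lambda>t. c ^ 3 * (eval3 f (v + (t / c) *s w) / (t / c)\<^sup>2)) \<longlongrightarrow> c ^ 3 * (L $ 1 * w $ 1 + L $ 2 * w $ 2 + L $ 3 * w $ 3)\<^sup>2) (at 0)"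
      by (intro tendsto_intros)
    moreover have "c ^ 3 * (eval3 f (v + (t / c) *s w) / (t / c)\<^sup>2) = eval3 f (c *s v + t *s w) / t\<^sup>2" for t
    proof -
      have "c *s v + t *s w = c *s (v + (t / c) *s w)" using assms(3) by (simp add: vec_eq_iff algebra_simps)
      then have "eval3 f (c *s v + t *s w) = c ^ 5 * eval3 f (v + (t / c) *s w)"
        by (simp only: eval3_scale[OF assms(2)])
      then show ?thesis using assms(3) by (simp add: power_divide field_simps eval_nat_numeral)
    qed
    moreover have "c ^ 3 * (L $ 1 * w $ 1 + L $ 2 * w $ 2 + L $ 3 * w $ 3)\<^sup>2
       = ((m *s L) $ 1 * w $ 1 + (m *s L) $ 2 * w $ 2 + (m *s L) $ 3 * w $ 3)\<^sup>2"
      unfolding m[symmetric] by (simp add: power2_eq_square algebra_simps)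
    ultimately show "((\<lambda>t. eval3 f (c *s v + t *s w) / t\<^sup>2) \<longlongrightarrow>
        ((m *s L) $ 1 * w $ 1 + (m *s L) $ 2 * w $ 2 + (m *s L) $ 3 * w $ 3)\<^sup>2) (at 0)"
      by (simp only:)
  qed
qed

text \<open>The coefficient of \<open>s\<^sup>j t\<^sup>k\<close> in \<open>f(1, s, t)\<close> for a quintic form \<open>f\<close>.\<close>

definition chart_coeff :: "poly3 \<Rightarrow> nat \<Rightarrow> nat \<Rightarrow> complex" where
  "chart_coeff f j k = (if j + k \<le> 5 then coeff3 f (5 - j - k) j k else 0)"

lemma eval3_chart_coeff:
  assumes "homogeneous 5 f"
  shows "eval3 f (vector [x, y, z]) = (\<Sum>j\<le>5. \<Sum>k\<le>5. chart_coeff f j k * x ^ (5 - j - k) * y ^ j * z ^ k)"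
proof -
  have inner: "(\<Sum>i\<le>5. coeff3 f i j k * x ^ i * y ^ j * z ^ k) = chart_coeff f j k * x ^ (5 - j - k) * y ^ j * z ^ k" for j k
  proof (cases "j + k \<le> 5")
    case True
    have "(\<Sum>i\<le>5. coeff3 f i j k * x ^ i * y ^ j * z ^ k) = (\<Sum>i\<in>{5 - j - k}. coeff3 f i j k * x ^ i * y ^ j * z ^ k)"
    proof (rule sum.mono_neutral_right)
      show "\<forall>i\<in>{..5} - {5 - j - k}. coeff3 f i j k * x ^ i * y ^ j * z ^ k = 0"
      proof
        fix i assume "i \<in> {..5} - {5 - j - k}"
        then have "i + j + k \<noteq> 5" using True by auto
        then show "coeff3 f i j k * x ^ i * y ^ j * z ^ k = 0" using homogeneous_coeff3[OF assms] by auto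
      qed
    qed auto
    then show ?thesis using True by (simp add: chart_coeff_def)
  next
    case False
    then have "coeff3 f i j k = 0" for i using homogeneous_coeff3[OF assms, of i j k] by auto
    then show ?thesis using False by (simp add: chart_coeff_def)
  qed
  have "eval3 f (vector [x, y, z]) = (\<Sum>j\<le>5. \<Sum>i\<le>5. \<Sum>k\<le>5. coeff3 f i j k * x ^ i * y ^ j * z ^ k)"
    unfolding eval3_homogeneous[OF assms] by (subst sum.swap) simp
  also have "\<dots> = (\<Sum>j\<le>5. \<Sum>k\<le>5. \<Sum>i\<le>5. coeff3 f i j k * x ^ i * y ^ j * z ^ k)"
    by (intro sum.cong refl sum.swap)
  finally show ?thesis by (simp only: inner)
qed

lemma eval3_chart: "homogeneous 5 f \<Longrightarrow> eval3 f (vector [1, s, t]) = bipoly (chart_coeff f) (s, t)"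
  by (simp add: eval3_chart_coeff bipoly_def)

lemma chart_second_order:
  assumes "homogeneous 5 f" "chart_coeff f 0 0 = 0" "chart_coeff f 1 0 = 0" "chart_coeff f 0 1 = 0"
  shows "((\<lambda>e. eval3 f (vector [1 + e * r, e * s, e * t]) / e\<^sup>2) \<longlongrightarrow>
    chart_coeff f 2 0 * s\<^sup>2 + chart_coeff f 1 1 * s * t + chart_coeff f 0 2 * t\<^sup>2) (at 0)"
proof -
  \<comment> \<open>The exponent \<open>j + k - 2\<close> is truncated only where the coefficient
    vanishes. At \<open>e = 0\<close> precisely the terms with \<open>j + k = 2\<close> survive, so
    the radial component \<open>r\<close> disappears.\<close>
  define R where "R e = (\<Sum>j\<le>5. \<Sum>k\<le>5. chart_coeff f j k * (1 + e * r) ^ (5 - j - k) * s ^ j * t ^ k * e ^ (j + k - 2))" for e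
  have "eval3 f (vector [1 + e * r, e * s, e * t]) = e\<^sup>2 * R e" for e
  proof -
    have "chart_coeff f j k * (1 + e * r) ^ (5 - j - k) * (e * s) ^ j * (e * t) ^ k
       = e\<^sup>2 * (chart_coeff f j k * (1 + e * r) ^ (5 - j - k) * s ^ j * t ^ k * e ^ (j + k - 2))" for j k
    proof (cases "j + k < 2")
      case True
      then have "chart_coeff f j k = 0" using assms(2-4) by (cases j; cases k; auto)
      then show ?thesis by simp
    next
      case False
      then have "j + k = 2 + (j + k - 2)" by simp
      then have "e ^ j * e ^ k = e\<^sup>2 * e ^ (j + k - 2)" by (metis power_add)
      then show ?thesis by (simp add: power_mult_distrib mult_ac)
    qed
    then show ?thesis unfolding eval3_chart_coeff[OF assms(1)] R_def by (simp only: sum_distrib_left)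
  qed
  then have ev: "\<forall>\<^sub>F e in at 0. R e = eval3 f (vector [1 + e * r, e * s, e * t]) / e\<^sup>2"
    by (simp add: eventually_at_filter)
  have lim: "(R \<longlongrightarrow> R 0) (at 0)"
    unfolding R_def by (intro tendsto_intros)
  have "R 0 = chart_coeff f 2 0 * s\<^sup>2 + chart_coeff f 1 1 * s * t + chart_coeff f 0 2 * t\<^sup>2"
    using assms(2-4) by (simp add: R_def atMost_5 algebra_simps)
  then show ?thesis using Lim_transform_eventually[OF lim ev] by simp
qed

lemma chart_first_order:
  assumes "homogeneous 5 f" "\<And>w. ((\<lambda>t. eval3 f (vector [1, 0, 0] + t *s w)) has_field_derivative 0) (at 0)"
    "eval3 f (vector [1, 0, 0]) = 0"
  shows "chart_coeff f 0 0 = 0" "chart_coeff f 1 0 = 0" "chart_coeff f 0 1 = 0"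
proof -
  show c00: "chart_coeff f 0 0 = 0"
    using assms(3) by (simp add: eval3_chart[OF assms(1)] bipoly_def atMost_5)
  have "((\<lambda>t. eval3 f (vector [1, 0, 0] + t *s vector [0, x, y])) has_field_derivative
     x * chart_coeff f 1 0 + y * chart_coeff f 0 1) (at 0)" for x y
  proof -
    have e: "vector [1, 0, 0] + t *s vector [0, x, y] = (vector [1, t * x, t * y] :: complex^3)" for t
      by (simp add: vec_eq_iff forall_3)
    have "((\<lambda>t. \<Sum>j\<le>5. \<Sum>k\<le>5. (chart_coeff f j k * x ^ j * y ^ k) * t ^ (j + k)) has_field_derivative
        (\<Sum>j\<le>5. \<Sum>k\<le>5. (chart_coeff f j k * x ^ j * y ^ k) * (of_nat (j + k) * 0 ^ (j + k - Suc 0)))) (at 0)"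
    \<comment> \<open>At 0 the power of zero leaves only \<open>j + k \<le> 1\<close>, and the
      factor \<open>of_nat (j + k)\<close> removes the constant term.\<close>
    proof (intro DERIV_sum DERIV_cmult)
      show "((\<lambda>t. t ^ n) has_field_derivative of_nat n * 0 ^ (n - Suc 0)) (at (0::complex))" for n
        using DERIV_power[OF DERIV_ident, of n "0::complex"] by simp
    qed
    moreover have "(\<Sum>j\<le>5. \<Sum>k\<le>5. (chart_coeff f j k * x ^ j * y ^ k) * (of_nat (j + k) * 0 ^ (j + k - Suc 0)))
        = x * chart_coeff f 1 0 + y * chart_coeff f 0 1"
      by (simp add: atMost_5)
    ultimately show ?thesis
      unfolding e eval3_chart[OF assms(1)] bipoly_def by (simp add: power_mult_distrib power_add mult_ac)
  qed
  then have "x * chart_coeff f 1 0 + y * chart_coeff f 0 1 = 0" for x y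
    using assms(2) DERIV_unique by blast
  from this[of 1 0] this[of 0 1] show "chart_coeff f 1 0 = 0" "chart_coeff f 0 1 = 0" by simp_all
qed

lemma mem_zero_locus_span:
  assumes "homogeneous d f" "w \<noteq> 0"
  shows "vec.span {w} \<in> zero_locus f \<longleftrightarrow> eval3 f w = 0"
proof -
  have "vec.span {w} \<in> CP2" using assms(2) unfolding CP2_def by blast
  moreover have "eval3 f u = 0" if "eval3 f w = 0" "u \<in> vec.span {w}" for u
    using that by (auto simp: vec.span_singleton eval3_scale[OF assms(1)])
  moreover have "w \<in> vec.span {w}" by (simp add: vec.span_base)
  ultimately show ?thesis unfolding zero_locus_def by blast
qed

lemma in_chart_zero_locus:
  assumes "homogeneous 5 f" "homogeneous 5 f'" "vec.span {v, a, b} = UNIV"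
    "\<And>x y z. eval3 f' (vector [x, y, z]) = eval3 f (x *s v + y *s a + z *s b)"
  shows "in_chart (zero_locus f) v a b = {p. bipoly (chart_coeff f') p = 0}"
proof -
  have "vec.span {v + s *s a + t *s b} \<in> zero_locus f \<longleftrightarrow> bipoly (chart_coeff f') (s, t) = 0" for s t
  proof -
    have "v + s *s a + t *s b \<noteq> 0"
      using basis_injective[OF assms(3), of 1 s t] by auto
    then have "vec.span {v + s *s a + t *s b} \<in> zero_locus f \<longleftrightarrow> eval3 f (1 *s v + s *s a + t *s b) = 0"
      using mem_zero_locus_span[OF assms(1)] by simp
    also have "\<dots> \<longleftrightarrow> bipoly (chart_coeff f') (s, t) = 0"
      by (simp only: assms(4)[symmetric] eval3_chart[OF assms(2)])
    finally show ?thesis .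
  qed
  then show ?thesis by (auto simp: in_chart_def)
qed

lemma chart_coeff_singular:
  assumes "p \<in> singular_points f" "v \<in> p" "homogeneous 5 f'"
    "\<And>x y z. eval3 f' (vector [x, y, z]) = eval3 f (x *s v + y *s a + z *s b)"
  shows "chart_coeff f' 0 0 = 0" "chart_coeff f' 1 0 = 0" "chart_coeff f' 0 1 = 0"
proof -
  have g: "gradient f v = 0" "eval3 f v = 0"
    using assms(1,2) by (auto simp: singular_points_def zero_locus_def)
  have "eval3 f' (vector [1, 0, 0]) = 0" using assms(4)[of 1 0 0] g by simp
  moreover have "((\<lambda>t. eval3 f' (vector [1, 0, 0] + t *s w)) has_field_derivative 0) (at 0)" for w
  proof -
    have "eval3 f' (vector [1, 0, 0] + t *s w) = eval3 f (v + t *s (w $ 1 *s v + w $ 2 *s a + w $ 3 *s b))" for t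
    proof -
      have "vector [1, 0, 0] + t *s w = vector [1 + t * w $ 1, t * w $ 2, t * w $ 3]"
        by (simp add: vec_eq_iff forall_3)
      moreover have "(1 + t * w $ 1) *s v + (t * w $ 2) *s a + (t * w $ 3) *s b
          = v + t *s (w $ 1 *s v + w $ 2 *s a + w $ 3 *s b)"
        by (simp add: vec_eq_iff algebra_simps)
      ultimately show ?thesis by (simp only: assms(4))
    qed
    then show ?thesis using eval3_directional_derivative[OF g(1)] by (simp only:)
  qed
  ultimately show "chart_coeff f' 0 0 = 0" "chart_coeff f' 1 0 = 0" "chart_coeff f' 0 1 = 0"
    using chart_first_order[OF assms(3)] by blast+
qed

section \<open>Adapting the chart to the tangent direction by unitary rotations\<close>

lemma span_unitary_rotation:
  fixes v a b :: "complex^3"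
  assumes "vec.span {v, a, b} = UNIV" "(norm x)\<^sup>2 + (norm y)\<^sup>2 = 1"
  shows "vec.span {v, cnj y *s a - cnj x *s b, x *s a + y *s b} = UNIV"
  unfolding span3_eq_UNIV_iff
proof
  fix w
  have "complex_of_real ((norm x)\<^sup>2 + (norm y)\<^sup>2) = x * cnj x + y * cnj y"
    by (simp only: of_real_add complex_norm_square)
  then have one: "x * cnj x + y * cnj y = 1" using assms(2) by simp
  obtain r s t where w: "w = r *s v + s *s a + t *s b"
    using assms(1) unfolding span3_eq_UNIV_iff by blast
  have "w = r *s v + (y * s - x * t) *s (cnj y *s a - cnj x *s b) + (cnj x * s + cnj y * t) *s (x *s a + y *s b)"
  proof -
    have 1: "(y * s - x * t) * cnj y + (cnj x * s + cnj y * t) * x = s"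
      "(y * s - x * t) * (- cnj x) + (cnj x * s + cnj y * t) * y = t"
      using one by algebra+
    have "r *s v + (y * s - x * t) *s (cnj y *s a - cnj x *s b) + (cnj x * s + cnj y * t) *s (x *s a + y *s b)
       = r *s v + ((y * s - x * t) * cnj y + (cnj x * s + cnj y * t) * x) *s a
          + ((y * s - x * t) * (- cnj x) + (cnj x * s + cnj y * t) * y) *s b"
      by (simp add: vec_eq_iff algebra_simps)
    then show ?thesis unfolding 1 w by simp
  qed
  then show "\<exists>r s t. w = r *s v + s *s (cnj y *s a - cnj x *s b) + t *s (x *s a + y *s b)" by blast
qed

text \<open>The transformation of the quadratic part is obtained by uniqueness of limits of
  second-order quotients, which avoids expanding the substituted polynomial.\<close>

lemma rotated_chart:
  assumes f: "homogeneous 5 f" "squarefree f" and p: "p \<in> singular_points f" "v \<in> p"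
    and span: "vec.span {v, a, b} = UNIV"
    and f1: "homogeneous 5 f1" "\<And>x y z. eval3 f1 (vector [x, y, z]) = eval3 f (x *s v + y *s a + z *s b)"
      "knot_link {p. bipoly (chart_coeff f1) p = 0} n"
    and xy: "(norm x)\<^sup>2 + (norm y)\<^sup>2 = 1"
  obtains a' b' f2 where "vec.span {v, a', b'} = UNIV" "homogeneous 5 f2" "squarefree f2"
    "\<And>x y z. eval3 f2 (vector [x, y, z]) = eval3 f (x *s v + y *s a' + z *s b')"
    "knot_link {p. bipoly (chart_coeff f2) p = 0} n"
    "\<And>s t. chart_coeff f2 2 0 * s\<^sup>2 + chart_coeff f2 1 1 * s * t + chart_coeff f2 0 2 * t\<^sup>2 =
      chart_coeff f1 2 0 * (cnj y * s + x * t)\<^sup>2 + chart_coeff f1 1 1 * (cnj y * s + x * t) * (y * t - cnj x * s)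
        + chart_coeff f1 0 2 * (y * t - cnj x * s)\<^sup>2"
proof -
  let ?a = "cnj y *s a - cnj x *s b" and ?b = "x *s a + y *s b"
  have span': "vec.span {v, ?a, ?b} = UNIV" by (rule span_unitary_rotation[OF span xy])
  obtain f2 where f2: "squarefree f2" "homogeneous 5 f2"
    "\<And>x y z. eval3 f2 (vector [x, y, z]) = eval3 f (x *s v + y *s ?a + z *s ?b)"
    using change_of_basis[OF span' f(2,1)] by blast
  have rel: "eval3 f2 (vector [r, s, t]) = eval3 f1 (vector [r, cnj y * s + x * t, y * t - cnj x * s])" for r s t
  proof -
    have "r *s v + s *s ?a + t *s ?b = r *s v + (cnj y * s + x * t) *s a + (y * t - cnj x * s) *s b"
      by (simp add: vec_eq_iff algebra_simps)
    then show ?thesis by (simp only: f2(3) f1(2))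
  qed
  have "bipoly (chart_coeff f2) (s, t) = bipoly (chart_coeff f1) (cnj y * s + x * t, y * t - cnj x * s)" for s t
    unfolding eval3_chart[OF f2(2), symmetric] eval3_chart[OF f1(1), symmetric] by (rule rel)
  then have "{p. bipoly (chart_coeff f2) p = 0} =
      {p. bipoly (chart_coeff f1) (cnj y * fst p + x * snd p, y * snd p - cnj x * fst p) = 0}"
    by auto
  then have kl: "knot_link {p. bipoly (chart_coeff f2) p = 0} n"
    using knot_link_unitary[OF f1(3) xy] by simp
  have quad: "chart_coeff f2 2 0 * s\<^sup>2 + chart_coeff f2 1 1 * s * t + chart_coeff f2 0 2 * t\<^sup>2 =
      chart_coeff f1 2 0 * (cnj y * s + x * t)\<^sup>2 + chart_coeff f1 1 1 * (cnj y * s + x * t) * (y * t - cnj x * s)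
        + chart_coeff f1 0 2 * (y * t - cnj x * s)\<^sup>2" for s t
  proof -
    have l2: "((\<lambda>e. eval3 f2 (vector [1 + e * 0, e * s, e * t]) / e\<^sup>2) \<longlongrightarrow>
        chart_coeff f2 2 0 * s\<^sup>2 + chart_coeff f2 1 1 * s * t + chart_coeff f2 0 2 * t\<^sup>2) (at 0)"
      by (rule chart_second_order[OF f2(2) chart_coeff_singular[OF p f2(2,3)]])
    have l1: "((\<lambda>e. eval3 f1 (vector [1 + e * 0, e * (cnj y * s + x * t), e * (y * t - cnj x * s)]) / e\<^sup>2) \<longlongrightarrow>
        chart_coeff f1 2 0 * (cnj y * s + x * t)\<^sup>2 + chart_coeff f1 1 1 * (cnj y * s + x * t) * (y * t - cnj x * s)
        + chart_coeff f1 0 2 * (y * t - cnj x * s)\<^sup>2) (at 0)"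
      by (rule chart_second_order[OF f1(1) chart_coeff_singular[OF p f1(1,2)]])
    have "eval3 f2 (vector [1 + e * 0, e * s, e * t]) =
        eval3 f1 (vector [1 + e * 0, e * (cnj y * s + x * t), e * (y * t - cnj x * s)])" for e
      unfolding rel by (simp add: algebra_simps)
    then show ?thesis using l1 l2 by (simp only:) (rule tendsto_unique[OF _ l2], simp_all)
  qed
  show ?thesis using that[OF span' f2(2,1,3) kl quad] .
qed

lemma unit_vector_direction:
  fixes X Y :: complex
  assumes "X \<noteq> 0 \<or> Y \<noteq> 0"
  obtains r :: real where "r > 0" "(norm (X / r))\<^sup>2 + (norm (Y / r))\<^sup>2 = 1"
proof
  define r where "r = sqrt ((norm X)\<^sup>2 + (norm Y)\<^sup>2)"
  have "(norm X)\<^sup>2 + (norm Y)\<^sup>2 > 0" using assms by (auto simp: add_pos_nonneg add_nonneg_pos)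
  then have r: "r > 0" "r\<^sup>2 = (norm X)\<^sup>2 + (norm Y)\<^sup>2" by (auto simp: r_def)
  show "r > 0" by fact
  show "(norm (X / r))\<^sup>2 + (norm (Y / r))\<^sup>2 = 1"
    using r(1) by (simp add: norm_divide power_divide add_divide_distrib[symmetric] r(2)[symmetric])
qed

lemma quadratic_form_zero:
  fixes p q r :: complex
  assumes "\<And>s t. p * s\<^sup>2 + q * s * t + r * t\<^sup>2 = 0"
  shows "p = 0" "q = 0" "r = 0"
  using assms[of 1 0] assms[of 0 1] assms[of 1 1] by auto

text \<open>A nonzero quadratic part is treated by two rotations: one makes the coefficient of the
  square of the second chart coordinate nonzero, so that the discriminant criterion applies; the
  other aligns the resulting double tangent line with the first axis. A vanishing quadratic part
  already has the required form.\<close>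

lemma singular_T2_chart:
  assumes C: "plane_curve 5 f C" and p: "p \<in> singular_points f" "has_link_T2 C p n" "odd n"
  obtains v a b f' where "p = vec.span {v}" "vec.span {v, a, b} = UNIV" "squarefree f'" "homogeneous 5 f'"
    "\<And>x y z. eval3 f' (vector [x, y, z]) = eval3 f (x *s v + y *s a + z *s b)"
    "knot_link {p. bipoly (chart_coeff f') p = 0} n"
    "chart_coeff f' 0 0 = 0" "chart_coeff f' 1 0 = 0" "chart_coeff f' 0 1 = 0"
    "chart_coeff f' 2 0 = 0" "chart_coeff f' 1 1 = 0"
proof -
  have f: "homogeneous 5 f" "squarefree f" "C = zero_locus f" using C by (auto simp: plane_curve_def)
  obtain v a b where vab: "p = vec.span {v}" "vec.span {v, a, b} = UNIV"
    "same_link (in_chart C v a b) {(x, y). x\<^sup>2 = y ^ n}"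
    using p(2) unfolding has_link_T2_def affine_chart_at_def by blast
  have vp: "v \<in> p" unfolding vab(1) by (simp add: vec.span_base)
  obtain f0 where f0: "squarefree f0" "homogeneous 5 f0"
    "\<And>x y z. eval3 f0 (vector [x, y, z]) = eval3 f (x *s v + y *s a + z *s b)"
    using change_of_basis[OF vab(2) f(2,1)] by blast
  have kl: "knot_link {p. bipoly (chart_coeff f0) p = 0} n"
    using same_link_imp_knot_link[OF vab(3)] unfolding f(3) in_chart_zero_locus[OF f(1) f0(2) vab(2) f0(3)] .
  note c0 = chart_coeff_singular[OF p(1) vp f0(2,3)]
  define Q where "Q s t = chart_coeff f0 2 0 * s\<^sup>2 + chart_coeff f0 1 1 * s * t + chart_coeff f0 0 2 * t\<^sup>2" for s t
  show ?thesis
  proof (cases "\<forall>s t. Q s t = 0")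
    case True
    then have "chart_coeff f0 2 0 = 0" "chart_coeff f0 1 1 = 0"
      using quadratic_form_zero[of "chart_coeff f0 2 0" "chart_coeff f0 1 1" "chart_coeff f0 0 2"] unfolding Q_def by blast+
    then show ?thesis using that[OF vab(1,2) f0 kl c0] by blast
  next
    case False
    \<comment> \<open>The rotated second axis will point along \<open>(X, Y)\<close>, where the
      quadratic form does not vanish.\<close>
    then obtain X Y where Q: "Q X Y \<noteq> 0" by blast
    then have "X \<noteq> 0 \<or> Y \<noteq> 0" by (auto simp: Q_def)
    then obtain r :: real where r: "r > 0" "(norm (X / r))\<^sup>2 + (norm (Y / r))\<^sup>2 = 1"
      by (rule unit_vector_direction)
    obtain a1 b1 f1 where f1: "vec.span {v, a1, b1} = UNIV" "homogeneous 5 f1" "squarefree f1"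
      "\<And>x y z. eval3 f1 (vector [x, y, z]) = eval3 f (x *s v + y *s a1 + z *s b1)"
      "knot_link {p. bipoly (chart_coeff f1) p = 0} n"
      "\<And>s t. chart_coeff f1 2 0 * s\<^sup>2 + chart_coeff f1 1 1 * s * t + chart_coeff f1 0 2 * t\<^sup>2 =
         Q (cnj (Y / r) * s + X / r * t) (Y / r * t - cnj (X / r) * s)"
      using rotated_chart[OF f(1,2) p(1) vp vab(2) f0(2,3) kl r(2)] unfolding Q_def by metis
    note c1 = chart_coeff_singular[OF p(1) vp f1(2,4)]
    have "chart_coeff f1 0 2 = Q (X / r) (Y / r)" using f1(6)[of 0 1] by simp
    also have "\<dots> = Q X Y / r\<^sup>2"
      by (simp add: Q_def power_divide add_divide_distrib power2_eq_square)
    finally have k0: "chart_coeff f1 0 2 \<noteq> 0" using Q r by simp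
    have disc: "(chart_coeff f1 1 1)\<^sup>2 = 4 * chart_coeff f1 2 0 * chart_coeff f1 0 2"
    proof -
      have low: "chart_coeff f1 i j = 0" if "i + 1 * j < 2 * 1" for i j
        using that c1 by (cases i; cases j; auto)
      show ?thesis
        using knot_link_not_two_branches[OF f1(5) p(3) _ k0 low] by simp
    qed
    define \<mu> where "\<mu> = csqrt (chart_coeff f1 0 2)"
    define l where "l = chart_coeff f1 1 1 / (2 * \<mu>)"
    have \<mu>: "\<mu>\<^sup>2 = chart_coeff f1 0 2" "\<mu> \<noteq> 0" using k0 by (auto simp: \<mu>_def)
    have sq: "chart_coeff f1 2 0 * s\<^sup>2 + chart_coeff f1 1 1 * s * t + chart_coeff f1 0 2 * t\<^sup>2 = (l * s + \<mu> * t)\<^sup>2" for s t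
    proof -
      have "chart_coeff f1 1 1 = 2 * l * \<mu>" using \<mu>(2) by (simp add: l_def)
      moreover have "chart_coeff f1 2 0 = l\<^sup>2"
        using disc \<mu> calculation k0 by (simp add: power_mult_distrib)
      ultimately show ?thesis by (simp add: \<mu>(1)[symmetric] power2_eq_square algebra_simps)
    qed
    \<comment> \<open>The vector \<open>(cnj l, cnj \<mu>)\<close> is Hermitian orthogonal to the
      kernel of \<open>l * s + \<mu> * t\<close>, so rotating the second axis onto it makes the
      first axis that kernel.\<close>
    obtain r' :: real where r': "r' > 0" "(norm (cnj l / r'))\<^sup>2 + (norm (cnj \<mu> / r'))\<^sup>2 = 1"
      using unit_vector_direction[of "cnj l" "cnj \<mu>"] \<mu>(2) by auto
    obtain a2 b2 f2 where f2: "vec.span {v, a2, b2} = UNIV" "homogeneous 5 f2" "squarefree f2"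
      "\<And>x y z. eval3 f2 (vector [x, y, z]) = eval3 f (x *s v + y *s a2 + z *s b2)"
      "knot_link {p. bipoly (chart_coeff f2) p = 0} n"
      "\<And>s t. chart_coeff f2 2 0 * s\<^sup>2 + chart_coeff f2 1 1 * s * t + chart_coeff f2 0 2 * t\<^sup>2 =
         (l * (cnj (cnj \<mu> / r') * s + cnj l / r' * t) + \<mu> * (cnj \<mu> / r' * t - cnj (cnj l / r') * s))\<^sup>2"
      using rotated_chart[OF f(1,2) p(1) vp f1(1,2,4,5) r'(2)] unfolding sq by metis
    define m where "m = l * cnj l / r' + \<mu> * cnj \<mu> / r'"
    have "(chart_coeff f2 2 0) * s\<^sup>2 + chart_coeff f2 1 1 * s * t + (chart_coeff f2 0 2 - m\<^sup>2) * t\<^sup>2 = 0" for s t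
    proof -
      have "l * (cnj (cnj \<mu> / r') * s + cnj l / r' * t) + \<mu> * (cnj \<mu> / r' * t - cnj (cnj l / r') * s) = m * t"
        by (simp add: m_def algebra_simps)
      then show ?thesis using f2(6)[of s t] by (simp add: algebra_simps power_mult_distrib)
    qed
    from quadratic_form_zero[OF this]
    have "chart_coeff f2 2 0 = 0" "chart_coeff f2 1 1 = 0" by blast+
    then show ?thesis
      using that[OF vab(1) f2(1,3,2,4,5) chart_coeff_singular[OF p(1) vp f2(2,4)]] by blast
  qed
qed

lemma degenerate_from_chart:
  assumes "homogeneous 5 f'" "vec.span {v, a, b} = UNIV"
    "\<And>x y z. eval3 f' (vector [x, y, z]) = eval3 f (x *s v + y *s a + z *s b)"
    "chart_coeff f' 0 0 = 0" "chart_coeff f' 1 0 = 0" "chart_coeff f' 0 1 = 0"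
    "chart_coeff f' 2 0 = 0" "chart_coeff f' 1 1 = 0"
  shows "degenerate f v"
proof -
  define m where "m = csqrt (chart_coeff f' 0 2)"
  have m: "m\<^sup>2 = chart_coeff f' 0 2" by (simp add: m_def)
  have "\<exists>x y z. axis i 1 = x *s v + y *s a + z *s b" for i :: 3
    using assms(2) unfolding span3_eq_UNIV_iff by blast
  then obtain X Y Z where XYZ: "\<And>i :: 3. axis i 1 = X i *s v + Y i *s a + Z i *s b" by metis
  \<comment> \<open>\<open>Z\<close> gives the third coordinates of the standard basis vectors with
    respect to \<open>v\<close>, \<open>a\<close>, \<open>b\<close>, so \<open>L\<close> is
    \<open>m\<close> times that coordinate functional.\<close>
  define L :: "complex^3" where "L = (\<chi> i. m * Z i)"
  show ?thesis
    unfolding degenerate_def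
  proof (intro exI[of _ L] allI)
    fix w :: "complex^3"
    define r s t where "r = w $ 1 * X 1 + w $ 2 * X 2 + w $ 3 * X 3"
      and "s = w $ 1 * Y 1 + w $ 2 * Y 2 + w $ 3 * Y 3" and "t = w $ 1 * Z 1 + w $ 2 * Z 2 + w $ 3 * Z 3"
    have "w = w $ 1 *s axis 1 1 + w $ 2 *s axis 2 1 + w $ 3 *s axis 3 1"
      by (simp add: vec_eq_iff forall_3 axis_def)
    also have "\<dots> = r *s v + s *s a + t *s b"
      unfolding XYZ by (simp add: r_def s_def t_def vec_eq_iff algebra_simps)
    finally have w: "w = r *s v + s *s a + t *s b" .
    have e: "eval3 f' (vector [1 + e * r, e * s, e * t]) = eval3 f (v + e *s w)" for e
    proof -
      have "(1 + e * r) *s v + (e * s) *s a + (e * t) *s b = v + e *s w"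
        by (subst w) (simp add: vec_eq_iff algebra_simps)
      then show ?thesis by (simp only: assms(3))
    qed
    have "((\<lambda>e. eval3 f (v + e *s w) / e\<^sup>2) \<longlongrightarrow> chart_coeff f' 0 2 * t\<^sup>2) (at 0)"
      using chart_second_order[OF assms(1,4,5,6), of r s t] assms(7,8) by (simp add: e)
    moreover have "chart_coeff f' 0 2 * t\<^sup>2 = (L $ 1 * w $ 1 + L $ 2 * w $ 2 + L $ 3 * w $ 3)\<^sup>2"
    proof -
      have "L $ 1 * w $ 1 + L $ 2 * w $ 2 + L $ 3 * w $ 3 = m * t"
        by (simp add: L_def t_def algebra_simps)
      then show ?thesis by (simp add: power_mult_distrib m)
    qed
    ultimately show "((\<lambda>e. eval3 f (v + e *s w) / e\<^sup>2) \<longlongrightarrow> (L $ 1 * w $ 1 + L $ 2 * w $ 2 + L $ 3 * w $ 3)\<^sup>2) (at 0)"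
      by simp
  qed
qed

section \<open>Discriminants and square factors\<close>

lemma poly_second_order_limit:
  fixes r :: "complex poly"
  assumes "((\<lambda>t. poly r t / t\<^sup>2) \<longlongrightarrow> l) (at 0)"
  shows "coeff r 0 = 0" "coeff r 1 = 0" "coeff r 2 = l"
proof -
  obtain a r1 where r: "r = pCons a r1" by (rule pCons_cases)
  obtain b s where r1: "r1 = pCons b s" by (rule pCons_cases)
  have cont: "(poly q \<longlongrightarrow> poly q 0) (at 0)" for q :: "complex poly"
    by (intro isContD poly_isCont)
  have ev: "\<forall>\<^sub>F t in at 0. t \<noteq> (0::complex)" by (simp add: eventually_at_filter)
  have "((\<lambda>t. t\<^sup>2 * (poly r t / t\<^sup>2)) \<longlongrightarrow> 0\<^sup>2 * l) (at 0)" by (intro tendsto_intros assms)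
  then have "((\<lambda>t. t\<^sup>2 * (poly r t / t\<^sup>2)) \<longlongrightarrow> 0) (at 0)"
    by (simp only: power_zero_numeral mult_zero_left)
  then have "(poly r \<longlongrightarrow> 0) (at 0)"
    by (rule Lim_transform_eventually) (rule eventually_mono[OF ev], simp)
  then have "poly r 0 = 0" using cont tendsto_unique[OF at_neq_bot] by blast
  then have a: "a = 0" by (simp add: r)
  have "((\<lambda>t. t * (poly r t / t\<^sup>2)) \<longlongrightarrow> 0 * l) (at 0)" by (intro tendsto_intros assms)
  then have "((\<lambda>t. t * (poly r t / t\<^sup>2)) \<longlongrightarrow> 0) (at 0)" by (simp only: mult_zero_left)
  then have "(poly r1 \<longlongrightarrow> 0) (at 0)"
    by (rule Lim_transform_eventually) (rule eventually_mono[OF ev], simp add: r a power2_eq_square)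
  then have "poly r1 0 = 0" using cont tendsto_unique[OF at_neq_bot] by blast
  then have b: "b = 0" by (simp add: r1)
  have "(poly s \<longlongrightarrow> l) (at 0)"
    by (rule Lim_transform_eventually[OF assms]) (rule eventually_mono[OF ev], simp add: r r1 a b power2_eq_square)
  then have "poly s 0 = l" using cont tendsto_unique[OF at_neq_bot] by blast
  then show "coeff r 0 = 0" "coeff r 1 = 0" "coeff r 2 = l"
    by (simp_all add: r r1 a b poly_0_coeff_0 numeral_2_eq_2)
qed

text \<open>Along a line of slope \<open>H\<close> everything becomes a polynomial in
  \<open>t\<close>, whose coefficients up to order two are polynomials in \<open>H\<close>; varying
  \<open>H\<close> separates them.\<close>

lemma quadratic_expansion:
  fixes p :: "nat \<Rightarrow> complex poly" and \<alpha> \<beta> :: complex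
  assumes "\<And>H. ((\<lambda>t. (\<Sum>i\<le>5. poly (p i) t * (t * H) ^ i) / t\<^sup>2) \<longlongrightarrow> (\<alpha> * H + \<beta>)\<^sup>2) (at 0)"
  shows "coeff (p 0) 0 = 0" "coeff (p 0) 1 = 0" "coeff (p 0) 2 = \<beta>\<^sup>2" "coeff (p 1) 0 = 0"
    "coeff (p 1) 1 = 2 * \<alpha> * \<beta>" "coeff (p 2) 0 = \<alpha>\<^sup>2"
proof -
  define r where "r H = (\<Sum>i\<le>5. monom (H ^ i) i * p i)" for H
  have "poly (r H) t = (\<Sum>i\<le>5. poly (p i) t * (t * H) ^ i)" for H t
    by (simp add: r_def poly_sum poly_monom power_mult_distrib mult_ac)
  then have lim: "((\<lambda>t. poly (r H) t / t\<^sup>2) \<longlongrightarrow> (\<alpha> * H + \<beta>)\<^sup>2) (at 0)" for H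
    using assms by simp
  have cf: "coeff (r H) n = (\<Sum>i\<le>5. if n < i then 0 else H ^ i * coeff (p i) (n - i))" for H n
    by (simp add: r_def coeff_sum coeff_monom_mult)
  have c0: "coeff (r H) 0 = coeff (p 0) 0" and c1: "coeff (r H) 1 = coeff (p 0) 1 + H * coeff (p 1) 0"
    and c2: "coeff (r H) 2 = coeff (p 0) 2 + H * coeff (p 1) 1 + H\<^sup>2 * coeff (p 2) 0" for H
    unfolding cf atMost_5 by simp_all
  note L = poly_second_order_limit[OF lim]
  show "coeff (p 0) 0 = 0" using L(1)[of 0] c0 by simp
  show "coeff (p 0) 1 = 0" using L(2)[of 0] c1[of 0] by simp
  then show "coeff (p 1) 0 = 0" using L(2)[of 1] c1[of 1] by simp
  have e: "coeff (p 0) 2 + H * coeff (p 1) 1 + H\<^sup>2 * coeff (p 2) 0 = (\<alpha> * H + \<beta>)\<^sup>2" for H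
    using L(3) c2 by simp
  show b: "coeff (p 0) 2 = \<beta>\<^sup>2" using e[of 0] by simp
  have q: "(\<alpha>\<^sup>2 - coeff (p 2) 0) * s\<^sup>2 + (2 * \<alpha> * \<beta> - coeff (p 1) 1) * s * 1 + 0 * 1\<^sup>2 = 0" for s
    using e[of s] b by (simp add: power2_eq_square algebra_simps)
  have 1: "(\<alpha>\<^sup>2 - coeff (p 2) 0) + (2 * \<alpha> * \<beta> - coeff (p 1) 1) = 0"
    "(\<alpha>\<^sup>2 - coeff (p 2) 0) - (2 * \<alpha> * \<beta> - coeff (p 1) 1) = 0"
    using q[of 1] q[of "-1"] by (simp_all add: algebra_simps)
  have half: "x = 0 \<and> y = 0" if "x + y = 0" "x - y = 0" for x y :: complex
    using that by auto
  from half[OF 1] show "coeff (p 1) 1 = 2 * \<alpha> * \<beta>" "coeff (p 2) 0 = \<alpha>\<^sup>2"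
    by simp_all
qed

lemma root_count:
  fixes p :: "'a::idom poly"
  assumes "finite S" "\<And>x. x \<in> S \<Longrightarrow> [:- x, 1:] ^ n dvd p" "degree p < n * card S"
  shows "p = 0"
proof (rule ccontr)
  assume p: "p \<noteq> 0"
  have "n * card S = (\<Sum>x\<in>S. n)" by simp
  also have "\<dots> \<le> (\<Sum>x\<in>S. order x p)"
    using assms(2) p order_divides by (intro sum_mono) blast
  also have "\<dots> = (\<Sum>x\<in>S. count (proots p) x)" using p by simp
  also have "\<dots> \<le> size (proots p)"
  proof -
    have "(\<Sum>x\<in>S. count (proots p) x) = (\<Sum>x\<in>S \<inter> set_mset (proots p). count (proots p) x)"
      using assms(1) by (intro sum.mono_neutral_right) (auto simp: not_in_iff simp del: set_count_proots)
    also have "\<dots> \<le> (\<Sum>x\<in>set_mset (proots p). count (proots p) x)"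
      by (intro sum_mono2) auto
    finally show ?thesis by (simp add: size_multiset_overloaded_eq del: set_count_proots)
  qed
  also have "\<dots> \<le> degree p" by (rule size_proots_le)
  finally show False using assms(3) by simp
qed

lemma shift_dvd:
  fixes p :: "'a::comm_ring_1 poly"
  assumes "monom 1 n dvd pcompose p [:x, 1:]"
  shows "[:- x, 1:] ^ n dvd p"
proof -
  obtain g where g: "pcompose p [:x, 1:] = monom 1 n * g" using assms by blast
  have "p = pcompose (pcompose p [:x, 1:]) [:- x, 1:]"
    by (simp add: pcompose_assoc[symmetric] pcompose_pCons)
  also have "\<dots> = pcompose (monom 1 n) [:- x, 1:] * pcompose g [:- x, 1:]"
    by (simp add: g pcompose_mult)
  also have "pcompose (monom 1 n) [:- x, 1:] = [:- x, 1:] ^ n"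
    by (induction n) (simp_all add: monom_0 monom_Suc pcompose_pCons)
  finally show ?thesis by (rule dvdI)
qed

text \<open>The discriminant of the cubic with coefficients \<open>a\<close>, \<open>b\<close>,
  \<open>c\<close>, \<open>d\<close> in descending order.\<close>

definition disc3 :: "'a::comm_ring_1 \<Rightarrow> 'a \<Rightarrow> 'a \<Rightarrow> 'a \<Rightarrow> 'a" where
  "disc3 a b c d = b\<^sup>2 * c\<^sup>2 - 4 * a * c ^ 3 - 4 * b ^ 3 * d - 27 * a\<^sup>2 * d\<^sup>2 + 18 * a * b * c * d"

text \<open>The shifted arguments are the Taylor coefficients of the cubic at \<open>x\<close>;
  translation does not affect differences of roots.\<close>

lemma disc3_shift:
  "disc3 a (b + 3 * a * x) (c + 2 * b * x + 3 * a * x\<^sup>2) (d + c * x + b * x\<^sup>2 + a * x ^ 3) = disc3 a b c d"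
  by (simp add: disc3_def power2_eq_square power3_eq_cube algebra_simps)

text \<open>With \<open>c\<close> divisible by the variable and \<open>d\<close> by its square, the
  discriminant is \<open>b\<^sup>2 * (c\<^sup>2 - 4 * b * d)\<close> modulo the third power. The
  bracket is divisible by the square, and the last hypothesis kills its next coefficient.\<close>

lemma disc3_triple_root:
  fixes a b c d :: "complex poly"
  assumes "coeff d 0 = 0" "coeff d 1 = 0" "coeff c 0 = 0" "(coeff c 1)\<^sup>2 = 4 * coeff b 0 * coeff d 2"
  shows "monom 1 3 dvd disc3 a b c d" "monom 1 3 dvd c\<^sup>2 - 4 * b * d"
proof -
  define X where "X = monom (1::complex) 1"
  have "X dvd c" unfolding X_def monom_1_dvd_iff' using assms(3) by simp
  then obtain c1 where c: "c = X * c1" ..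
  have "monom 1 2 dvd d" unfolding monom_1_dvd_iff' using assms(1,2) by (auto simp: less_2_cases_iff)
  then obtain d2 where "d = monom 1 2 * d2" ..
  then have d: "d = X\<^sup>2 * d2" by (simp add: X_def monom_power)
  have X3: "monom 1 3 = X\<^sup>2 * X" by (simp add: X_def monom_power mult_monom)
  have "coeff c 1 = coeff c1 0" by (simp add: c X_def coeff_monom_mult)
  moreover have "coeff d 2 = coeff d2 0" by (simp add: d X_def monom_power coeff_monom_mult)
  ultimately have "poly (c1\<^sup>2 - 4 * b * d2) 0 = 0" using assms(4) by (simp flip: poly_0_coeff_0)
  then have "coeff (c1\<^sup>2 - 4 * b * d2) 0 = 0" by (simp only: poly_0_coeff_0)
  then have "X dvd c1\<^sup>2 - 4 * b * d2" unfolding X_def monom_1_dvd_iff' by simp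
  then obtain e where e: "c1\<^sup>2 - 4 * b * d2 = X * e" ..
  have "c\<^sup>2 - 4 * b * d = X\<^sup>2 * (c1\<^sup>2 - 4 * b * d2)"
    by (simp add: c d power_mult_distrib algebra_simps)
  then show "monom 1 3 dvd c\<^sup>2 - 4 * b * d" unfolding X3 e by (simp add: mult.assoc[symmetric])
  have "disc3 a b c d = X\<^sup>2 * X * (b\<^sup>2 * e - 4 * a * c1 ^ 3 - 27 * a\<^sup>2 * d2\<^sup>2 * X + 18 * a * b * c1 * d2)"
  proof -
    have "disc3 a b c d = X\<^sup>2 * (b\<^sup>2 * (c1\<^sup>2 - 4 * b * d2) +
        X * (18 * a * b * c1 * d2 - 4 * a * c1 ^ 3 - 27 * a\<^sup>2 * d2\<^sup>2 * X))"
      unfolding disc3_def c d by (simp add: power2_eq_square power3_eq_cube algebra_simps)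
    then show ?thesis unfolding e by (simp add: power2_eq_square algebra_simps)
  qed
  then show "monom 1 3 dvd disc3 a b c d" unfolding X3 by simp
qed

text \<open>The coefficient of \<open>x\<^sup>i\<close> in \<open>f(x, y, 1)\<close>, a polynomial in \<open>y\<close>. The point \<open>[1 : 0 : 0]\<close> is the centre of the
  projection \<open>(x, y, z) \<mapsto> (y, z)\<close>.\<close>

definition dehom :: "poly3 \<Rightarrow> nat \<Rightarrow> complex poly" where
  "dehom f i = (\<Sum>j\<le>5. monom (if i + j \<le> 5 then coeff3 f i j (5 - i - j) else 0) j)"

lemma coeff_dehom: "coeff (dehom f i) j = (if i + j \<le> 5 then coeff3 f i j (5 - i - j) else 0)"
  by (simp add: dehom_def coeff_sum_monom)

lemma degree_dehom: "degree (dehom f i) \<le> 5 - i"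
  by (rule degree_le) (auto simp: coeff_dehom)

lemma eval_coeff:
  assumes "homogeneous 5 f" "z \<noteq> 0" "i \<le> 5"
  shows "poly (poly (coeff f i) [:y:]) z = z ^ (5 - i) * poly (dehom f i) (y / z)"
proof -
  have "poly (poly (coeff f i) [:y:]) z = (\<Sum>j\<le>5. poly (coeff (coeff f i) j) z * y ^ j)"
    by (subst poly_eq_sum_atMost[OF homogeneous_degrees(2)[OF assms(1)]]) (simp add: poly_sum)
  also have "\<dots> = (\<Sum>j\<le>5. z ^ (5 - i) * (coeff (dehom f i) j * (y / z) ^ j))"
  proof (rule sum.cong)
    fix j :: nat assume "j \<in> {..5}"
    show "poly (coeff (coeff f i) j) z * y ^ j = z ^ (5 - i) * (coeff (dehom f i) j * (y / z) ^ j)"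
    proof (cases "i + j \<le> 5")
      case True
      have "coeff (coeff f i) j = monom (coeff3 f i j (5 - i - j)) (5 - i - j)"
      proof (rule poly_eqI)
        fix k
        have "coeff3 f i j k = 0" if "k \<noteq> 5 - i - j"
        proof -
          have "i + j + k \<noteq> 5" using that True by arith
          then show ?thesis using homogeneous_coeff3[OF assms(1), of i j k] by blast
        qed
        then show "coeff (coeff (coeff f i) j) k = coeff (monom (coeff3 f i j (5 - i - j)) (5 - i - j)) k"
          by (auto simp: coeff3_def)
      qed
      moreover have "z ^ (5 - i) = z ^ (5 - i - j) * z ^ j"
        using True by (simp add: power_add[symmetric])
      ultimately show ?thesis using True assms(2) by (simp add: poly_monom coeff_dehom power_divide)
    next
      case False
      have "coeff (coeff f i) j = 0"
        using homogeneous_coeff3[OF assms(1), of i j] False by (auto simp: poly_eq_iff coeff3_def)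
      then show ?thesis using False by (simp add: coeff_dehom)
    qed
  qed simp
  also have "\<dots> = z ^ (5 - i) * poly (dehom f i) (y / z)"
  proof -
    have "degree (dehom f i) \<le> 5" using degree_dehom[of f i] by simp
    then show ?thesis by (simp add: poly_eq_sum_atMost[of "dehom f i" 5] sum_distrib_left)
  qed
  finally show ?thesis .
qed

lemma eval3_dehom:
  assumes "homogeneous 5 f"
  shows "eval3 f (vector [x, y, 1]) = (\<Sum>i\<le>5. poly (dehom f i) y * x ^ i)"
proof -
  have "eval3 f (vector [x, y, 1]) = (\<Sum>i\<le>5. poly (poly (coeff f i) [:y:]) 1 * x ^ i)"
    unfolding eval3_def
    by (subst poly_eq_sum_atMost[OF homogeneous_degrees(1)[OF assms]]) (simp add: poly_sum)
  also have "\<dots> = (\<Sum>i\<le>5. poly (dehom f i) y * x ^ i)"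
    by (intro sum.cong refl) (simp add: eval_coeff[OF assms])
  finally show ?thesis .
qed

lemma poly2_eq_0I:
  fixes G :: "complex poly poly"
  assumes "\<And>y z. z \<noteq> 0 \<Longrightarrow> poly (poly G [:y:]) z = 0"
  shows "G = 0"
proof (rule poly_eq_0_if_infinite_zeros)
  show "infinite (range (\<lambda>y::complex. [:y:]))"
    by (intro infinite_range_const_poly infinite_UNIV_char_0) (auto simp: inj_on_def)
  fix q assume "q \<in> range (\<lambda>y::complex. [:y:])"
  then obtain y where q: "q = [:y:]" by blast
  show "poly G q = 0"
  proof (rule poly_eq_0_if_infinite_zeros)
    show "infinite (UNIV - {0::complex})" using infinite_UNIV_char_0 by (rule infinite_remove)
  qed (use assms q in auto)
qed

section \<open>Repeated factors from vanishing discriminants\<close>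

lemma not_squarefree_if_square_dvd_multiple:
  fixes f L :: poly3
  assumes "L\<^sup>2 dvd smult k f" "degree L = 1" "k \<noteq> 0"
  shows "\<not> squarefree f"
proof
  assume sf: "squarefree f"
  have "primitive_part (L * L) dvd primitive_part (smult k f)"
    using assms(1) by (intro primitive_part_dvd_primitive_partI) (simp add: power2_eq_square)
  then have "(primitive_part L)\<^sup>2 dvd smult (unit_factor k) (primitive_part f)"
    by (simp only: primitive_part_mult primitive_part_smult power2_eq_square)
  moreover have "unit_factor k dvd 1" using assms(3) by simp
  then obtain k' where "1 = unit_factor k * k'" ..
  then have "primitive_part f = smult k' (smult (unit_factor k) (primitive_part f))"
    by (simp add: mult.commute)
  ultimately have "(primitive_part L)\<^sup>2 dvd primitive_part f"
    by (metis dvd_smult)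
  moreover have "primitive_part f dvd f"
    by (metis content_times_primitive_part dvd_smult dvd_refl)
  ultimately have "(primitive_part L)\<^sup>2 dvd f" by (rule dvd_trans)
  then have "primitive_part L dvd 1" using sf unfolding squarefree_def by blast
  then have "degree (primitive_part L) = 0" by (metis is_unit_iff_degree is_unit_polyE degree_pCons_0)
  then show False using assms(2) by simp
qed

lemma cubic_square_dvd:
  fixes a b c d :: "complex poly poly"
  assumes "disc3 a b c d = 0" "a \<noteq> 0"
  shows "\<not> squarefree [:d, c, b, a:]"
proof -
  \<comment> \<open>\<open>P\<close>, \<open>Q\<close>, \<open>R\<close> are the coefficients of the
    Hessian of the cubic, whose discriminant is -3 times \<open>disc3\<close>. If \<open>P\<close>
    is nonzero, the double root is \<open>- Q / (2 * P)\<close>; if \<open>P = 0\<close>, there is a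
    triple root \<open>- b / (3 * a)\<close>.\<close>
  define P Q where "P = b\<^sup>2 - 3 * a * c" and "Q = b * c - 9 * a * d"
  define R where "R = c\<^sup>2 - 3 * b * d"
  have "Q\<^sup>2 = 4 * P * R - 3 * disc3 a b c d"
    by (simp add: P_def Q_def R_def disc3_def power2_eq_square power3_eq_cube algebra_simps)
  then have QP: "Q\<^sup>2 = 4 * P * R" using assms(1) by simp
  show ?thesis
  proof (cases "P = 0")
    case True
    then have "Q = 0" using QP by simp
    have eq: "smult (27 * a\<^sup>2) [:d, c, b, a:] = [:b, 3 * a:]\<^sup>2 * [:b, 3 * a:]"
    proof -
      have bb: "b * b = 3 * a * c" "b * c = 9 * a * d"
        using True \<open>Q = 0\<close> by (simp_all add: P_def Q_def power2_eq_square)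
      have "b * (b * b) = 3 * a * (b * c)" unfolding bb(1) by (simp add: algebra_simps)
      then have "b * (b * b) = 27 * a\<^sup>2 * d" unfolding bb(2) by (simp add: power2_eq_square algebra_simps)
      moreover have "9 * a * (b * b) = 27 * a\<^sup>2 * c" unfolding bb(1) by (simp add: power2_eq_square algebra_simps)
      moreover have "[:b, 3 * a:]\<^sup>2 * [:b, 3 * a:] = [:b * (b * b), 9 * a * (b * b), 27 * a\<^sup>2 * b, 27 * a\<^sup>2 * a:]"
        by (simp add: power2_eq_square algebra_simps)
      ultimately show ?thesis by simp
    qed
    have "[:b, 3 * a:]\<^sup>2 dvd smult (27 * a\<^sup>2) [:d, c, b, a:]" unfolding eq by (rule dvd_triv_left)
    then show ?thesis
      by (rule not_squarefree_if_square_dvd_multiple) (use assms(2) in auto)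
  next
    case False
    have eq: "smult (4 * P ^ 3) [:d, c, b, a:] = [:Q, 2 * P:]\<^sup>2 * [:b * P - a * Q, a * P:]"
    proof -
      have "R * (b * P - a * Q) = P\<^sup>2 * d + b * disc3 a b c d"
        by (simp add: P_def Q_def R_def disc3_def power2_eq_square power3_eq_cube algebra_simps)
      then have "R * (b * P - a * Q) = P\<^sup>2 * d" using assms(1) by simp
      have "4 * P ^ 3 * d = 4 * P * (P\<^sup>2 * d)" by (simp add: power2_eq_square power3_eq_cube mult_ac)
      also have "\<dots> = 4 * P * (R * (b * P - a * Q))" using \<open>R * (b * P - a * Q) = P\<^sup>2 * d\<close> by simp
      also have "\<dots> = Q\<^sup>2 * (b * P - a * Q)" unfolding QP by (simp only: mult_ac)
      finally have 1: "4 * P ^ 3 * d = Q\<^sup>2 * (b * P - a * Q)" .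
      have "P * c - Q * b + 3 * a * R = 0"
        by (simp add: P_def Q_def R_def power2_eq_square algebra_simps)
      then have "4 * P\<^sup>2 * (P * c - Q * b + 3 * a * R) = 0" by simp
      then have "4 * P ^ 3 * c = 4 * P * Q * (b * P) - 4 * P * a * (4 * P * R) + (4 * P * R) * (a * P)"
        by (simp add: power2_eq_square power3_eq_cube algebra_simps)
      also have "\<dots> = 4 * P * Q * (b * P - a * Q) + Q\<^sup>2 * (a * P)"
        unfolding QP[symmetric] by (simp add: power2_eq_square algebra_simps)
      finally have 2: "4 * P ^ 3 * c = 4 * P * Q * (b * P - a * Q) + Q\<^sup>2 * (a * P)" .
      have 3: "4 * P ^ 3 * b = 4 * P\<^sup>2 * (b * P - a * Q) + 4 * P * Q * (a * P)"
        by (simp add: power2_eq_square power3_eq_cube algebra_simps)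
      have 4: "4 * P ^ 3 * a = 4 * P\<^sup>2 * (a * P)" by (simp add: power2_eq_square power3_eq_cube)
      have "[:Q, 2 * P:]\<^sup>2 * [:b * P - a * Q, a * P:] = [:Q\<^sup>2 * (b * P - a * Q),
        4 * P * Q * (b * P - a * Q) + Q\<^sup>2 * (a * P), 4 * P\<^sup>2 * (b * P - a * Q) + 4 * P * Q * (a * P), 4 * P\<^sup>2 * (a * P):]"
        by (simp add: power2_eq_square algebra_simps)
      then show ?thesis by (simp only: 1[symmetric] 2[symmetric] 3[symmetric] 4[symmetric]) simp
    qed
    have "[:Q, 2 * P:]\<^sup>2 dvd smult (4 * P ^ 3) [:d, c, b, a:]" unfolding eq by (rule dvd_triv_left)
    then show ?thesis
      by (rule not_squarefree_if_square_dvd_multiple) (use False in auto)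
  qed
qed

lemma quadratic_square_dvd:
  fixes b c d :: "complex poly poly"
  assumes "c\<^sup>2 - 4 * b * d = 0" "b \<noteq> 0"
  shows "\<not> squarefree [:d, c, b:]"
proof -
  have "smult (4 * b) [:d, c, b:] = [:c, 2 * b:]\<^sup>2"
    using assms(1) by (simp add: power2_eq_square algebra_simps)
  then have "[:c, 2 * b:]\<^sup>2 dvd smult (4 * b) [:d, c, b:]" by (simp only: dvd_refl)
  then show ?thesis
    by (rule not_squarefree_if_square_dvd_multiple) (use assms(2) in auto)
qed

section \<open>Configurations of degenerate points on a quintic\<close>

lemma pcompose_numeral: "pcompose (numeral n) q = (numeral n :: complex poly)"
  by (simp add: numeral_poly)

lemma poly_eqI_poly:
  fixes p q :: "complex poly"
  shows "(\<And>x. poly p x = poly q x) \<Longrightarrow> p = q"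
  by (simp add: fun_eq_iff flip: poly_eq_poly_eq_iff)

lemma coeff_dehom_chart: "coeff (dehom f i) j = (if i + j \<le> 5 then chart_coeff f j (5 - i - j) else 0)"
  by (auto simp: coeff_dehom chart_coeff_def)

lemma not_squarefree_if_y_square:
  assumes "homogeneous 5 f" "\<And>i j. j < 2 \<Longrightarrow> coeff (dehom f i) j = 0"
  shows "\<not> squarefree f"
proof
  assume sf: "squarefree f"
  define y :: poly3 where "y = [:monom 1 1:]"
  have y2: "y\<^sup>2 = [:monom 1 2:]" by (simp add: y_def power2_eq_square mult_monom numeral_2_eq_2)
  have "coeff (coeff f i) j = 0" if "j < 2" for i j
  proof (rule poly_eqI)
    fix k
    show "coeff (coeff (coeff f i) j) k = coeff 0 k"
    proof (rule ccontr)
      assume "coeff (coeff (coeff f i) j) k \<noteq> coeff 0 k"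
      then have nz: "coeff3 f i j k \<noteq> 0" by (simp add: coeff3_def)
      then have "i + j + k = 5" using homogeneous_coeff3[OF assms(1)] by blast
      then have "i + j \<le> 5" "k = 5 - i - j" by arith+
      then show False using assms(2)[OF that, of i] nz by (simp add: coeff_dehom)
    qed
  qed
  then have "y\<^sup>2 dvd f" unfolding y2 const_poly_dvd_iff monom_1_dvd_iff' by simp
  then have "y dvd 1" using sf unfolding squarefree_def by blast
  then have "monom 1 1 dvd (1 :: complex poly poly)" by (simp add: y_def is_unit_const_poly_iff)
  then have "coeff (1 :: complex poly poly) 0 = 0" unfolding monom_1_dvd_iff' by blast
  then show False by simp
qed

lemma not_squarefree_if_z_square:
  assumes "\<And>i j k. k < 2 \<Longrightarrow> coeff3 f i j k = 0"
  shows "\<not> squarefree f"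
proof
  assume sf: "squarefree f"
  define z :: poly3 where "z = [:[:monom 1 1:]:]"
  have z2: "z\<^sup>2 = [:[:monom 1 2:]:]" by (simp add: z_def power2_eq_square mult_monom numeral_2_eq_2)
  have "z\<^sup>2 dvd f" unfolding z2 const_poly_dvd_iff monom_1_dvd_iff' using assms by (simp add: coeff3_def)
  then have "z dvd 1" using sf unfolding squarefree_def by blast
  then have "monom 1 1 dvd (1 :: complex poly)" by (simp add: z_def is_unit_const_poly_iff)
  then have "coeff (1 :: complex poly) 0 = 0" unfolding monom_1_dvd_iff' by blast
  then show False by simp
qed

text \<open>The shear \<open>y + y0 * z\<close> moves the line in question to \<open>y = 0\<close>,
  where a double component can be read off the coefficients.\<close>

lemma dehom_shift_not_all_double:
  assumes "homogeneous 5 f" "squarefree f"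
    and dbl: "\<And>i j. j < 2 \<Longrightarrow> coeff (pcompose (dehom f i) [:y0, 1:]) j = 0"
  shows False
proof -
  let ?e1 = "vector [1, 0, 0] :: complex^3" and ?e2 = "vector [0, 1, 0] :: complex^3" and ?e3 = "vector [0, y0, 1] :: complex^3"
  have comb: "x *s ?e1 + y *s ?e2 + z *s ?e3 = vector [x, y + y0 * z, z]" for x y z
    by (simp add: vec_eq_iff forall_3)
  have span: "vec.span {?e1, ?e2, ?e3} = UNIV"
    unfolding span3_eq_UNIV_iff comb
  proof
    fix w :: "complex^3"
    have "w = vector [w $ 1, (w $ 2 - y0 * w $ 3) + y0 * w $ 3, w $ 3]" by (simp add: vec_eq_iff forall_3)
    then show "\<exists>x y z. w = vector [x, y + y0 * z, z]" by blast
  qed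
  obtain f' where f': "squarefree f'" "homogeneous 5 f'"
    "\<And>x y z. eval3 f' (vector [x, y, z]) = eval3 f (x *s ?e1 + y *s ?e2 + z *s ?e3)"
    using change_of_basis[OF span assms(2,1)] by blast
  note f'(3)[unfolded comb]
  note f' = f'(1,2) this
  have "dehom f' i = pcompose (dehom f i) [:y0, 1:]" if i: "i \<le> 5" for i
  proof (rule poly_eqI_poly)
    fix y
    have "poly (\<Sum>i\<le>5. monom (poly (dehom f' i) y) i) x = poly (\<Sum>i\<le>5. monom (poly (dehom f i) (y + y0)) i) x" for x
      using f'(3)[of x y 1] by (simp add: poly_sum poly_monom eval3_dehom[OF f'(2)] eval3_dehom[OF assms(1)])
    then have "(\<Sum>i\<le>5. monom (poly (dehom f' i) y) i) = (\<Sum>i\<le>5. monom (poly (dehom f i) (y + y0)) i)"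
      by (intro poly_eqI_poly)
    then have "coeff (\<Sum>i\<le>5. monom (poly (dehom f' i) y) i) i = coeff (\<Sum>i\<le>5. monom (poly (dehom f i) (y + y0)) i) i"
      by simp
    then show "poly (dehom f' i) y = poly (pcompose (dehom f i) [:y0, 1:]) y"
      using i by (simp add: coeff_sum_monom poly_pcompose add.commute)
  qed
  then have "coeff (dehom f' i) j = 0" if "j < 2" for i j
    using dbl[OF that, of i] by (cases "i \<le> 5") (auto simp: coeff_dehom)
  then show False using not_squarefree_if_y_square[OF f'(2)] f'(1) by blast
qed

text \<open>The degenerate point is moved to the origin in both coordinates. The square
  \<open>(\<alpha> * H + \<beta>)\<^sup>2\<close> of the quadratic expansion then has vanishing
  discriminant, the input of \<open>disc3_triple_root\<close>.\<close>

lemma degenerate_vertical: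
  assumes "homogeneous 5 f" "degenerate f (vector [x0, y0, 1])" "dehom f 4 = 0" "dehom f 5 = 0"
  defines "A i \<equiv> pcompose (dehom f i) [:y0, 1:]"
  defines "b \<equiv> A 2 + 3 * A 3 * [:x0:]"
    and "c \<equiv> A 1 + 2 * A 2 * [:x0:] + 3 * A 3 * [:x0:]\<^sup>2"
    and "d \<equiv> A 0 + A 1 * [:x0:] + A 2 * [:x0:]\<^sup>2 + A 3 * [:x0:] ^ 3"
  shows "coeff d 0 = 0" "coeff d 1 = 0" "coeff c 0 = 0" "(coeff c 1)\<^sup>2 = 4 * coeff b 0 * coeff d 2"
proof -
  obtain L :: "complex^3" where L: "\<And>w. ((\<lambda>t. eval3 f (vector [x0, y0, 1] + t *s w) / t\<^sup>2) \<longlongrightarrow> (L $ 1 * w $ 1 + L $ 2 * w $ 2 + L $ 3 * w $ 3)\<^sup>2) (at 0)"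
    using assms(2) unfolding degenerate_def by blast
  define p where "p i = (if i = 0 then d else if i = 1 then c else if i = 2 then b else if i = 3 then A 3 else 0)" for i :: nat
  have "((\<lambda>t. (\<Sum>i\<le>5. poly (p i) t * (t * H) ^ i) / t\<^sup>2) \<longlongrightarrow> (L $ 1 * H + L $ 2)\<^sup>2) (at 0)" for H
  proof -
    have "eval3 f (vector [x0, y0, 1] + t *s vector [H, 1, 0]) = (\<Sum>i\<le>5. poly (p i) t * (t * H) ^ i)" for t
    proof -
      have "vector [x0, y0, 1] + t *s vector [H, 1, 0] = (vector [x0 + t * H, y0 + t, 1] :: complex^3)"
        by (simp add: vec_eq_iff forall_3)
      then have "eval3 f (vector [x0, y0, 1] + t *s vector [H, 1, 0]) = (\<Sum>i\<le>5. poly (A i) t * (x0 + t * H) ^ i)"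
        by (simp add: eval3_dehom[OF assms(1)] A_def poly_pcompose mult.commute)
      also have "\<dots> = poly (A 0) t + poly (A 1) t * (x0 + t * H) + poly (A 2) t * (x0 + t * H)\<^sup>2 + poly (A 3) t * (x0 + t * H) ^ 3"
        using assms(3,4) by (simp add: atMost_5 A_def)
      also have "\<dots> = (\<Sum>i\<le>5. poly (p i) t * (t * H) ^ i)"
        by (simp add: atMost_5 p_def b_def c_def d_def power2_eq_square power3_eq_cube algebra_simps)
      finally show ?thesis .
    qed
    then show ?thesis using L[of "vector [H, 1, 0]"] by simp
  qed
  note Q = quadratic_expansion[of p "L $ 1" "L $ 2", OF this]
  show "coeff d 0 = 0" "coeff d 1 = 0" "coeff c 0 = 0" "(coeff c 1)\<^sup>2 = 4 * coeff b 0 * coeff d 2"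
    using Q by (simp_all add: p_def power_mult_distrib)
qed

text \<open>\<open>C 0\<close> is the restriction to a line and \<open>C 1\<close> the first-order
  term across it. If \<open>C 0 = 0\<close>, the square term along the line vanishes, hence the
  linear form does, and with it the mixed term: that is the double root of
  \<open>C 1\<close>.\<close>

lemma degenerate_horizontal:
  fixes f :: poly3
  assumes "degenerate f v" "\<And>t K. eval3 f (v + t *s (w1 + K *s w2)) = (\<Sum>j\<le>5. poly (C j) (x0 + t) * (t * K) ^ j)"
  shows "[:- x0, 1:]\<^sup>2 dvd C 0" "C 0 = 0 \<Longrightarrow> [:- x0, 1:]\<^sup>2 dvd C 1"
proof -
  obtain L :: "complex^3" where L: "\<And>w. ((\<lambda>t. eval3 f (v + t *s w) / t\<^sup>2) \<longlongrightarrow> (L $ 1 * w $ 1 + L $ 2 * w $ 2 + L $ 3 * w $ 3)\<^sup>2) (at 0)"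
    using assms(1) unfolding degenerate_def by blast
  define l where "l w = L $ 1 * w $ 1 + L $ 2 * w $ 2 + L $ 3 * w $ 3" for w :: "complex^3"
  define p where "p j = pcompose (C j) [:x0, 1:]" for j
  have "((\<lambda>t. (\<Sum>i\<le>5. poly (p i) t * (t * K) ^ i) / t\<^sup>2) \<longlongrightarrow> (l w2 * K + l w1)\<^sup>2) (at 0)" for K
  proof -
    have lw: "l (w1 + K *s w2) = l w2 * K + l w1" by (simp add: l_def algebra_simps)
    have e: "(\<Sum>i\<le>5. poly (p i) t * (t * K) ^ i) = eval3 f (v + t *s (w1 + K *s w2))" for t
      unfolding assms(2) by (simp add: p_def poly_pcompose)
    show ?thesis unfolding e lw[symmetric] unfolding l_def by (rule L)
  qed
  note Q = quadratic_expansion[of p "l w2" "l w1", OF this]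
  have "monom 1 2 dvd p 0" unfolding monom_1_dvd_iff' using Q(1,2) by (auto simp: less_2_cases_iff)
  then show "[:- x0, 1:]\<^sup>2 dvd C 0" unfolding p_def by (rule shift_dvd)
  assume "C 0 = 0"
  then have "l w1 = 0" using Q(3) by (simp add: p_def)
  then have "monom 1 2 dvd p 1" unfolding monom_1_dvd_iff' using Q(4,5) by (auto simp: less_2_cases_iff)
  then show "[:- x0, 1:]\<^sup>2 dvd C 1" unfolding p_def by (rule shift_dvd)
qed

text \<open>By Bezout the line \<open>y = y0 z\<close> is a component of the curve; degeneracy bounds the remaining
  component in the same way, so the line is a double component.\<close>

lemma too_many_on_line:
  assumes f: "homogeneous 5 f" "squarefree f" and "finite S" "\<And>x. x \<in> S \<Longrightarrow> degenerate f (vector [x, y0, 1])"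
    and "\<And>i. i > r \<Longrightarrow> dehom f i = 0" "r < 2 * card S"
  shows False
proof -
  \<comment> \<open>\<open>C j\<close> is the coefficient of the \<open>j\<close>-th power of
    \<open>y - y0\<close>, as a polynomial in \<open>x\<close>.\<close>
  define C where "C j = (\<Sum>i\<le>5. monom (coeff (pcompose (dehom f i) [:y0, 1:]) j) i)" for j
  have cC: "coeff (C j) i = (if i \<le> 5 then coeff (pcompose (dehom f i) [:y0, 1:]) j else 0)" for i j
    by (simp add: C_def coeff_sum_monom)
  have deg: "degree (C j) < 2 * card S" for j
  proof -
    have "degree (C j) \<le> r" by (rule degree_le) (auto simp: cC assms(5))
    then show ?thesis using assms(6) by simp
  qed
  have exp: "eval3 f (vector [x, y0, 1] + t *s (vector [1, 0, 0] + K *s vector [0, 1, 0])) = (\<Sum>j\<le>5. poly (C j) (x + t) * (t * K) ^ j)" for x t K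
  proof -
    have "vector [x, y0, 1] + t *s (vector [1, 0, 0] + K *s vector [0, 1, 0]) = (vector [x + t, y0 + t * K, 1] :: complex^3)"
      by (simp add: vec_eq_iff forall_3)
    then have "eval3 f (vector [x, y0, 1] + t *s (vector [1, 0, 0] + K *s vector [0, 1, 0])) = (\<Sum>i\<le>5. poly (pcompose (dehom f i) [:y0, 1:]) (t * K) * (x + t) ^ i)"
      by (simp add: eval3_dehom[OF f(1)] poly_pcompose mult.commute)
    also have "\<dots> = (\<Sum>i\<le>5. (\<Sum>j\<le>5. coeff (pcompose (dehom f i) [:y0, 1:]) j * (t * K) ^ j) * (x + t) ^ i)"
    proof -
      have "degree (pcompose (dehom f i) [:y0, 1:]) \<le> 5" for i
        using degree_dehom[of f i] by (simp add: degree_pcompose)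
      then show ?thesis by (simp add: poly_eq_sum_atMost[where D = 5])
    qed
    also have "\<dots> = (\<Sum>i\<le>5. \<Sum>j\<le>5. coeff (pcompose (dehom f i) [:y0, 1:]) j * (x + t) ^ i * (t * K) ^ j)"
      unfolding sum_distrib_right by (simp only: mult_ac)
    also have "\<dots> = (\<Sum>j\<le>5. \<Sum>i\<le>5. coeff (pcompose (dehom f i) [:y0, 1:]) j * (x + t) ^ i * (t * K) ^ j)"
      by (rule sum.swap)
    also have "\<dots> = (\<Sum>j\<le>5. poly (C j) (x + t) * (t * K) ^ j)"
      by (simp add: C_def poly_sum poly_monom sum_distrib_right)
    finally show ?thesis .
  qed
  have C0: "C 0 = 0"
    by (rule root_count[OF assms(3) _ deg]) (rule degenerate_horizontal(1)[OF assms(4) exp])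
  have C1: "C 1 = 0"
    by (rule root_count[OF assms(3) _ deg]) (rule degenerate_horizontal(2)[OF assms(4) exp C0])
  have "coeff (pcompose (dehom f i) [:y0, 1:]) j = 0" if "j < 2" for i j
  proof (cases "i \<le> 5")
    case True
    then show ?thesis using C0 C1 cC[of 0 i] cC[of 1 i] that by (auto simp: less_2_cases_iff)
  next
    case False
    then have "dehom f i = 0" by (auto simp: poly_eq_iff coeff_dehom)
    then show ?thesis by simp
  qed
  then show False by (rule dehom_shift_not_all_double[OF f])
qed

lemma points_on_distinct_lines:
  assumes f: "homogeneous 5 f" "squarefree f" and T: "\<And>x y. (x, y) \<in> T \<Longrightarrow> degenerate f (vector [x, y, 1])"
    and r: "r < 4" "\<And>i. i > r \<Longrightarrow> dehom f i = 0"
  shows "inj_on snd T"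
proof (rule inj_onI)
  fix s s' assume s: "s \<in> T" "s' \<in> T" "snd s = snd s'"
  show "s = s'"
  proof (rule ccontr)
    assume "s \<noteq> s'"
    then have ne: "fst s \<noteq> fst s'" using s(3) by (simp add: prod_eq_iff)
    show False
    proof (rule too_many_on_line[OF f, of "{fst s, fst s'}" "snd s" r])
      show "degenerate f (vector [x, snd s, 1])" if "x \<in> {fst s, fst s'}" for x
        using that T s by (metis empty_iff insert_iff prod.collapse)
    qed (use ne r in auto)
  qed
qed

lemma coeff_eq_0_iff_dehom:
  assumes "homogeneous 5 f"
  shows "dehom f i = 0 \<Longrightarrow> coeff f i = 0" "coeff f i = 0 \<Longrightarrow> dehom f i = 0"
proof -
  show "coeff f i = 0" if "dehom f i = 0"
  proof (cases "i \<le> 5")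
    case True
    then show ?thesis using that by (intro poly2_eq_0I) (simp add: eval_coeff[OF assms])
  next
    case False
    then show ?thesis using homogeneous_degrees(1)[OF assms] by (simp add: coeff_eq_0)
  qed
  show "dehom f i = 0" if "coeff f i = 0"
    using that by (auto simp: poly_eq_iff coeff_dehom coeff3_def)
qed

lemma no_triple_point_configuration:
  assumes f: "homogeneous 5 f" "squarefree f"
    and T: "finite T" "card T = 4" "\<And>x y. (x, y) \<in> T \<Longrightarrow> degenerate f (vector [x, y, 1])"
    and z: "dehom f 3 = 0" "dehom f 4 = 0" "dehom f 5 = 0"
  shows False
proof -
  have z6: "dehom f i = 0" if i: "i > 2" for i
  proof -
    consider "i = 3" | "i = 4" | "i = 5" | "i > 5" using i by linarith
    then show ?thesis by cases (use z in \<open>auto simp: poly_eq_iff coeff_dehom\<close>)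
  qed
  show False
  \<comment> \<open>If the degree in \<open>x\<close> drops to 1, a single degenerate point already
    forces a double line, because \<open>1 < 2 * 1\<close>.\<close>
  proof (cases "dehom f 2 = 0")
    case True
    have "T \<noteq> {}" using T(2) by auto
    then obtain x y where xy: "(x, y) \<in> T" by auto
    show False
    proof (rule too_many_on_line[OF f, of "{x}" y 1])
      show "dehom f i = 0" if "i > 1" for i using z6[of i] True that by (cases "i = 2") auto
    qed (use T(3)[OF xy] in auto)
  next
    case False
    have inj: "inj_on snd T" by (rule points_on_distinct_lines[OF f T(3), where r = 2]) (use z6 in auto)
    define D where "D = (dehom f 1)\<^sup>2 - 4 * dehom f 2 * dehom f 0"
    have "D = 0"
    proof (rule root_count[where S = "snd ` T" and n = 3])
      have "degree ((dehom f 1)\<^sup>2) \<le> 8"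
        using degree_power_le[of "dehom f 1" 2] degree_dehom[of f 1] by simp
      moreover have "degree (4 * dehom f 2 * dehom f 0) \<le> 8"
      proof -
        have "degree (4 * dehom f 2 * dehom f 0) \<le> degree (4 * dehom f 2) + degree (dehom f 0)" by (rule degree_mult_le)
        also have "degree (4 * dehom f 2) \<le> 0 + degree (dehom f 2)"
          using degree_mult_le[of 4 "dehom f 2"] by simp
        finally show ?thesis using degree_dehom[of f 2] degree_dehom[of f 0] by simp
      qed
      ultimately have "degree D \<le> 8" unfolding D_def by (rule degree_diff_le)
      then show "degree D < 3 * card (snd ` T)" using inj T(2) by (simp add: card_image)
    next
      fix y assume "y \<in> snd ` T"
      then obtain x where xy: "(x, y) \<in> T" by force
      let ?A = "\<lambda>i. pcompose (dehom f i) [:y, 1:]"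
      note dv = degenerate_vertical[OF f(1) T(3)[OF xy] z(2,3)]
      have "monom 1 3 dvd (?A 1 + 2 * ?A 2 * [:x:] + 3 * ?A 3 * [:x:]\<^sup>2)\<^sup>2 -
         4 * (?A 2 + 3 * ?A 3 * [:x:]) * (?A 0 + ?A 1 * [:x:] + ?A 2 * [:x:]\<^sup>2 + ?A 3 * [:x:] ^ 3)"
        by (rule disc3_triple_root(2)[OF dv])
      also have "\<dots> = pcompose D [:y, 1:]"
      proof -
        have "?A 3 = 0" using z by simp
        moreover have "pcompose D [:y, 1:] = (?A 1)\<^sup>2 - 4 * ?A 2 * ?A 0"
          by (simp add: D_def pcompose_diff pcompose_mult power2_eq_square pcompose_numeral)
        ultimately show ?thesis by (simp add: power2_eq_square algebra_simps)
      qed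
      finally show "[:- y, 1:] ^ 3 dvd D" by (rule shift_dvd)
    qed (use T(1) in auto)
    have "(coeff f 1)\<^sup>2 - 4 * coeff f 2 * coeff f 0 = 0"
    proof (rule poly2_eq_0I)
      fix y z :: complex assume z: "z \<noteq> 0"
      have "poly (poly ((coeff f 1)\<^sup>2 - 4 * coeff f 2 * coeff f 0) [:y:]) z = z ^ 8 * poly D (y / z)"
        by (simp add: eval_coeff[OF f(1) z] D_def power_mult_distrib algebra_simps eval_nat_numeral)
      then show "poly (poly ((coeff f 1)\<^sup>2 - 4 * coeff f 2 * coeff f 0) [:y:]) z = 0" using \<open>D = 0\<close> by simp
    qed
    moreover have "coeff f 2 \<noteq> 0" using False coeff_eq_0_iff_dehom(2)[OF f(1)] by blast
    moreover have "f = [:coeff f 0, coeff f 1, coeff f 2:]"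
    proof (rule poly_eqI)
      fix n :: nat
      consider "n = 0" | "n = 1" | "n = 2" | "n > 2" by linarith
      then show "coeff f n = coeff [:coeff f 0, coeff f 1, coeff f 2:] n"
      proof cases
        case 4
        then show ?thesis using coeff_eq_0_iff_dehom(1)[OF f(1) z6[OF 4]] by (simp add: coeff_pCons split: nat.split)
      qed (simp_all add: numeral_2_eq_2)
    qed
    ultimately show False using quadratic_square_dvd f(2) by metis
  qed
qed

text \<open>The coefficient of \<open>x ^ i\<close> in the quintic is a form of degree
  \<open>5 - i\<close>; with these weights 2, 3, 4, 5 every term of the discriminant has weight
  14.\<close>

lemma disc3_weighted:
  fixes w :: complex
  shows "disc3 (w\<^sup>2 * a) (w ^ 3 * b) (w ^ 4 * c) (w ^ 5 * d) = w ^ 14 * disc3 a b c d"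
proof -
  have e: "(w ^ 3)\<^sup>2 * (w ^ 4)\<^sup>2 = w ^ 14" "w\<^sup>2 * (w ^ 4) ^ 3 = w ^ 14" "(w ^ 3) ^ 3 * w ^ 5 = w ^ 14"
    "(w\<^sup>2)\<^sup>2 * (w ^ 5)\<^sup>2 = w ^ 14" "w\<^sup>2 * w ^ 3 * w ^ 4 * w ^ 5 = w ^ 14"
    by (simp_all flip: power_mult power_add)
  have "disc3 (w\<^sup>2 * a) (w ^ 3 * b) (w ^ 4 * c) (w ^ 5 * d) =
     ((w ^ 3)\<^sup>2 * (w ^ 4)\<^sup>2) * (b\<^sup>2 * c\<^sup>2) - 4 * (w\<^sup>2 * (w ^ 4) ^ 3) * (a * c ^ 3) - 4 * ((w ^ 3) ^ 3 * w ^ 5) * (b ^ 3 * d)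
     - 27 * ((w\<^sup>2)\<^sup>2 * (w ^ 5)\<^sup>2) * (a\<^sup>2 * d\<^sup>2) + 18 * (w\<^sup>2 * w ^ 3 * w ^ 4 * w ^ 5) * (a * b * c * d)"
    by (simp only: disc3_def power_mult_distrib mult_ac)
  then show ?thesis unfolding e by (simp add: disc3_def algebra_simps)
qed

text \<open>The discriminant has degree 14 as a form, so this is a root of multiplicity three at infinity: the
  projection of the tangent at the double point.\<close>

lemma degree_disc3_tangent:
  fixes b c d :: "complex poly"
  assumes "degree b \<le> 2" "degree c \<le> 4" "degree d \<le> 5" "(coeff b 2)\<^sup>2 = 4 * \<kappa> * coeff c 4"
  shows "degree (disc3 [:\<kappa>:] b c d) \<le> 11"
proof -
  have c0: "coeff b n = 0" if "n > 2" for n using assms(1) that by (simp add: coeff_eq_0)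
  have c1: "coeff c n = 0" if "n > 4" for n using assms(2) that by (simp add: coeff_eq_0)
  \<comment> \<open>The terms \<open>b\<^sup>2 * c\<^sup>2\<close> and
    \<open>4 * \<kappa> * c ^ 3\<close> are the ones that may reach degree 12. Together they are
    \<open>c\<^sup>2 * e\<close>, and the hypothesis lowers the degree of \<open>e\<close> from 4 to
    3.\<close>
  define e where "e = b\<^sup>2 - smult (4 * \<kappa>) c"
  have e: "degree e \<le> 3"
  proof (rule degree_le, intro allI impI)
    fix n :: nat assume n: "3 < n"
    have b2: "coeff (b\<^sup>2) n = (\<Sum>i\<le>n. coeff b i * coeff b (n - i))" by (simp add: power2_eq_square coeff_mult)
    show "coeff e n = 0"
    proof (cases "n = 4")
      case True
      have "{..4::nat} = {0, 1, 2, 3, 4}" by auto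
      then have "coeff (b\<^sup>2) 4 = (coeff b 2)\<^sup>2" using b2 by (simp add: True c0 power2_eq_square)
      then show ?thesis using assms(4) by (simp add: e_def True)
    next
      case False
      have "coeff b i * coeff b (n - i) = 0" for i
        using c0[of i] c0[of "n - i"] n False by (cases "i > 2") auto
      then have "coeff (b\<^sup>2) n = 0" unfolding b2 by (intro sum.neutral ballI)
      then show ?thesis using c1[of n] n False by (simp add: e_def)
    qed
  qed
  have eq: "disc3 [:\<kappa>:] b c d = c * c * e - smult 4 (b * b * b * d) - smult (27 * \<kappa>\<^sup>2) (d * d) + smult (18 * \<kappa>) (b * c * d)"
  proof -
    have s: "smult k p = [:k:] * p" for k and p :: "complex poly" by simp
    have n: "numeral m = [:numeral m:]" for m :: num by (simp add: numeral_poly)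
    show ?thesis
      unfolding disc3_def e_def n s power2_eq_square power3_eq_cube by (simp add: algebra_simps)
  qed
  have m: "degree (p * q) \<le> i + j" if "degree p \<le> i" "degree q \<le> j" for p q :: "complex poly" and i j
    using degree_mult_le[of p q] that by linarith
  have "degree (c * c * e) \<le> 4 + 4 + 3" by (intro m assms e)
  moreover have "degree (smult 4 (b * b * b * d)) \<le> 2 + 2 + 2 + 5"
    by (intro order_trans[OF degree_smult_le] m assms)
  moreover have "degree (smult (27 * \<kappa>\<^sup>2) (d * d)) \<le> 5 + 5"
    by (intro order_trans[OF degree_smult_le] m assms)
  moreover have "degree (smult (18 * \<kappa>) (b * c * d)) \<le> 2 + 4 + 5"
    by (intro order_trans[OF degree_smult_le] m assms)
  ultimately show ?thesis unfolding eq
    by (intro degree_add_le degree_diff_le) simp_all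
qed

text \<open>The triple root at infinity appears as a drop of the degree from 14 to 11, so the count
  for the four finite triple roots reads \<open>12 > 11\<close>.\<close>

lemma no_double_point_configuration:
  assumes f: "homogeneous 5 f" "squarefree f"
    and T: "finite T" "card T = 4" "\<And>x y. (x, y) \<in> T \<Longrightarrow> degenerate f (vector [x, y, 1])"
    and z: "dehom f 4 = 0" "dehom f 5 = 0"
    and q: "dehom f 3 = [:\<kappa>:]" "\<kappa> \<noteq> 0" "degree (dehom f 2) \<le> 2" "(coeff (dehom f 2) 2)\<^sup>2 = 4 * \<kappa> * coeff (dehom f 1) 4"
  shows False
proof -
  have z6: "dehom f i = 0" if i: "i > 3" for i
  proof -
    consider "i = 4" | "i = 5" | "i > 5" using i by linarith
    then show ?thesis by cases (use z in \<open>auto simp: poly_eq_iff coeff_dehom\<close>)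
  qed
  have inj: "inj_on snd T" by (rule points_on_distinct_lines[OF f T(3), where r = 3]) (use z6 in auto)
  define D where "D = disc3 (dehom f 3) (dehom f 2) (dehom f 1) (dehom f 0)"
  have "D = 0"
  proof (rule root_count[where S = "snd ` T" and n = 3])
    have "degree D \<le> 11"
      unfolding D_def q(1) using degree_dehom[of f 1] degree_dehom[of f 0] q
      by (intro degree_disc3_tangent) auto
    then show "degree D < 3 * card (snd ` T)" using inj T(2) by (simp add: card_image)
  next
    fix y assume "y \<in> snd ` T"
    then obtain x where xy: "(x, y) \<in> T" by force
    let ?A = "\<lambda>i. pcompose (dehom f i) [:y, 1:]"
    note dv = degenerate_vertical[OF f(1) T(3)[OF xy] z]
    have "monom 1 3 dvd disc3 (?A 3) (?A 2 + 3 * ?A 3 * [:x:]) (?A 1 + 2 * ?A 2 * [:x:] + 3 * ?A 3 * [:x:]\<^sup>2)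
       (?A 0 + ?A 1 * [:x:] + ?A 2 * [:x:]\<^sup>2 + ?A 3 * [:x:] ^ 3)"
      by (rule disc3_triple_root(1)[OF dv])
    also have "\<dots> = pcompose D [:y, 1:]"
      unfolding disc3_shift
      by (simp add: D_def disc3_def pcompose_diff pcompose_add pcompose_mult power2_eq_square power3_eq_cube pcompose_numeral)
    finally show "[:- y, 1:] ^ 3 dvd D" by (rule shift_dvd)
  qed (use T(1) in auto)
  have "disc3 (coeff f 3) (coeff f 2) (coeff f 1) (coeff f 0) = 0"
  proof (rule poly2_eq_0I)
    fix y z :: complex assume z: "z \<noteq> 0"
    have p2: "poly (poly (disc3 a b c d) [:y:]) z = disc3 (poly (poly a [:y:]) z) (poly (poly b [:y:]) z)
       (poly (poly c [:y:]) z) (poly (poly d [:y:]) z)" for a b c d :: "complex poly poly"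
      by (simp add: disc3_def)
    have p1: "poly (disc3 a b c d) x = disc3 (poly a x) (poly b x) (poly c x) (poly d x)" for a b c d :: "complex poly" and x
      by (simp add: disc3_def)
    have "poly (poly (disc3 (coeff f 3) (coeff f 2) (coeff f 1) (coeff f 0)) [:y:]) z = z ^ 14 * poly D (y / z)"
      unfolding p2 D_def p1 disc3_weighted[symmetric] by (simp add: eval_coeff[OF f(1) z])
    then show "poly (poly (disc3 (coeff f 3) (coeff f 2) (coeff f 1) (coeff f 0)) [:y:]) z = 0" using \<open>D = 0\<close> by simp
  qed
  moreover have "coeff f 3 \<noteq> 0" using q(1,2) coeff_eq_0_iff_dehom(2)[OF f(1), of 3] by auto
  moreover have "f = [:coeff f 0, coeff f 1, coeff f 2, coeff f 3:]"
  proof (rule poly_eqI)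
    fix n :: nat
    consider "n = 0" | "n = 1" | "n = 2" | "n = 3" | "n > 3" by linarith
    then show "coeff f n = coeff [:coeff f 0, coeff f 1, coeff f 2, coeff f 3:] n"
    proof cases
      case 5
      then show ?thesis using coeff_eq_0_iff_dehom(1)[OF f(1) z6[OF 5]] by (simp add: coeff_pCons split: nat.split)
    qed (simp_all add: numeral_2_eq_2 numeral_3_eq_3)
  qed
  ultimately show False using cubic_square_dvd f(2) by metis
qed

text \<open>The tangent \<open>z = 0\<close> meets the curve at least four times at the centre, so
  the restriction to it is linear in \<open>x\<close>. A degenerate point gives it a double root, so
  it vanishes. The tacnode identity then kills \<open>chart_coeff f 2 1\<close>, the first-order
  term across the line becomes linear too, and the same argument makes the line a double
  component.\<close>

lemma no_point_on_tangent:
  assumes f: "homogeneous 5 f" "squarefree f" and x0: "degenerate f (vector [x0, 1, 0])"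
    and c: "chart_coeff f 0 0 = 0" "chart_coeff f 1 0 = 0" "chart_coeff f 0 1 = 0" "chart_coeff f 2 0 = 0" "chart_coeff f 1 1 = 0"
      "chart_coeff f 3 0 = 0" "(chart_coeff f 2 1)\<^sup>2 = 4 * chart_coeff f 4 0 * chart_coeff f 0 2"
  shows False
proof -
  define C where "C k = (\<Sum>j\<le>5. monom (chart_coeff f j k) (5 - j - k))" for k
  have exp: "eval3 f (vector [x0, 1, 0] + t *s (vector [1, 0, 0] + K *s vector [0, 0, 1])) = (\<Sum>j\<le>5. poly (C j) (x0 + t) * (t * K) ^ j)" for t K
  proof -
    have "vector [x0, 1, 0] + t *s (vector [1, 0, 0] + K *s vector [0, 0, 1]) = (vector [x0 + t, 1, t * K] :: complex^3)"
      by (simp add: vec_eq_iff forall_3)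
    then have "eval3 f (vector [x0, 1, 0] + t *s (vector [1, 0, 0] + K *s vector [0, 0, 1])) =
        (\<Sum>j\<le>5. \<Sum>k\<le>5. chart_coeff f j k * (x0 + t) ^ (5 - j - k) * (t * K) ^ k)"
      by (simp add: eval3_chart_coeff[OF f(1)])
    also have "\<dots> = (\<Sum>k\<le>5. \<Sum>j\<le>5. chart_coeff f j k * (x0 + t) ^ (5 - j - k) * (t * K) ^ k)"
      by (rule sum.swap)
    also have "\<dots> = (\<Sum>j\<le>5. poly (C j) (x0 + t) * (t * K) ^ j)"
      by (simp add: C_def poly_sum poly_monom sum_distrib_right)
    finally show ?thesis .
  qed
  have c51: "chart_coeff f 5 1 = 0" by (simp add: chart_coeff_def)
  have C0: "C 0 = [:chart_coeff f 5 0, chart_coeff f 4 0:]"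
    using c by (simp add: C_def atMost_5 monom_altdef)
  have "C 0 = 0"
  proof (rule root_count[where S = "{x0}" and n = 2])
    show "[:- x, 1:]\<^sup>2 dvd C 0" if "x \<in> {x0}" for x
      using degenerate_horizontal(1)[OF x0 exp] that by simp
  qed (auto simp: C0)
  then have c0: "chart_coeff f 5 0 = 0" "chart_coeff f 4 0 = 0" using C0 by simp_all
  then have c21: "chart_coeff f 2 1 = 0" using c(7) by simp
  have C1: "C 1 = [:chart_coeff f 4 1, chart_coeff f 3 1:]"
    using c c21 c51 by (simp add: C_def atMost_5 monom_altdef)
  have "C 1 = 0"
  proof (rule root_count[where S = "{x0}" and n = 2])
    show "[:- x, 1:]\<^sup>2 dvd C 1" if "x \<in> {x0}" for x
      using degenerate_horizontal(2)[OF x0 exp \<open>C 0 = 0\<close>] that by simp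
  qed (use C1 in auto)
  then have c1: "chart_coeff f 4 1 = 0" "chart_coeff f 3 1 = 0" using C1 by simp_all
  have cz: "chart_coeff f j k = 0" if "k < 2" "j \<le> 5" for j k
  proof -
    have "j \<in> {0, 1, 2, 3, 4, 5}" using that(2) atMost_5 by blast
    then show ?thesis using that(1) c c0 c1 c21 c51 by (auto simp: less_2_cases_iff)
  qed
  have "coeff3 f i j k = 0" if "k < 2" for i j k
  proof (rule ccontr)
    assume nz: "coeff3 f i j k \<noteq> 0"
    then have s: "i + j + k = 5" using homogeneous_coeff3[OF f(1)] by blast
    then have "chart_coeff f j k = coeff3 f i j k" by (auto simp: chart_coeff_def intro!: arg_cong[where f = "\<lambda>i. coeff3 f i j k"])
    then show False using cz[OF that, of j] nz s by simp
  qed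
  then show False using not_squarefree_if_z_square f(2) by blast
qed

lemma span_shear:
  fixes v a b :: "complex^3"
  assumes "vec.span {v, a, b} = UNIV"
  shows "vec.span {v, a + l *s b, b} = UNIV"
  unfolding span3_eq_UNIV_iff
proof
  fix w
  obtain x y z where "w = x *s v + y *s a + z *s b" using assms unfolding span3_eq_UNIV_iff by blast
  then have "w = x *s v + y *s (a + l *s b) + (z - l * y) *s b" by (simp add: vec_eq_iff algebra_simps)
  then show "\<exists>x y z. w = x *s v + y *s (a + l *s b) + z *s b" by blast
qed

lemma span_singleton_scale:
  fixes v :: "complex^3"
  assumes "c \<noteq> 0"
  shows "vec.span {c *s v} = vec.span {v}"
proof -
  have "range (\<lambda>k. k *s (c *s v)) = range (\<lambda>k. k *s v)"
  proof (intro equalityI subsetI)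
    fix w assume "w \<in> range (\<lambda>k. k *s v)"
    then obtain k where "w = k *s v" by blast
    then have "w = (k / c) *s (c *s v)" using assms by (simp add: vec_eq_iff)
    then show "w \<in> range (\<lambda>k. k *s (c *s v))" by blast
  qed auto
  then show ?thesis by (simp only: vec.span_singleton)
qed

lemma normalized_points:
  assumes f: "homogeneous 5 f" and span: "vec.span {v, a, b} = UNIV"
    and f': "\<And>x y z. eval3 f' (vector [x, y, z]) = eval3 f (x *s v + y *s a + z *s b)"
    and P: "finite P" "\<And>p. p \<in> P \<Longrightarrow> \<exists>x y z. z \<noteq> 0 \<and> p = vec.span {x *s v + y *s a + z *s b} \<and> degenerate f (x *s v + y *s a + z *s b)"
  obtains T where "finite T" "card T = card P" "\<And>x y. (x, y) \<in> T \<Longrightarrow> degenerate f' (vector [x, y, 1])"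
proof -
  have "\<exists>x y. p = vec.span {x *s v + y *s a + 1 *s b} \<and> degenerate f' (vector [x, y, 1])" if p: "p \<in> P" for p
  proof -
    obtain x y z where xyz: "z \<noteq> 0" "p = vec.span {x *s v + y *s a + z *s b}" "degenerate f (x *s v + y *s a + z *s b)"
      using P(2)[OF p] by blast
    have s: "(x / z) *s v + (y / z) *s a + 1 *s b = (1 / z) *s (x *s v + y *s a + z *s b)"
      using xyz(1) by (simp add: vec_eq_iff field_simps)
    have "degenerate f ((x / z) *s v + (y / z) *s a + 1 *s b)"
      unfolding s using xyz(1) by (intro degenerate_scale[OF xyz(3) f]) simp
    then have "degenerate f' (vector [x / z, y / z, 1])" by (rule degenerate_change_of_basis[OF _ f'])
    moreover have "p = vec.span {(x / z) *s v + (y / z) *s a + 1 *s b}"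
      unfolding s xyz(2) using xyz(1) by (intro span_singleton_scale[symmetric]) simp
    ultimately show ?thesis by blast
  qed
  then obtain X Y where XY: "\<And>p. p \<in> P \<Longrightarrow> p = vec.span {X p *s v + Y p *s a + 1 *s b}"
    "\<And>p. p \<in> P \<Longrightarrow> degenerate f' (vector [X p, Y p, 1])" by metis
  \<comment> \<open>A point of the projective plane is recovered from its affine coordinates, so no
    points are lost.\<close>
  have "inj_on (\<lambda>p. (X p, Y p)) P"
    by (rule inj_onI) (metis XY(1) prod.inject)
  then have "card ((\<lambda>p. (X p, Y p)) ` P) = card P" by (rule card_image)
  then show ?thesis using that[of "(\<lambda>p. (X p, Y p)) ` P"] P(1) XY(2) by auto
qed

lemma dehom_high_zero:
  assumes "chart_coeff f 0 0 = 0" "chart_coeff f 1 0 = 0" "chart_coeff f 0 1 = 0"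
  shows "dehom f 4 = 0" "dehom f 5 = 0"
proof -
  have "coeff (dehom f 5) j = 0" for j using assms by (cases j) (simp_all add: coeff_dehom_chart)
  then show "dehom f 5 = 0" by (simp add: poly_eq_iff)
  have "coeff (dehom f 4) j = 0" for j
  proof -
    consider "j = 0" | "j = 1" | "j > 1" by linarith
    then show ?thesis using assms by cases (simp_all add: coeff_dehom_chart)
  qed
  then show "dehom f 4 = 0" by (simp add: poly_eq_iff)
qed

theorem proposition8p2:
  shows "\<not> (\<exists>f C P q. plane_curve 5 f C \<and>
           P \<subseteq> singular_points f \<and> card P = 4 \<and> (\<forall>p\<in>P. has_link_T2 C p 3) \<and>
           q \<in> singular_points f \<and> q \<notin> P \<and> has_link_T2 C q 5)"
proof
  assume "\<exists>f C P q. plane_curve 5 f C \<and>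
           P \<subseteq> singular_points f \<and> card P = 4 \<and> (\<forall>p\<in>P. has_link_T2 C p 3) \<and>
           q \<in> singular_points f \<and> q \<notin> P \<and> has_link_T2 C q 5"
  then obtain f C P q where C: "plane_curve 5 f C" and P: "P \<subseteq> singular_points f" "card P = 4"
    "\<And>p. p \<in> P \<Longrightarrow> has_link_T2 C p 3" and q: "q \<in> singular_points f" "q \<notin> P" "has_link_T2 C q 5"
    by blast
  have f: "homogeneous 5 f" "squarefree f" using C by (auto simp: plane_curve_def)
  have odd: "odd (3::nat)" "odd (5::nat)" by simp_all
  have finP: "finite P" using P(2) by (metis card.infinite zero_neq_numeral)
  obtain v a b f1 where v: "q = vec.span {v}" "vec.span {v, a, b} = UNIV"
    and f1: "squarefree f1" "homogeneous 5 f1"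
      "\<And>x y z. eval3 f1 (vector [x, y, z]) = eval3 f (x *s v + y *s a + z *s b)"
      "knot_link {p. bipoly (chart_coeff f1) p = 0} 5"
    and c: "chart_coeff f1 0 0 = 0" "chart_coeff f1 1 0 = 0" "chart_coeff f1 0 1 = 0"
      "chart_coeff f1 2 0 = 0" "chart_coeff f1 1 1 = 0"
    by (rule singular_T2_chart[OF C q(1,3) odd(2)]) (rule that)
  have vq: "v \<in> q" unfolding v(1) by (simp add: vec.span_base)
  have Pdeg: "\<exists>x y z. (y \<noteq> 0 \<or> z \<noteq> 0) \<and> p = vec.span {x *s v + y *s a + z *s b} \<and> degenerate f (x *s v + y *s a + z *s b)"
    if p: "p \<in> P" for p
  proof -
    have ps: "p \<in> singular_points f" using P(1) p by blast
    obtain w a' b' f2 where w: "p = vec.span {w}" "vec.span {w, a', b'} = UNIV"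
      and f2: "squarefree f2" "homogeneous 5 f2"
        "\<And>x y z. eval3 f2 (vector [x, y, z]) = eval3 f (x *s w + y *s a' + z *s b')"
        "knot_link {p. bipoly (chart_coeff f2) p = 0} 3"
      and c2: "chart_coeff f2 0 0 = 0" "chart_coeff f2 1 0 = 0" "chart_coeff f2 0 1 = 0"
        "chart_coeff f2 2 0 = 0" "chart_coeff f2 1 1 = 0"
      by (rule singular_T2_chart[OF C ps P(3)[OF p] odd(1)]) (rule that)
    have "degenerate f w" by (rule degenerate_from_chart[OF f2(2) w(2) f2(3) c2])
    obtain x y z where xyz: "w = x *s v + y *s a + z *s b" using v(2) unfolding span3_eq_UNIV_iff by blast
    have "y \<noteq> 0 \<or> z \<noteq> 0"
    proof (rule ccontr)
      assume "\<not> (y \<noteq> 0 \<or> z \<noteq> 0)"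
      then have wx: "w = x *s v" by (simp add: xyz)
      have "x \<noteq> 0" using basis_injective[OF w(2), of 1 0 0] wx by auto
      then have "p = q" unfolding w(1) v(1) wx by (rule span_singleton_scale)
      then show False using p q(2) by simp
    qed
    then show ?thesis using xyz w(1) \<open>degenerate f w\<close> by blast
  qed
  show False
  \<comment> \<open>The other quadratic coefficients vanish already, so this one separates a double
    point from a point of multiplicity at least three.\<close>
  proof (cases "chart_coeff f1 0 2 = 0")
    case False
    have c30: "chart_coeff f1 3 0 = 0" by (rule knot_link_T25_not_cusp[OF f1(4) False c])
    have low: "chart_coeff f1 i j = 0" if "i + 2 * j < 2 * 2" for i j
    proof -
      have "j = 0 \<and> (i = 0 \<or> i = 1 \<or> i = 2 \<or> i = 3) \<or> j = 1 \<and> (i = 0 \<or> i = 1)" using that by presburger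
      then show ?thesis using c c30 by auto
    qed
    \<comment> \<open>With the cubic term gone, the leading form for the weights 1 and 2 has weight
      4: it is made of \<open>s ^ 4\<close>, \<open>s\<^sup>2 * t\<close> and
      \<open>t\<^sup>2\<close>.\<close>
    have tac: "(chart_coeff f1 2 1)\<^sup>2 = 4 * chart_coeff f1 4 0 * chart_coeff f1 0 2"
      using knot_link_not_two_branches[OF f1(4) _ _ False low] by simp
    have "\<exists>x y z. z \<noteq> 0 \<and> p = vec.span {x *s v + y *s a + z *s b} \<and> degenerate f (x *s v + y *s a + z *s b)"
      if p: "p \<in> P" for p
    proof -
      obtain x y z where xyz: "y \<noteq> 0 \<or> z \<noteq> 0" "p = vec.span {x *s v + y *s a + z *s b}" "degenerate f (x *s v + y *s a + z *s b)"
        using Pdeg[OF p] by blast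
      have "z \<noteq> 0"
      proof
        assume z: "z = 0"
        then have y: "y \<noteq> 0" using xyz(1) by simp
        have s: "(x / y) *s v + 1 *s a + 0 *s b = (1 / y) *s (x *s v + y *s a + z *s b)"
          using y z by (simp add: vec_eq_iff field_simps)
        have "degenerate f ((x / y) *s v + 1 *s a + 0 *s b)"
          unfolding s using y by (intro degenerate_scale[OF xyz(3) f(1)]) simp
        then have "degenerate f1 (vector [x / y, 1, 0])" by (rule degenerate_change_of_basis[OF _ f1(3)])
        then show False by (rule no_point_on_tangent[OF f1(2,1) _ c c30 tac])
      qed
      then show ?thesis using xyz by blast
    qed
    then obtain T where T: "finite T" "card T = card P" "\<And>x y. (x, y) \<in> T \<Longrightarrow> degenerate f1 (vector [x, y, 1])"
      using normalized_points[OF f(1) v(2) f1(3) finP] by blast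
    have A3: "dehom f1 3 = [:chart_coeff f1 0 2:]"
    proof (rule poly_eqI)
      fix j :: nat
      consider "j = 0" | "j = 1" | "j = 2" | "j > 2" by linarith
      then show "coeff (dehom f1 3) j = coeff [:chart_coeff f1 0 2:] j"
        using c by cases (simp_all add: coeff_dehom_chart coeff_pCons numeral_2_eq_2 split: nat.split)
    qed
    have deg2: "degree (dehom f1 2) \<le> 2"
    proof (rule degree_le, intro allI impI)
      fix j :: nat assume "2 < j"
      then consider "j = 3" | "j > 3" by linarith
      then show "coeff (dehom f1 2) j = 0" using c30 by cases (simp_all add: coeff_dehom_chart)
    qed
    have tac': "(coeff (dehom f1 2) 2)\<^sup>2 = 4 * chart_coeff f1 0 2 * coeff (dehom f1 1) 4"
      using tac by (simp add: coeff_dehom_chart)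
    have T4: "card T = 4" using T(2) P(2) by simp
    show False
      by (rule no_double_point_configuration[OF f1(2,1) T(1) T4 T(3) dehom_high_zero[OF c(1,2,3)] A3 False deg2 tac'])
  next
    case True
    define X where "X p = (SOME t. \<exists>x. (fst t \<noteq> 0 \<or> snd t \<noteq> 0) \<and> p = vec.span {x *s v + fst t *s a + snd t *s b} \<and>
        degenerate f (x *s v + fst t *s a + snd t *s b))" for p
    have X: "\<exists>x. (fst (X p) \<noteq> 0 \<or> snd (X p) \<noteq> 0) \<and> p = vec.span {x *s v + fst (X p) *s a + snd (X p) *s b} \<and>
        degenerate f (x *s v + fst (X p) *s a + snd (X p) *s b)" if p: "p \<in> P" for p
      unfolding X_def 
    proof (rule someI_ex)
      obtain x y z where "y \<noteq> 0 \<or> z \<noteq> 0" "p = vec.span {x *s v + y *s a + z *s b}" "degenerate f (x *s v + y *s a + z *s b)"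
        using Pdeg[OF p] by blast
      then show "\<exists>t x. (fst t \<noteq> 0 \<or> snd t \<noteq> 0) \<and> p = vec.span {x *s v + fst t *s a + snd t *s b} \<and>
        degenerate f (x *s v + fst t *s a + snd t *s b)"
        by (intro exI[of _ "(y, z)"] exI[of _ x]) simp
    qed
    have "finite ((\<lambda>p. snd (X p) / fst (X p)) ` P)" using finP by simp
    \<comment> \<open>In the sheared basis the third coordinate is
      \<open>snd (X p) - l * fst (X p)\<close>. Avoiding finitely many slopes keeps all four points
      off the line \<open>z = 0\<close>; where \<open>fst (X p) = 0\<close> the coordinate is
      nonzero for any \<open>l\<close>, so the value 0 of the quotient does no harm.\<close>
    then obtain l where l: "l \<notin> (\<lambda>p. snd (X p) / fst (X p)) ` P"
      using ex_new_if_finite[OF infinite_UNIV_char_0] by blast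
    let ?a = "a + l *s b"
    have span': "vec.span {v, ?a, b} = UNIV" by (rule span_shear[OF v(2)])
    obtain f2 where f2: "squarefree f2" "homogeneous 5 f2"
      "\<And>x y z. eval3 f2 (vector [x, y, z]) = eval3 f (x *s v + y *s ?a + z *s b)"
      using change_of_basis[OF span' f(2,1)] by blast
    note c2 = chart_coeff_singular[OF q(1) vq f2(2,3)]
    have "\<exists>x y z. z \<noteq> 0 \<and> p = vec.span {x *s v + y *s ?a + z *s b} \<and> degenerate f (x *s v + y *s ?a + z *s b)"
      if p: "p \<in> P" for p
    proof -
      obtain x where x: "fst (X p) \<noteq> 0 \<or> snd (X p) \<noteq> 0" "p = vec.span {x *s v + fst (X p) *s a + snd (X p) *s b}"
        "degenerate f (x *s v + fst (X p) *s a + snd (X p) *s b)"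
        using X[OF p] by blast
      have e: "x *s v + fst (X p) *s a + snd (X p) *s b = x *s v + fst (X p) *s ?a + (snd (X p) - l * fst (X p)) *s b"
        by (simp add: vec_eq_iff algebra_simps)
      have "snd (X p) - l * fst (X p) \<noteq> 0"
      proof
        assume 0: "snd (X p) - l * fst (X p) = 0"
        then have "fst (X p) \<noteq> 0" using x(1) by auto
        then have "l = snd (X p) / fst (X p)" using 0 by (simp add: field_simps)
        then show False using l p by blast
      qed
      then show ?thesis using x(2,3) unfolding e by blast
    qed
    then obtain T where T: "finite T" "card T = card P" "\<And>x y. (x, y) \<in> T \<Longrightarrow> degenerate f2 (vector [x, y, 1])"
      using normalized_points[OF f(1) span' f2(3) finP] by blast
    \<comment> \<open>The shear only substitutes \<open>l * s + t\<close> for the second chart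
      coordinate, and the quadratic part of \<open>f1\<close> vanishes.\<close>
    have quad: "chart_coeff f2 2 0 * s\<^sup>2 + chart_coeff f2 1 1 * s * t + chart_coeff f2 0 2 * t\<^sup>2 = 0" for s t
    proof -
      have l2: "((\<lambda>e. eval3 f2 (vector [1 + e * 0, e * s, e * t]) / e\<^sup>2) \<longlongrightarrow>
          chart_coeff f2 2 0 * s\<^sup>2 + chart_coeff f2 1 1 * s * t + chart_coeff f2 0 2 * t\<^sup>2) (at 0)"
        by (rule chart_second_order[OF f2(2) c2])
      have l1: "((\<lambda>e. eval3 f1 (vector [1 + e * 0, e * s, e * (l * s + t)]) / e\<^sup>2) \<longlongrightarrow> 0) (at 0)"
        using chart_second_order[OF f1(2) c(1,2,3), of 0 s "l * s + t"] c(4,5) True by simp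
      have "eval3 f2 (vector [1 + e * 0, e * s, e * t]) = eval3 f1 (vector [1 + e * 0, e * s, e * (l * s + t)])" for e
      proof -
        have "(1 + e * 0) *s v + (e * s) *s ?a + (e * t) *s b = (1 + e * 0) *s v + (e * s) *s a + (e * (l * s + t)) *s b"
          by (simp add: vec_eq_iff algebra_simps)
        then show ?thesis by (simp only: f1(3) f2(3))
      qed
      then have "((\<lambda>e. eval3 f2 (vector [1 + e * 0, e * s, e * t]) / e\<^sup>2) \<longlongrightarrow> 0) (at 0)" using l1 by (simp only:)
      then show ?thesis by (rule tendsto_unique[OF at_neq_bot l2])
    qed
    note z = quadratic_form_zero[OF quad]
    have A3: "dehom f2 3 = 0"
    proof (rule poly_eqI)
      fix j :: nat
      consider "j = 0" | "j = 1" | "j = 2" | "j > 2" by linarith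
      then show "coeff (dehom f2 3) j = coeff 0 j"
        using z by cases (simp_all add: coeff_dehom_chart)
    qed
    have T4: "card T = 4" using T(2) P(2) by simp
    show False
      by (rule no_triple_point_configuration[OF f2(2,1) T(1) T4 T(3) A3 dehom_high_zero[OF c2]])
  qed
qed

end
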